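(* Let $\Gamma$ be a tropical curve. Two divisors on $\Gamma$ are linearly equivalent if and only if one can be attained from the other using chip firing moves.
   Context: A metric graph is a compact connected metric space in which every point has a neighborhood isometric to a star-shaped set with the path metric. A tropical curve is a metric graph in which the leaf edges may have length $\infty$, with a point at infinity added for each unbounded edge. Divisors are finite formal $\mathbb Z$-combinations of points of $\Gamma$. A tropical rational function is a continuous function $f$ on $\Gamma$, real-valued (except that it may attain values $\pm\infty$ at points at infinity), piecewise linear on each edge with finitely many pieces and integer slopes; $(f)=\sum_x\mathrm{ord}_x(f)\cdot x$, where $\mathrm{ord}_x(f)$ is the sum of the outgoing slopes of $f$ at $x$. Divisors $D$ and $D'$ are linearly equivalent if $D-D'=(f)$ for some tropical rational function $f$. A subgraph is a compact subset of $\Gamma$ with finitely many connected components. For a (not necessarily connected) subgraph $\Gamma'\subset\Gamma$ and a positive real number $l$, the chip firing move $CF(\Gamma',l)$ is the tropical rational function $CF(\Gamma',l)(x)=-\min(l,\mathrm{dist}(x,\Gamma'))$. Applying this move to a divisor $D$ gives $D+(CF(\Gamma',l))$; for small enough $l$ this moves one chip from the boundary of $\Gamma'$ along each edge out of $\Gamma'$ by distance $l$. Attaining one divisor from another using chip firing moves means applying finitely many such moves in succession; the intermediate divisors are not required to be effective.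
   Formalization: Linear equivalence is supplemented by requiring that the two divisors have equal coefficients at the points at infinity; otherwise the claim fails, e.g. (0) and (∞) on [0,∞], since moves with real l never change coefficients at infinity. The metric is taken to be the path metric. *)

theory Defs
  imports "HOL-Analysis.Analysis"
begin

(* The compact space is \<open>curve_top\<close>; \<open>inf_pts\<close> are its points at infinity, and \<open>path_dist\<close> is
   the path metric, meaningful between points that are not at infinity only. *)
record 'a curve_data =
  curve_top :: "'a topology"
  inf_pts :: "'a set"
  path_dist :: "'a \<Rightarrow> 'a \<Rightarrow> real"

definition points :: "'a curve_data \<Rightarrow> 'a set"
  where "points \<Gamma> = topspace (curve_top \<Gamma>)"

definition fin_pts :: "'a curve_data \<Rightarrow> 'a set"
  where "fin_pts \<Gamma> = points \<Gamma> - inf_pts \<Gamma>"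

definition neighbourhood :: "'a curve_data \<Rightarrow> 'a \<Rightarrow> 'a set \<Rightarrow> bool"
  where "neighbourhood \<Gamma> x N \<longleftrightarrow> (\<exists>U. openin (curve_top \<Gamma>) U \<and> x \<in> U \<and> U \<subseteq> N)"

(* An isometry from the star with n arms of length r onto a neighbourhood of x.
   The pair (k, t) stands for the point at distance t from the centre on the k-th arm, i.e. for
   t * exp (2 pi i k / n) in the complex plane; the path metric of the star is |s - t| on a
   common arm and s + t between different arms. The number n is the valence of x; n = 0 occurs
   only on the one-point curve. *)
definition star_chart :: "'a curve_data \<Rightarrow> 'a \<Rightarrow> nat \<Rightarrow> real \<Rightarrow> (nat \<Rightarrow> real \<Rightarrow> 'a) \<Rightarrow> bool"
  where "star_chart \<Gamma> x n r \<phi> \<longleftrightarrow>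
     0 < r \<and>
     (\<forall>k<n. \<phi> k 0 = x) \<and>
     (\<forall>k<n. \<forall>t\<in>{0..<r}. \<phi> k t \<in> fin_pts \<Gamma>) \<and>
     (\<forall>j<n. \<forall>k<n. \<forall>s\<in>{0..<r}. \<forall>t\<in>{0..<r}.
        path_dist \<Gamma> (\<phi> j s) (\<phi> k t) = (if j = k then \<bar>s - t\<bar> else s + t)) \<and>
     neighbourhood \<Gamma> x (insert x {\<phi> k t | k t. k < n \<and> 0 \<le> t \<and> t < r})"

(* An unbounded leaf edge with its point p at infinity: \<open>\<rho>\<close> is an isometric copy of [0, \<infinity>) that
   converges to p, and its points other than \<open>\<rho> 0\<close> form with p an open subset of the curve. *)
definition end_chart :: "'a curve_data \<Rightarrow> 'a \<Rightarrow> (real \<Rightarrow> 'a) \<Rightarrow> bool"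
  where "end_chart \<Gamma> p \<rho> \<longleftrightarrow>
     (\<forall>t\<ge>0. \<rho> t \<in> fin_pts \<Gamma>) \<and>
     (\<forall>s\<ge>0. \<forall>t\<ge>0. path_dist \<Gamma> (\<rho> s) (\<rho> t) = \<bar>s - t\<bar>) \<and>
     limitin (curve_top \<Gamma>) \<rho> p at_top \<and>
     openin (curve_top \<Gamma>) (insert p (\<rho> ` {0<..}))"

(* The penultimate condition makes \<open>path_dist\<close> the path metric globally (shortest paths exist by
   compactness); the star condition alone constrains distances only locally. *)
definition tropical_curve :: "'a curve_data \<Rightarrow> bool"
  where "tropical_curve \<Gamma> \<longleftrightarrow>
     points \<Gamma> \<noteq> {} \<and>
     compact_space (curve_top \<Gamma>) \<and>
     connected_space (curve_top \<Gamma>) \<and>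
     Hausdorff_space (curve_top \<Gamma>) \<and>
     finite (inf_pts \<Gamma>) \<and> inf_pts \<Gamma> \<subseteq> points \<Gamma> \<and>
     Metric_space (fin_pts \<Gamma>) (path_dist \<Gamma>) \<and>
     Metric_space.mtopology (fin_pts \<Gamma>) (path_dist \<Gamma>)
       = subtopology (curve_top \<Gamma>) (fin_pts \<Gamma>) \<and>
     (\<forall>x\<in>fin_pts \<Gamma>. \<exists>n r \<phi>. star_chart \<Gamma> x n r \<phi>) \<and>
     (\<forall>x\<in>fin_pts \<Gamma>. \<forall>y\<in>fin_pts \<Gamma>. \<exists>\<gamma>.
        \<gamma> 0 = x \<and> \<gamma> (path_dist \<Gamma> x y) = y \<and>
        (\<forall>s\<in>{0..path_dist \<Gamma> x y}. \<gamma> s \<in> fin_pts \<Gamma>) \<and>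
        (\<forall>s\<in>{0..path_dist \<Gamma> x y}. \<forall>t\<in>{0..path_dist \<Gamma> x y}.
           path_dist \<Gamma> (\<gamma> s) (\<gamma> t) = \<bar>s - t\<bar>)) \<and>
     (\<forall>p\<in>inf_pts \<Gamma>. \<exists>\<rho>. end_chart \<Gamma> p \<rho>)"

definition divisor :: "'a curve_data \<Rightarrow> ('a \<Rightarrow> int) \<Rightarrow> bool"
  where "divisor \<Gamma> D \<longleftrightarrow> finite {x. D x \<noteq> 0} \<and> {x. D x \<noteq> 0} \<subseteq> points \<Gamma>"

(* S contains the vertices (valence different from 2), the break points of f and the points at
   infinity. The components of the complement of S are finitely many open segments (or a single
   circle), and a function on such a component is linear of slope m iff it is so locally. *)
definition piecewise_linear :: "'a curve_data \<Rightarrow> ('a \<Rightarrow> ereal) \<Rightarrow> bool"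
  where "piecewise_linear \<Gamma> f \<longleftrightarrow>
     (\<exists>S. finite S \<and> inf_pts \<Gamma> \<subseteq> S \<and>
        (\<forall>x\<in>points \<Gamma> - S. \<exists>r \<phi> (m::int). star_chart \<Gamma> x 2 r \<phi> \<and>
           (\<forall>t\<in>{0..<r}. f (\<phi> 0 t) = f x + ereal (m * t) \<and>
                         f (\<phi> 1 t) = f x - ereal (m * t))))"

definition rational_function :: "'a curve_data \<Rightarrow> ('a \<Rightarrow> ereal) \<Rightarrow> bool"
  where "rational_function \<Gamma> f \<longleftrightarrow>
     continuous_map (curve_top \<Gamma>) euclidean f \<and>
     (\<forall>x\<in>fin_pts \<Gamma>. \<bar>f x\<bar> \<noteq> \<infinity>) \<and>
     piecewise_linear \<Gamma> f"

definition outgoing_slope :: "('a \<Rightarrow> ereal) \<Rightarrow> (real \<Rightarrow> 'a) \<Rightarrow> real"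
  where "outgoing_slope f \<gamma> =
     Lim (at_right 0) (\<lambda>t. (real_of_ereal (f (\<gamma> t)) - real_of_ereal (f (\<gamma> 0))) / t)"

(* Slope in the direction that points away from infinity, i.e. of decreasing t. *)
definition outgoing_slope_inf :: "('a \<Rightarrow> ereal) \<Rightarrow> (real \<Rightarrow> 'a) \<Rightarrow> real"
  where "outgoing_slope_inf f \<rho> =
     Lim at_top (\<lambda>t. real_of_ereal (f (\<rho> t)) - real_of_ereal (f (\<rho> (t + 1))))"

(* Two star charts at x agree near x up to a permutation of the arms, and two end charts at p
   differ by a shift of the parameter, so the values do not depend on the charts chosen. *)
definition ord_at :: "'a curve_data \<Rightarrow> ('a \<Rightarrow> ereal) \<Rightarrow> 'a \<Rightarrow> real"
  where "ord_at \<Gamma> f x =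
     (if x \<in> inf_pts \<Gamma> then outgoing_slope_inf f (SOME \<rho>. end_chart \<Gamma> x \<rho>)
      else (case (SOME (n, \<phi>). \<exists>r. star_chart \<Gamma> x n r \<phi>) of
              (n, \<phi>) \<Rightarrow> \<Sum>k<n. outgoing_slope f (\<phi> k)))"

definition linearly_equivalent :: "'a curve_data \<Rightarrow> ('a \<Rightarrow> int) \<Rightarrow> ('a \<Rightarrow> int) \<Rightarrow> bool"
  where "linearly_equivalent \<Gamma> D D' \<longleftrightarrow>
     (\<exists>f. rational_function \<Gamma> f \<and>
          (\<forall>x\<in>points \<Gamma>. of_int (D x - D' x) = ord_at \<Gamma> f x))"

definition subgraph :: "'a curve_data \<Rightarrow> 'a set \<Rightarrow> bool"
  where "subgraph \<Gamma> A \<longleftrightarrow>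
     compactin (curve_top \<Gamma>) A \<and>
     finite (connected_components_of (subtopology (curve_top \<Gamma>) A))"

definition ext_dist :: "'a curve_data \<Rightarrow> 'a \<Rightarrow> 'a \<Rightarrow> ereal"
  where "ext_dist \<Gamma> x y =
     (if x = y then 0
      else if x \<in> inf_pts \<Gamma> \<or> y \<in> inf_pts \<Gamma> then \<infinity>
      else ereal (path_dist \<Gamma> x y))"

definition dist_to_set :: "'a curve_data \<Rightarrow> 'a \<Rightarrow> 'a set \<Rightarrow> ereal"
  where "dist_to_set \<Gamma> x A = (INF y\<in>A. ext_dist \<Gamma> x y)"

(* If a point p at infinity is isolated in the subgraph A, then CF A l jumps at p. Orders do not
   see the value at p, so such a move has the same divisor as the one for A without p. *)
definition CF :: "'a curve_data \<Rightarrow> 'a set \<Rightarrow> real \<Rightarrow> 'a \<Rightarrow> ereal"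
  where "CF \<Gamma> A l x = - min (ereal l) (dist_to_set \<Gamma> x A)"

definition chip_firing_step :: "'a curve_data \<Rightarrow> ('a \<Rightarrow> int) \<Rightarrow> ('a \<Rightarrow> int) \<Rightarrow> bool"
  where "chip_firing_step \<Gamma> D D' \<longleftrightarrow>
     divisor \<Gamma> D \<and> divisor \<Gamma> D' \<and>
     (\<exists>A l. subgraph \<Gamma> A \<and> 0 < l \<and>
        (\<forall>x\<in>points \<Gamma>. of_int (D' x) = of_int (D x) + ord_at \<Gamma> (CF \<Gamma> A l) x))"

(* As l is real, chip firing functions are bounded, so no move changes the coefficient of a
   divisor at a point at infinity, whereas linear equivalence may change it: on [0, \<infinity>] the
   function f(x) = x gives the divisor (0) - (\<infinity>). *)
definition attainable_from :: "'a curve_data \<Rightarrow> ('a \<Rightarrow> int) \<Rightarrow> ('a \<Rightarrow> int) \<Rightarrow> bool"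
  where "attainable_from \<Gamma> D D' \<longleftrightarrow> (chip_firing_step \<Gamma>)\<^sup>*\<^sup>* D D'"

end

theory Submission
  imports Defs
begin

text \<open>
  A bounded rational function \<open>g\<close> takes only finitely many critical values, a value being critical if
  it is attained at a vertex, at a bend or on a flat piece. Clipping \<open>g\<close> to the intervals between
  consecutive critical values writes it as a sum of slabs. Over the open interval from \<open>a\<close> to \<open>c\<close>,
  \<open>g\<close> consists of disjoint edges with nonzero integer slopes \<open>s\<close>, each of length \<open>(c - a) / s\<close>. Let \<open>N\<close>
  be a common multiple of the slopes and \<open>l = (c - a) / N\<close>. Every such edge splits into \<open>N / s\<close> pieces of
  length \<open>l\<close>; moving \<open>s\<close> chips across each piece, one per move, crosses all edges in exactly \<open>N\<close>
  simultaneous moves of length \<open>l\<close>. Each of these moves is minus a function with values in \<open>[0, l]\<close>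
  and slopes in \<open>{-1, 0, 1}\<close> that has a descending direction wherever it lies strictly between \<open>0\<close> and
  \<open>l\<close>, and such a function is the distance to its zero set, truncated at \<open>l\<close>.

  Conversely, the distance to a subgraph is piecewise linear because each arm of a star either
  lies in the subgraph near its centre or avoids it there: otherwise the subgraph would have
  infinitely many components.
\<close>

text \<open>A distance is global: along one edge it can be cut short by a path through another part
  of the curve. Hence no distance is computed when a move is built. The criterion for truncated
  distances is local: slopes of absolute value at most 1 bound the function above by the distance to
  its zero set, and the descending directions lead to a zero at no greater distance than the value.
  Both conditions can be checked arm by arm. Cutting at critical values serves the same purpose.
  Inside a slab there is no vertex, so edges of different slope do not interact; they meet only at
  the two boundary values, where every move is constantly \<open>0\<close> or \<open>l\<close>,
  whatever the slope. Points at infinity are removed from the argument at the outset. If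
  \<open>D\<close> and \<open>D'\<close> agree there, the rational function has order 0 at each end,
  hence is constant near it. The proof therefore works with real functions on the finite points
  \<open>F\<close> that are locally constant at the ends; their values at the ends are ignored, and
  are restored only when continuity on the whole curve is required.\<close>

lemma locally_affine_imp_affine:
  fixes F :: "real \<Rightarrow> real"
  assumes conv: "\<And>x y z. x \<in> I \<Longrightarrow> y \<in> I \<Longrightarrow> x \<le> z \<Longrightarrow> z \<le> y \<Longrightarrow> z \<in> I"
    and loc: "\<And>x. x \<in> I \<Longrightarrow> \<exists>m::int. \<exists>e>0. \<forall>y. \<bar>y - x\<bar> < e \<longrightarrow> F y = F x + real_of_int m * (y - x)"
  shows "\<exists>m::int. \<forall>x\<in>I. \<forall>y\<in>I. F y = F x + real_of_int m * (y - x)"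
proof -
  have "\<forall>x\<in>I. \<exists>m::int. \<exists>e>0. \<forall>y. \<bar>y - x\<bar> < e \<longrightarrow> F y = F x + real_of_int m * (y - x)"
    using loc by blast
  from bchoice[OF this] obtain G :: "real \<Rightarrow> int" where
    G: "\<And>x. x \<in> I \<Longrightarrow> \<exists>e>0. \<forall>y. \<bar>y - x\<bar> < e \<longrightarrow> F y = F x + real_of_int (G x) * (y - x)"
    by blast
  \<comment> \<open>The chosen slope is determined by the values nearby, so it is locally constant.
    Bisection (\<open>Bolzano\<close>) then makes it constant on \<open>I\<close>, and a second
    bisection glues the local affine formulas.\<close>
  have Gloc: "\<exists>e>0. \<forall>y\<in>I. \<bar>y - x\<bar> < e \<longrightarrow> G y = G x" if x: "x \<in> I" for x
  proof -
    obtain e where e: "e > 0" "\<And>y. \<bar>y - x\<bar> < e \<Longrightarrow> F y = F x + real_of_int (G x) * (y - x)"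
      using G[OF x] by blast
    have "G y = G x" if y: "y \<in> I" "\<bar>y - x\<bar> < e" for y
    proof -
      obtain e' where e': "e' > 0" "\<And>z. \<bar>z - y\<bar> < e' \<Longrightarrow> F z = F y + real_of_int (G y) * (z - y)"
        using G[OF y(1)] by blast
      \<comment> \<open>A point other than \<open>y\<close> at which both local formulas hold;
        comparing them there forces equal slopes.\<close>
      define z where "z = y + min e' (e - \<bar>y - x\<bar>) / 2"
      have z: "\<bar>z - y\<bar> < e'" "\<bar>z - x\<bar> < e" "z \<noteq> y"
        using e' y unfolding z_def by (auto simp: min_def abs_if field_simps)
      have "real_of_int (G y) * (z - y) = real_of_int (G x) * (z - y)"
        using e(2)[OF z(2)] e(2)[OF y(2)] e'(2)[OF z(1)] by (simp add: algebra_simps)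
      with z(3) show ?thesis by simp
    qed
    with e(1) show ?thesis by blast
  qed
  have Geq: "G a = G b" if "a \<in> I" "b \<in> I" "a \<le> b" for a b
  proof -
    have "a \<in> I \<longrightarrow> b \<in> I \<longrightarrow> G a = G b"
      using \<open>a \<le> b\<close>
    proof (induction rule: Bolzano)
      case (trans a b c) then show ?case using conv by metis
    next
      case (local x)
      then have "x \<in> I" using conv that by blast
      then obtain e where e: "e > 0" "\<And>y. y \<in> I \<Longrightarrow> \<bar>y - x\<bar> < e \<Longrightarrow> G y = G x"
        using Gloc by blast
      have "G u = G v" if "u \<le> x" "x \<le> v" "v - u < e" "u \<in> I" "v \<in> I" for u v
        using e(2)[of u] e(2)[of v] that by auto
      with e(1) show ?case by blast
    qed
    with that show ?thesis by blast
  qed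
  have aff: "F b = F a + real_of_int (G a) * (b - a)" if "a \<in> I" "b \<in> I" "a \<le> b" for a b
  proof -
    have "a \<in> I \<longrightarrow> b \<in> I \<longrightarrow> F b = F a + real_of_int (G a) * (b - a)"
      using \<open>a \<le> b\<close>
    proof (induction rule: Bolzano)
      case (trans a b c)
      show ?case
      proof (intro impI)
        assume ac: "a \<in> I" "c \<in> I"
        then have b: "b \<in> I" using conv trans by blast
        then have "G a = G b" using Geq ac trans by blast
        then show "F c = F a + real_of_int (G a) * (c - a)" using trans ac b by (simp add: algebra_simps)
      qed
    next
      case (local x)
      then have x: "x \<in> I" using conv that by blast
      then obtain e where e: "e > 0" "\<And>y. \<bar>y - x\<bar> < e \<Longrightarrow> F y = F x + real_of_int (G x) * (y - x)"
        using G by blast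
      have "F v = F u + real_of_int (G u) * (v - u)" if "u \<le> x" "x \<le> v" "v - u < e" "u \<in> I" "v \<in> I" for u v
        using e(2)[of u] e(2)[of v] that Geq[of u x] x by (auto simp: algebra_simps)
      with e(1) show ?case by blast
    qed
    with that show ?thesis by blast
  qed
  show ?thesis
  proof (cases "I = {}")
    case False
    then obtain a where a: "a \<in> I" by blast
    have Ga: "G x = G a" if "x \<in> I" for x
      using Geq[of x a] Geq[of a x] a that by linarith
    have "F y = F x + real_of_int (G a) * (y - x)" if "x \<in> I" "y \<in> I" for x y
    proof (cases "x \<le> y")
      case True then show ?thesis using aff[of x y] Ga that by simp
    next
      case False then show ?thesis using aff[of y x] Ga that by (simp add: algebra_simps)
    qed
    then show ?thesis by blast
  qed simp
qed

text \<open>The local bound compares points only with the centre \<open>s\<close>, not with each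
  other. Bisection needs no more, since it only asks about short intervals that contain
  \<open>s\<close>.\<close>

lemma pointwise_nonexpanding_imp_nonexpanding:
  fixes F :: "real \<Rightarrow> real"
  assumes "a \<le> b"
    and loc: "\<And>s. a \<le> s \<Longrightarrow> s \<le> b \<Longrightarrow>
      \<exists>e>0. \<forall>t\<in>{a..b}. \<bar>t - s\<bar> < e \<longrightarrow> \<bar>F t - F s\<bar> \<le> \<bar>t - s\<bar>"
  shows "\<bar>F b - F a\<bar> \<le> b - a"
proof -
  have "x \<in> {a..b} \<longrightarrow> y \<in> {a..b} \<longrightarrow> \<bar>F y - F x\<bar> \<le> y - x" if xy: "x \<le> y" "a \<le> x" "y \<le> b" for x y
    using \<open>x \<le> y\<close>
  proof (induction rule: Bolzano)
    case (trans a b c)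
    then show ?case by auto
  next
    case (local s)
    then obtain e where e: "e > 0" "\<And>t. t \<in> {a..b} \<Longrightarrow> \<bar>t - s\<bar> < e \<Longrightarrow> \<bar>F t - F s\<bar> \<le> \<bar>t - s\<bar>"
      using loc[of s] xy by (meson order_trans)
    have "\<bar>F v - F u\<bar> \<le> v - u" if "u \<le> s" "s \<le> v" "v - u < e" "u \<in> {a..b}" "v \<in> {a..b}" for u v
      using e(2)[of u] e(2)[of v] that by auto
    with e(1) show ?case by blast
  qed
  from this[of a b] assms(1) show ?thesis by simp
qed

section \<open>Clamping to an interval, and tiling an interval by clamps\<close>

definition ramp :: "real \<Rightarrow> real \<Rightarrow> real"
  where "ramp l v = min l (max 0 v)"

lemma eventually_affine_less:
  fixes A B \<mu> :: real
  assumes "A < B" shows "\<forall>\<^sub>F t in at_right 0. A + \<mu> * t < B"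
proof -
  have "((\<lambda>t. A + \<mu> * t) \<longlongrightarrow> A + \<mu> * 0) (at_right 0)" by (intro tendsto_intros)
  from order_tendstoD(2)[OF this, of B] show ?thesis using assms by simp
qed

lemma eventually_affine_greater:
  fixes A B \<mu> :: real
  assumes "B < A" shows "\<forall>\<^sub>F t in at_right 0. B < A + \<mu> * t"
proof -
  have "((\<lambda>t. A + \<mu> * t) \<longlongrightarrow> A + \<mu> * 0) (at_right 0)" by (intro tendsto_intros)
  from order_tendstoD(1)[OF this, of B] show ?thesis using assms by simp
qed

text \<open>At the corners \<open>v = 0\<close> and \<open>v = l\<close> the slope becomes the
  positive or the negative part of \<open>\<sigma>\<close>, so it stays in
  \<open>{-1, 0, 1}\<close>. The last conjunct later supplies the descending direction at values
  strictly between \<open>0\<close> and \<open>l\<close>.\<close>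

lemma ramp_slope:
  assumes l: "0 < l" and \<sigma>: "\<bar>\<sigma>::int\<bar> \<le> 1"
  shows "\<exists>m::int. \<bar>m\<bar> \<le> (1::int) \<and>
    (\<forall>\<^sub>F t in at_right 0. ramp l (v + real_of_int \<sigma> * t) = ramp l v + real_of_int m * t) \<and>
    (0 < ramp l v \<and> ramp l v < l \<longrightarrow> m = \<sigma>)"
proof -
  have pos: "\<forall>\<^sub>F t in at_right (0::real). 0 < t" by (simp add: eventually_at_right_less)
  consider "v < 0 \<or> v > l" | "0 < v" "v < l" | "v = 0" | "v = l" by linarith
  then show ?thesis
  proof cases
    case 1
    then show ?thesis
    proof
      assume "v < 0"
      from eventually_affine_less[OF this, of "real_of_int \<sigma>"]
      have "\<forall>\<^sub>F t in at_right 0. ramp l (v + real_of_int \<sigma> * t) = ramp l v + real_of_int 0 * t"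
        by (rule eventually_mono) (use l \<open>v < 0\<close> in \<open>auto simp: ramp_def\<close>)
      then show ?thesis using \<open>v < 0\<close> l by (intro exI[of _ 0]) (auto simp: ramp_def)
    next
      assume "v > l"
      from eventually_affine_greater[OF this, of "real_of_int \<sigma>"]
      have "\<forall>\<^sub>F t in at_right 0. ramp l (v + real_of_int \<sigma> * t) = ramp l v + real_of_int 0 * t"
        by (rule eventually_mono) (use l \<open>v > l\<close> in \<open>auto simp: ramp_def\<close>)
      then show ?thesis using \<open>v > l\<close> l by (intro exI[of _ 0]) (auto simp: ramp_def)
    qed
  next
    case 2
    from eventually_conj[OF eventually_affine_less[OF 2(2), of "real_of_int \<sigma>"]
        eventually_affine_greater[OF 2(1), of "real_of_int \<sigma>"]]
    have "\<forall>\<^sub>F t in at_right 0. ramp l (v + real_of_int \<sigma> * t) = ramp l v + real_of_int \<sigma> * t"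
      by (rule eventually_mono) (use 2 in \<open>auto simp: ramp_def\<close>)
    then show ?thesis using \<sigma> by blast
  next
    case 3
    from eventually_conj[OF pos eventually_affine_less[OF l, of "real_of_int \<sigma>"]]
    have "\<forall>\<^sub>F t in at_right 0. ramp l (v + real_of_int \<sigma> * t) = ramp l v + real_of_int (max 0 \<sigma>) * t"
    proof (rule eventually_mono)
      fix t assume t: "0 < t \<and> 0 + real_of_int \<sigma> * t < l"
      consider "\<sigma> = 1" | "\<sigma> = 0" | "\<sigma> = - 1" using \<sigma> by linarith
      then show "ramp l (v + real_of_int \<sigma> * t) = ramp l v + real_of_int (max 0 \<sigma>) * t"
        by cases (use 3 l t in \<open>auto simp: ramp_def\<close>)
    qed
    then show ?thesis using \<sigma> 3 l by (intro exI[of _ "max 0 \<sigma>"]) (auto simp: ramp_def)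
  next
    case 4
    from eventually_conj[OF pos eventually_affine_greater[OF l, of "real_of_int \<sigma>"]]
    have "\<forall>\<^sub>F t in at_right 0. ramp l (v + real_of_int \<sigma> * t) = ramp l v + real_of_int (min 0 \<sigma>) * t"
    proof (rule eventually_mono)
      fix t assume t: "0 < t \<and> 0 < l + real_of_int \<sigma> * t"
      consider "\<sigma> = 1" | "\<sigma> = 0" | "\<sigma> = - 1" using \<sigma> by linarith
      then show "ramp l (v + real_of_int \<sigma> * t) = ramp l v + real_of_int (min 0 \<sigma>) * t"
        by cases (use 4 l t in \<open>auto simp: ramp_def\<close>)
    qed
    then show ?thesis using \<sigma> 4 l by (intro exI[of _ "min 0 \<sigma>"]) (auto simp: ramp_def)
  qed
qed

lemma ramp_add:
  assumes "0 \<le> w" "0 < l"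
  shows "min (max 0 v) w + ramp l (v - w) = min (max 0 v) (w + l)"
  using assms unfolding ramp_def by (auto simp: min_def max_def)

text \<open>The ramps with offsets \<open>q * l\<close> tile the interval from \<open>0\<close> to
  \<open>P * l\<close>: by \<open>ramp_add\<close> each one raises the upper clamp by
  \<open>l\<close>.\<close>

lemma sum_ramp:
  assumes "0 < l"
  shows "(\<Sum>q<P. ramp l (v - real q * l)) = min (max 0 v) (real P * l)"
proof (induction P)
  case (Suc P)
  have "0 \<le> real P * l" using assms by simp
  note ramp_add[OF this assms, of v]
  then show ?case using Suc by (simp add: algebra_simps)
qed simp

text \<open>Each quotient \<open>q\<close> occurs for \<open>s\<close> consecutive indices. This
  counts the \<open>s\<close> moves that an edge of slope \<open>s\<close> spends on each of its
  pieces.\<close>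

lemma sum_div_blocks:
  fixes f :: "nat \<Rightarrow> real"
  assumes "0 < s" shows "(\<Sum>j<P * s. f (j div s)) = real s * (\<Sum>q<P. f q)"
proof -
  have "(\<Sum>j<P * s. f (j div s)) = (\<Sum>q<P. \<Sum>j\<in>{q * s..<q * s + s}. f (j div s))"
    by (rule sum.nat_group[symmetric])
  also have "\<dots> = (\<Sum>q<P. \<Sum>j\<in>{q * s..<q * s + s}. f q)"
  proof (intro sum.cong refl)
    fix q j assume "j \<in> {q * s..<q * s + s}"
    then have "j div s = q" using assms by (intro div_nat_eqI) (auto simp: algebra_simps)
    then show "f (j div s) = f q" by simp
  qed
  also have "\<dots> = real s * (\<Sum>q<P. f q)" by (simp add: sum_distrib_left)
  finally show ?thesis .
qed

subsection \<open>Segments and star charts\<close>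

locale tropical =
  fixes \<Gamma> :: "'a curve_data"
  assumes tropical: "tropical_curve \<Gamma>"
begin

abbreviation "X \<equiv> curve_top \<Gamma>"
abbreviation "F \<equiv> fin_pts \<Gamma>"
abbreviation "d \<equiv> path_dist \<Gamma>"
abbreviation "ends \<equiv> inf_pts \<Gamma>"

sublocale Metric_space F d
  using tropical unfolding tropical_curve_def by blast

lemma points_eq: "points \<Gamma> = F \<union> ends"
  using tropical unfolding tropical_curve_def fin_pts_def by auto

lemma F_inf_disjoint: "F \<inter> ends = {}"
  by (auto simp: fin_pts_def)

lemma topspace_X: "topspace X = F \<union> ends"
  using points_eq by (simp add: points_def)

lemma Hausdorff_X: "Hausdorff_space X"
  and compact_X: "compact_space X"
  and finite_inf: "finite ends"
  and chart_ex: "x \<in> F \<Longrightarrow> \<exists>n r \<phi>. star_chart \<Gamma> x n r \<phi>"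
  and end_chart_ex: "p \<in> ends \<Longrightarrow> \<exists>\<rho>. end_chart \<Gamma> p \<rho>"
  and geodesic_ex: "x \<in> F \<Longrightarrow> y \<in> F \<Longrightarrow> \<exists>\<gamma>. \<gamma> 0 = x \<and> \<gamma> (d x y) = y \<and>
        (\<forall>s\<in>{0..d x y}. \<gamma> s \<in> F) \<and>
        (\<forall>s\<in>{0..d x y}. \<forall>t\<in>{0..d x y}. d (\<gamma> s) (\<gamma> t) = \<bar>s - t\<bar>)"
  and mtop: "mtopology = subtopology X F"
  using tropical unfolding tropical_curve_def by blast+

text \<open>The finitely many ends form a closed set in a Hausdorff space. As a consequence metric
  balls are open in the whole curve, and local arguments at finite points can be made with the
  metric.\<close>

lemma openin_F: "openin X F"
proof -
  have "closedin X ends"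
    using closedin_Hausdorff_finite[OF Hausdorff_X] finite_inf topspace_X by auto
  then have "openin X (topspace X - ends)" by (simp add: closedin_def)
  moreover have "topspace X - ends = F" using topspace_X F_inf_disjoint by auto
  ultimately show ?thesis by simp
qed

lemma openin_finite_iff:
  "U \<subseteq> F \<Longrightarrow> openin X U \<longleftrightarrow> (\<forall>x\<in>U. \<exists>r>0. mball x r \<subseteq> U)"
  using openin_open_subtopology[OF openin_F, of U] openin_mtopology[of U]
  unfolding mtop by auto

lemma openin_mball_X: "openin X (mball x r)"
  using openin_open_subtopology[OF openin_F, of "mball x r"] openin_mball[of x r]
  unfolding mtop by auto

lemma open_contains_mball:
  assumes "openin X U" "x \<in> U" "x \<in> F"
  shows "\<exists>r>0. mball x r \<subseteq> U"
proof -
  have "openin X (U \<inter> F)" using assms openin_F by blast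
  then show ?thesis using openin_finite_iff[of "U \<inter> F"] assms by (meson IntI Int_lower2 le_infE)
qed

definition isometric_on :: "real set \<Rightarrow> (real \<Rightarrow> 'a) \<Rightarrow> bool"
  where "isometric_on I \<alpha> \<longleftrightarrow> (\<forall>s\<in>I. \<alpha> s \<in> F) \<and> (\<forall>s\<in>I. \<forall>t\<in>I. d (\<alpha> s) (\<alpha> t) = \<bar>s - t\<bar>)"

lemma isometric_on_subset: "isometric_on I \<alpha> \<Longrightarrow> J \<subseteq> I \<Longrightarrow> isometric_on J \<alpha>"
  unfolding isometric_on_def by blast

lemma isometric_on_continuous:
  assumes "isometric_on I \<alpha>"
  shows "continuous_map (top_of_set I) X \<alpha>"
proof -
  have "continuous_map (subtopology Met_TC.mtopology I) mtopology \<alpha>"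
  proof (subst continuous_map_to_metric, intro ballI allI impI, goal_cases)
    case (1 t \<epsilon>)
    then have t: "t \<in> I" by simp
    have "openin (top_of_set I) (I \<inter> ball t \<epsilon>)" by (simp add: openin_open_Int)
    moreover have "t \<in> I \<inter> ball t \<epsilon>" using t 1 by simp
    moreover have "\<alpha> s \<in> mball (\<alpha> t) \<epsilon>" if "s \<in> I \<inter> ball t \<epsilon>" for s
      using that t assms by (auto simp: isometric_on_def dist_real_def)
    ultimately show ?case by auto
  qed
  then show ?thesis unfolding mtop
    using continuous_map_into_fulltopology by auto
qed

lemma isometric_connected:
  assumes "isometric_on I \<alpha>" "J \<subseteq> I" "connected J"
  shows "connectedin X (\<alpha> ` J)"
  using connectedin_continuous_map_image[OF isometric_on_continuous[OF assms(1)], of J] assms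
  by (simp add: connectedin_subtopology)

lemma isometric_compact:
  assumes "isometric_on I \<alpha>" "J \<subseteq> I" "compact J"
  shows "compactin X (\<alpha> ` J)"
  using image_compactin[OF _ isometric_on_continuous[OF assms(1)], of J] assms
  by (simp add: compactin_subtopology)

lemma isometric_closed:
  assumes "isometric_on I \<alpha>" "J \<subseteq> I" "compact J"
  shows "closedin X (\<alpha> ` J)"
  using compactin_imp_closedin[OF Hausdorff_X isometric_compact[OF assms]] .

lemma isometric_inj:
  assumes "isometric_on I \<alpha>" "s \<in> I" "t \<in> I" "\<alpha> s = \<alpha> t" shows "s = t"
  using assms mdist_zero unfolding isometric_on_def by fastforce

text \<open>A bare isometric path may run through a branch point. Openness of the interior excludes
  this: interior points have valence 2 (\<open>segment_chart\<close>), and a connected set can leave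
  the interior only through an endpoint (\<open>connected_in_segment\<close>).\<close>

definition segment :: "real \<Rightarrow> real \<Rightarrow> (real \<Rightarrow> 'a) \<Rightarrow> bool"
  where "segment a b \<alpha> \<longleftrightarrow> isometric_on {a..b} \<alpha> \<and> openin X (\<alpha> ` {a<..<b})"

lemma segment_F: "segment a b \<alpha> \<Longrightarrow> a \<le> t \<Longrightarrow> t \<le> b \<Longrightarrow> \<alpha> t \<in> F"
  unfolding segment_def isometric_on_def by auto

lemma segment_d: "segment a b \<alpha> \<Longrightarrow> a \<le> t \<Longrightarrow> t \<le> b \<Longrightarrow> a \<le> s \<Longrightarrow> s \<le> b \<Longrightarrow> d (\<alpha> s) (\<alpha> t) = \<bar>s - t\<bar>"
  unfolding segment_def isometric_on_def by auto

text \<open>Openness of the smaller interior: it is the larger one intersected with the ball about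
  the midpoint of \<open>a'\<close> and \<open>b'\<close>.\<close>

lemma segment_subset:
  assumes "segment a b \<alpha>" "a \<le> a'" "b' \<le> b"
  shows "segment a' b' \<alpha>"
proof -
  have iso: "isometric_on {a'..b'} \<alpha>"
    using assms unfolding segment_def by (auto elim!: isometric_on_subset)
  have "openin X (\<alpha> ` {a'<..<b'})"
  proof (cases "a' < b'")
    case True
    define m where "m = (a' + b') / 2"
    have m: "a' < m" "m < b'" using True by (auto simp: m_def)
    have "\<alpha> ` {a'<..<b'} = \<alpha> ` {a<..<b} \<inter> mball (\<alpha> m) ((b' - a') / 2)"
    proof (intro equalityI subsetI)
      fix y assume "y \<in> \<alpha> ` {a'<..<b'}"
      then obtain v where "y = \<alpha> v" "a' < v" "v < b'" by auto
      moreover from this have "\<bar>m - v\<bar> < (b' - a') / 2"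
        unfolding m_def abs_less_iff by (auto simp: field_simps)
      ultimately show "y \<in> \<alpha> ` {a<..<b} \<inter> mball (\<alpha> m) ((b' - a') / 2)"
        using assms m segment_d[OF assms(1), of v m] segment_F[OF assms(1)] by auto
    next
      fix y assume "y \<in> \<alpha> ` {a<..<b} \<inter> mball (\<alpha> m) ((b' - a') / 2)"
      then obtain v where v: "y = \<alpha> v" "a < v" "v < b" "d (\<alpha> m) (\<alpha> v) < (b' - a') / 2" by auto
      then have "\<bar>m - v\<bar> < (b' - a') / 2" using segment_d[OF assms(1), of v m] m assms by auto
      then have "a' < v" "v < b'" unfolding m_def abs_less_iff by (auto simp: field_simps)
      then show "y \<in> \<alpha> ` {a'<..<b'}" using v by auto
    qed
    moreover have "openin X (\<alpha> ` {a<..<b})" using assms(1) unfolding segment_def by blast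
    ultimately show ?thesis using openin_mball_X by auto
  next
    case False then show ?thesis by simp
  qed
  with iso show ?thesis unfolding segment_def by blast
qed

lemma segment_chart:
  assumes "segment a b \<alpha>" "a < v" "v < b"
  shows "star_chart \<Gamma> (\<alpha> v) 2 (min (v - a) (b - v)) (\<lambda>k t. if k = 0 then \<alpha> (v + t) else \<alpha> (v - t))"
proof -
  let ?r = "min (v - a) (b - v)"
  let ?\<phi> = "\<lambda>(k::nat) t. if k = 0 then \<alpha> (v + t) else \<alpha> (v - t)"
  note F = segment_F[OF assms(1)]
  have d: "d (\<alpha> s) (\<alpha> t) = \<bar>s - t\<bar>" if "a \<le> s" "s \<le> b" "a \<le> t" "t \<le> b" for s t
    using segment_d[OF assms(1)] that by blast
  have "openin X (\<alpha> ` {v - ?r<..<v + ?r})"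
    using segment_subset[OF assms(1), of "v - ?r" "v + ?r"] unfolding segment_def by auto
  moreover have "\<alpha> v \<in> \<alpha> ` {v - ?r<..<v + ?r}" using assms by auto
  moreover have "\<alpha> ` {v - ?r<..<v + ?r} \<subseteq>
      insert (\<alpha> v) {?\<phi> k t | k t. k < 2 \<and> 0 \<le> t \<and> t < ?r}"
  proof
    fix y assume "y \<in> \<alpha> ` {v - ?r<..<v + ?r}"
    then obtain w where w: "y = \<alpha> w" "v - ?r < w" "w < v + ?r" by auto
    show "y \<in> insert (\<alpha> v) {?\<phi> k t | k t. k < 2 \<and> 0 \<le> t \<and> t < ?r}"
    proof (cases "w \<ge> v")
      case True
      then have "y = ?\<phi> 0 (w - v) \<and> 0 < (2::nat) \<and> 0 \<le> w - v \<and> w - v < ?r" using w by auto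
      then show ?thesis by blast
    next
      case False
      then have "y = ?\<phi> 1 (v - w) \<and> 1 < (2::nat) \<and> 0 \<le> v - w \<and> v - w < ?r" using w by auto
      then show ?thesis by blast
    qed
  qed
  ultimately have nb: "neighbourhood \<Gamma> (\<alpha> v) (insert (\<alpha> v) {?\<phi> k t | k t. k < 2 \<and> 0 \<le> t \<and> t < ?r})"
    unfolding neighbourhood_def by blast
  have "\<forall>k<2. \<forall>t\<in>{0..<?r}. ?\<phi> k t \<in> F" using F by auto
  moreover have "\<forall>j<2. \<forall>k<2. \<forall>s\<in>{0..<?r}. \<forall>t\<in>{0..<?r}.
        d (?\<phi> j s) (?\<phi> k t) = (if j = k then \<bar>s - t\<bar> else s + t)"
    using d by (auto simp: less_2_cases_iff abs_if)
  ultimately show ?thesis unfolding star_chart_def using nb assms by auto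
qed

text \<open>In a star chart the arms cover some neighbourhood of \<open>x\<close>, perhaps not the
  ball of radius \<open>r\<close>, and nothing is said about parameter \<open>r\<close>. A good
  chart is shrunk until the arms fill the ball and are segments including their tips; the position
  on an arm is then the distance from \<open>x\<close>.\<close>

definition good_chart :: "'a \<Rightarrow> nat \<Rightarrow> real \<Rightarrow> (nat \<Rightarrow> real \<Rightarrow> 'a) \<Rightarrow> bool"
  where "good_chart x n r \<phi> \<longleftrightarrow> x \<in> F \<and> 0 < r \<and> star_chart \<Gamma> x n r \<phi> \<and>
     (\<forall>k<n. segment 0 r (\<phi> k) \<and> \<phi> k 0 = x) \<and>
     (\<forall>y\<in>F. d x y < r \<longrightarrow> y \<noteq> x \<longrightarrow> (\<exists>k<n. y = \<phi> k (d x y)))"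

lemma good_chart_ex:
  assumes c: "star_chart \<Gamma> x n r \<phi>" and x: "x \<in> F"
  shows "\<exists>r0. 0 < r0 \<and> r0 < r \<and> (\<forall>r'. 0 < r' \<longrightarrow> r' \<le> r0 \<longrightarrow> good_chart x n r' \<phi>)"
proof -
  let ?S = "insert x {\<phi> k t | k t. k < n \<and> 0 \<le> t \<and> t < r}"
  have r: "0 < r" and z: "\<And>k. k < n \<Longrightarrow> \<phi> k 0 = x"
    and F: "\<And>k t. k < n \<Longrightarrow> 0 \<le> t \<Longrightarrow> t < r \<Longrightarrow> \<phi> k t \<in> F"
    and d: "\<And>j k s t. j < n \<Longrightarrow> k < n \<Longrightarrow> 0 \<le> s \<Longrightarrow> s < r \<Longrightarrow> 0 \<le> t \<Longrightarrow> t < r \<Longrightarrow>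
         d (\<phi> j s) (\<phi> k t) = (if j = k then \<bar>s - t\<bar> else s + t)"
    and nb: "neighbourhood \<Gamma> x ?S"
    using c unfolding star_chart_def by auto
  obtain U where U: "openin X U" "x \<in> U" "U \<subseteq> ?S" using nb unfolding neighbourhood_def by blast
  obtain e where e: "e > 0" "mball x e \<subseteq> U" using open_contains_mball[OF U(1,2) x] by blast
  define r0 where "r0 = min e r / 2"
  have r0: "0 < r0" "r0 < r" "r0 < e" using e r by (auto simp: r0_def min_def)
  have dx: "d x (\<phi> k t) = t" if "k < n" "0 \<le> t" "t < r" for k t
    using d[of k k 0 t] z that r by auto
  have arm: "\<exists>k<n. y = \<phi> k (d x y)" if y: "y \<in> F" "d x y < e" "y \<noteq> x" for y
  proof -
    have "y \<in> ?S" using y e U x by auto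
    then obtain k t where "k < n" "y = \<phi> k t" "0 \<le> t" "t < r" using y by auto
    then show ?thesis using dx by auto
  qed
  have "good_chart x n r' \<phi>" if r': "0 < r'" "r' \<le> r0" for r'
  proof -
    have seg: "segment 0 r' (\<phi> k)" if k: "k < n" for k
    proof -
      have "isometric_on {0..r'} (\<phi> k)"
        unfolding isometric_on_def using F[OF k] d[OF k k] r' r0 by auto
      moreover have "openin X (\<phi> k ` {0<..<r'})"
      proof -
        have sub: "\<phi> k ` {0<..<r'} \<subseteq> F" using F[OF k] r' r0 by auto
        have "\<exists>q>0. mball y q \<subseteq> \<phi> k ` {0<..<r'}" if "y \<in> \<phi> k ` {0<..<r'}" for y
        proof -
          obtain t where t: "y = \<phi> k t" "0 < t" "t < r'" using \<open>y \<in> \<phi> k ` {0<..<r'}\<close> by auto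
          have yF: "y \<in> F" using sub \<open>y \<in> _\<close> by blast
          \<comment> \<open>Points on other arms are at least \<open>t\<close> away from
            \<open>y\<close>, and the tip is at distance \<open>r' - t\<close>; a ball of radius
            \<open>q\<close> therefore stays on the arm \<open>k\<close>.\<close>
          define q where "q = min t (r' - t)"
          have "mball y q \<subseteq> \<phi> k ` {0<..<r'}"
          proof
            fix w assume "w \<in> mball y q"
            then have w: "w \<in> F" "d y w < q" by auto
            have "d x y = t" using dx k t r' r0 by auto
            have tri: "d x w \<le> d x y + d y w" "d x y \<le> d x w + d y w"
              using triangle[of x y w] triangle[of x w y] x yF w by (auto simp: commute)
            have xw: "d x w < r'" "0 < d x w" using tri \<open>d x y = t\<close> w unfolding q_def by auto
            then have "w \<noteq> x" using x by auto
            then obtain j where j: "j < n" "w = \<phi> j (d x w)" using arm[OF w(1)] xw r' r0 by force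
            have "j = k"
            proof (rule ccontr)
              assume "j \<noteq> k"
              then have "d y w = t + d x w"
                using d[OF k j(1), of t "d x w"] t j xw r' r0 by auto
              then show False using w xw unfolding q_def by auto
            qed
            then show "w \<in> \<phi> k ` {0<..<r'}" using j xw by auto
          qed
          moreover have "q > 0" using t by (auto simp: q_def)
          ultimately show ?thesis by blast
        qed
        then show ?thesis using openin_finite_iff[OF sub] by blast
      qed
      ultimately show ?thesis unfolding segment_def by blast
    qed
    have "neighbourhood \<Gamma> x (insert x {\<phi> k t | k t. k < n \<and> 0 \<le> t \<and> t < r'})"
    proof -
      have "mball x r' \<subseteq> insert x {\<phi> k t | k t. k < n \<and> 0 \<le> t \<and> t < r'}"
      proof
        fix y assume "y \<in> mball x r'"
        then have y: "y \<in> F" "d x y < r'" by auto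
        then show "y \<in> insert x {\<phi> k t | k t. k < n \<and> 0 \<le> t \<and> t < r'}"
          using arm[of y] r' r0 x by (cases "y = x") force+
      qed
      moreover have "x \<in> mball x r'" using x r' by auto
      ultimately show ?thesis unfolding neighbourhood_def using openin_mball_X by blast
    qed
    then have "star_chart \<Gamma> x n r' \<phi>"
      unfolding star_chart_def using r' r0 z F d by auto
    then show ?thesis unfolding good_chart_def using x r' r0 seg z arm by auto
  qed
  with r0 show ?thesis by blast
qed

lemma good_chart_arm_d:
  assumes "good_chart x n r \<phi>" "k < n" "0 \<le> t" "t \<le> r"
  shows "\<phi> k t \<in> F" "d x (\<phi> k t) = t"
  using assms segment_F[of 0 r "\<phi> k" t] segment_d[of 0 r "\<phi> k" t 0] unfolding good_chart_def by auto

lemma star_chart_d: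
  assumes "star_chart \<Gamma> x n r \<phi>" "j < n" "k < n" "0 \<le> s" "s < r" "0 \<le> t" "t < r"
  shows "d (\<phi> j s) (\<phi> k t) = (if j = k then \<bar>s - t\<bar> else s + t)"
  using assms unfolding star_chart_def by auto


text \<open>The parameter is the distance from \<open>x\<close> in both charts, so
  \<open>\<phi> k t\<close> lies on some arm of \<open>\<phi>'\<close> at the same parameter. That
  arm does not depend on \<open>t\<close>: the distance to the reference point at \<open>r/2\<close>
  is \<open>\<bar>r/2 - t\<bar>\<close> on the same arm and \<open>r/2 + t\<close> on any
  other.\<close>

lemma chart_match_aux:
  assumes c: "good_chart x n r \<phi>" and c': "good_chart x n' r \<phi>'" and k: "k < n"
  shows "\<exists>j<n'. \<forall>t\<in>{0..<r}. \<phi> k t = \<phi>' j t"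
proof -
  have r: "0 < r" using c unfolding good_chart_def by auto
  note A = good_chart_arm_d[OF c k]
  have ex: "\<exists>j<n'. \<phi> k t = \<phi>' j t" if t: "0 < t" "t < r" for t
  proof -
    have "\<phi> k t \<noteq> x" using A[of t] t c unfolding good_chart_def by auto
    moreover have "\<phi> k t \<in> F" "d x (\<phi> k t) = t" using A t by auto
    ultimately show ?thesis using c' t unfolding good_chart_def by metis
  qed
  obtain j where j: "j < n'" "\<phi> k (r/2) = \<phi>' j (r/2)" using ex[of "r/2"] r by auto
  have "\<phi> k t = \<phi>' j t" if t: "0 \<le> t" "t < r" for t
  proof (cases "t = 0")
    case True then show ?thesis using c c' k j unfolding good_chart_def by auto
  next
    case False
    then obtain i where i: "i < n'" "\<phi> k t = \<phi>' i t" using ex[of t] t by auto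
    have 1: "d (\<phi> k (r/2)) (\<phi> k t) = \<bar>r/2 - t\<bar>"
      using star_chart_d[of x n r \<phi> k k "r/2" t] c k t r unfolding good_chart_def by auto
    have 2: "d (\<phi>' j (r/2)) (\<phi>' i t) = (if j = i then \<bar>r/2 - t\<bar> else r/2 + t)"
      using star_chart_d[of x n' r \<phi>' j i "r/2" t] c' i j t r unfolding good_chart_def by auto
    have "j = i" using 1 2 i j False t r by (auto split: if_splits)
    then show ?thesis using i by simp
  qed
  with j show ?thesis by auto
qed

text \<open>Allows slopes to be carried from an arbitrary chart to the one that \<open>SOME\<close>
  picks in \<open>ord_at\<close>.\<close>

lemma chart_match:
  assumes c: "star_chart \<Gamma> x n r \<phi>" and c': "star_chart \<Gamma> x n' r' \<phi>'" and x: "x \<in> F"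
  shows "\<exists>\<pi> e. 0 < e \<and> bij_betw \<pi> {..<n} {..<n'} \<and> (\<forall>k<n. \<forall>t\<in>{0..<e}. \<phi> k t = \<phi>' (\<pi> k) t)"
proof -
  obtain r1 where r1: "0 < r1" "\<And>q. 0 < q \<Longrightarrow> q \<le> r1 \<Longrightarrow> good_chart x n q \<phi>"
    using good_chart_ex[OF c x] by blast
  obtain r2 where r2: "0 < r2" "\<And>q. 0 < q \<Longrightarrow> q \<le> r2 \<Longrightarrow> good_chart x n' q \<phi>'"
    using good_chart_ex[OF c' x] by blast
  define e where "e = min r1 r2"
  have e: "0 < e" "good_chart x n e \<phi>" "good_chart x n' e \<phi>'" using r1 r2 by (auto simp: e_def)
  have "\<forall>k. \<exists>j. k < n \<longrightarrow> j < n' \<and> (\<forall>t\<in>{0..<e}. \<phi> k t = \<phi>' j t)"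
    using chart_match_aux[OF e(2,3)] by meson
  from choice[OF this] obtain \<pi>
    where \<pi>: "\<And>k. k < n \<Longrightarrow> \<pi> k < n' \<and> (\<forall>t\<in>{0..<e}. \<phi> k t = \<phi>' (\<pi> k) t)" by blast
  have uniq: "i = j" if "good_chart x m e \<psi>" "i < m" "j < m" "\<psi> i (e/2) = \<psi> j (e/2)" for m \<psi> i j
    using star_chart_d[of x m e \<psi> i j "e/2" "e/2"] star_chart_d[of x m e \<psi> i i "e/2" "e/2"] that e(1)
    unfolding good_chart_def by (auto split: if_splits)
  have "inj_on \<pi> {..<n}"
  proof (rule inj_onI)
    fix i j assume "i \<in> {..<n}" "j \<in> {..<n}" "\<pi> i = \<pi> j"
    then show "i = j" using uniq[OF e(2), of i j] \<pi>[of i] \<pi>[of j] e(1) by auto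
  qed
  moreover have "\<pi> ` {..<n} = {..<n'}"
  proof (intro equalityI subsetI)
    fix j assume j: "j \<in> {..<n'}"
    then obtain k where k: "k < n" "\<forall>t\<in>{0..<e}. \<phi>' j t = \<phi> k t"
      using chart_match_aux[OF e(3,2), of j] by auto
    have "e / 2 \<in> {0..<e}" using e(1) by simp
    then have "\<phi>' (\<pi> k) (e/2) = \<phi>' j (e/2)" using \<pi>[OF k(1)] k(2) by metis
    then have "\<pi> k = j" using uniq[OF e(3), of "\<pi> k" j] \<pi>[OF k(1)] j by blast
    then show "j \<in> \<pi> ` {..<n}" using k by auto
  qed (use \<pi> in auto)
  ultimately show ?thesis using \<pi> e(1) unfolding bij_betw_def by blast
qed

subsection \<open>Piecewise linear functions and their orders\<close>

text \<open>\<open>valence\<close> and \<open>arm\<close> are the two components of the very choice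
  made in \<open>ord_at\<close>, so that unfolding turns an order into a sum over arms.\<close>

definition valence :: "'a \<Rightarrow> nat"
  where "valence x = fst (SOME (n, \<phi>). \<exists>r. star_chart \<Gamma> x n r \<phi>)"

definition arm :: "'a \<Rightarrow> nat \<Rightarrow> real \<Rightarrow> 'a"
  where "arm x = snd (SOME (n, \<phi>). \<exists>r. star_chart \<Gamma> x n r \<phi>)"

lemma arm_chart:
  assumes "x \<in> F"
  obtains r where "star_chart \<Gamma> x (valence x) r (arm x)"
proof -
  have "\<exists>p. case p of (n, \<phi>) \<Rightarrow> \<exists>r. star_chart \<Gamma> x n r \<phi>" using chart_ex[OF assms] by auto
  note z = someI_ex[OF this]
  have "\<exists>r. star_chart \<Gamma> x (valence x) r (arm x)"
  proof (cases "SOME (n, \<phi>). \<exists>r. star_chart \<Gamma> x n r \<phi>")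
    case (Pair n \<phi>)
    then show ?thesis using z unfolding valence_def arm_def Pair by simp
  qed
  then show ?thesis using that by blast
qed

lemma arm_good:
  assumes "x \<in> F"
  obtains r0 where "0 < r0" "\<And>r. 0 < r \<Longrightarrow> r \<le> r0 \<Longrightarrow> good_chart x (valence x) r (arm x)"
  using arm_chart[OF assms] good_chart_ex[OF _ assms] by metis

lemma arm_0: "x \<in> F \<Longrightarrow> k < valence x \<Longrightarrow> arm x k 0 = x"
  using arm_chart[of x] unfolding star_chart_def by metis

text \<open>Stronger than a one-sided derivative: \<open>g\<close> is exactly affine on an initial
  piece of \<open>\<alpha>\<close>, starting from the value at \<open>\<alpha> 0\<close>.\<close>

definition has_slope :: "('a \<Rightarrow> real) \<Rightarrow> (real \<Rightarrow> 'a) \<Rightarrow> real \<Rightarrow> bool"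
  where "has_slope g \<alpha> m \<longleftrightarrow> (\<forall>\<^sub>F t in at_right 0. g (\<alpha> t) = g (\<alpha> 0) + m * t)"

lemma has_slope_iff: "has_slope g \<alpha> m \<longleftrightarrow> (\<exists>e>0. \<forall>t\<in>{0..<e}. g (\<alpha> t) = g (\<alpha> 0) + m * t)"
proof -
  have "(\<exists>b>0. \<forall>y>0. y < b \<longrightarrow> g (\<alpha> y) = g (\<alpha> 0) + m * y) \<longleftrightarrow>
        (\<exists>e>0. \<forall>t\<in>{0..<e}. g (\<alpha> t) = g (\<alpha> 0) + m * t)"
  proof (intro ex_cong1 conj_cong refl)
    fix e :: real
    show "(\<forall>y>0. y < e \<longrightarrow> g (\<alpha> y) = g (\<alpha> 0) + m * y) \<longleftrightarrow> (\<forall>t\<in>{0..<e}. g (\<alpha> t) = g (\<alpha> 0) + m * t)"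
    proof (intro iffI ballI allI impI)
      fix t assume "\<forall>y>0. y < e \<longrightarrow> g (\<alpha> y) = g (\<alpha> 0) + m * y" "t \<in> {0..<e}"
      then show "g (\<alpha> t) = g (\<alpha> 0) + m * t" by (cases "t = 0") auto
    next
      fix y assume "\<forall>t\<in>{0..<e}. g (\<alpha> t) = g (\<alpha> 0) + m * t" "0 < y" "y < e"
      then show "g (\<alpha> y) = g (\<alpha> 0) + m * y" using atLeastLessThan_iff less_imp_le by blast
    qed
  qed
  then show ?thesis unfolding has_slope_def eventually_at_right_field .
qed

lemma has_slope_unique:
  assumes "has_slope g \<alpha> m" "has_slope g \<alpha> m'" shows "m = m'"
proof -
  have "\<forall>\<^sub>F t in at_right (0::real). 0 < t" by (simp add: eventually_at_right_less)
  with assms have "\<forall>\<^sub>F t in at_right (0::real). m = m'"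
    unfolding has_slope_def by eventually_elim auto
  then show ?thesis by simp
qed

lemma has_slope_add: "has_slope g \<alpha> m \<Longrightarrow> has_slope h \<alpha> k \<Longrightarrow> has_slope (\<lambda>x. g x + h x) \<alpha> (m + k)"
  unfolding has_slope_def by (drule (1) eventually_conj, elim eventually_mono) (simp add: algebra_simps)

lemma has_slope_minus: "has_slope g \<alpha> m \<Longrightarrow> has_slope (\<lambda>x. - g x) \<alpha> (- m)"
  unfolding has_slope_def by (elim eventually_mono) (simp add: algebra_simps)

lemma slope_transfer:
  assumes "star_chart \<Gamma> x n r \<phi>" "star_chart \<Gamma> x n' r' \<phi>'" "x \<in> F"
  obtains \<pi> where "bij_betw \<pi> {..<n} {..<n'}"
    "\<And>k g m. k < n \<Longrightarrow> has_slope g (\<phi> k) m \<longleftrightarrow> has_slope g (\<phi>' (\<pi> k)) m"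
proof -
  obtain \<pi> e where \<pi>: "0 < e" "bij_betw \<pi> {..<n} {..<n'}" "\<forall>k<n. \<forall>t\<in>{0..<e}. \<phi> k t = \<phi>' (\<pi> k) t"
    using chart_match[OF assms] by blast
  have "has_slope g (\<phi> k) m \<longleftrightarrow> has_slope g (\<phi>' (\<pi> k)) m" if k: "k < n" for k g m
  proof -
    have "\<forall>\<^sub>F t in at_right 0. \<phi> k t = \<phi>' (\<pi> k) t"
      using \<pi> k by (auto simp: eventually_at_right_field)
    moreover have "\<phi> k 0 = \<phi>' (\<pi> k) 0" using \<pi> k by auto
    ultimately show ?thesis unfolding has_slope_def by (intro eventually_subst) (auto elim: eventually_mono)
  qed
  then show ?thesis using that \<pi> by blast
qed

text \<open>The value at the end itself is left free: orders do not see it, and a chip firing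
  function may jump there.\<close>

definition locally_const_at_ends :: "('a \<Rightarrow> real) \<Rightarrow> bool"
  where "locally_const_at_ends g \<longleftrightarrow>
     (\<forall>p\<in>ends. \<exists>U c. openin X U \<and> p \<in> U \<and> (\<forall>y\<in>U \<inter> F. g y = c))"

text \<open>Only bounded functions are covered: a nonzero slope at a point at infinity is excluded.\<close>

definition PL :: "('a \<Rightarrow> real) \<Rightarrow> bool"
  where "PL g \<longleftrightarrow> (\<forall>x\<in>F. \<forall>k<valence x. \<exists>m::int. has_slope g (arm x k) m) \<and> locally_const_at_ends g"

text \<open>The sign of \<open>m\<close> depends on the order of the two arms, so only \<open>\<bar>m\<bar>\<close> is determined.\<close>

definition nice :: "('a \<Rightarrow> real) \<Rightarrow> int \<Rightarrow> 'a \<Rightarrow> bool"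
  where "nice g m y \<longleftrightarrow> y \<in> F \<and> (\<exists>r \<phi>. star_chart \<Gamma> y 2 r \<phi> \<and>
     has_slope g (\<phi> 0) m \<and> has_slope g (\<phi> 1) (- real_of_int m))"

lemma bij_betw_2:
  assumes "bij_betw \<pi> {..<2::nat} {..<n::nat}"
  shows "n = 2 \<and> (\<pi> 0 = 0 \<and> \<pi> 1 = 1 \<or> \<pi> 0 = 1 \<and> \<pi> 1 = (0::nat))"
proof -
  have n: "n = 2" using bij_betw_same_card[OF assms] by simp
  have "\<pi> 0 < 2" "\<pi> 1 < 2" "\<pi> 0 \<noteq> \<pi> 1"
    using assms n inj_onD[of \<pi> "{..<2}" 0 1] unfolding bij_betw_def by auto
  then show ?thesis using n by linarith
qed

lemma nice_any_chart:
  assumes "nice g m y" "star_chart \<Gamma> y n r \<phi>"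
  shows "n = 2 \<and> (has_slope g (\<phi> 0) m \<and> has_slope g (\<phi> 1) (- real_of_int m) \<or>
    has_slope g (\<phi> 0) (- real_of_int m) \<and> has_slope g (\<phi> 1) m)"
proof -
  obtain r' \<phi>' where c: "star_chart \<Gamma> y 2 r' \<phi>'" "y \<in> F"
    "has_slope g (\<phi>' 0) m" "has_slope g (\<phi>' 1) (- real_of_int m)"
    using assms unfolding nice_def by blast
  obtain \<pi> where \<pi>: "bij_betw \<pi> {..<2} {..<n}"
    "\<And>k g m. k < 2 \<Longrightarrow> has_slope g (\<phi>' k) m \<longleftrightarrow> has_slope g (\<phi> (\<pi> k)) m"
    using slope_transfer[OF c(1) assms(2) c(2)] by blast
  show ?thesis using bij_betw_2[OF \<pi>(1)] \<pi>(2)[of 0 g m] \<pi>(2)[of 1 g "- m"] c by auto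
qed

lemma nice_arm:
  assumes "nice g m y"
  shows "valence y = 2 \<and> (has_slope g (arm y 0) m \<and> has_slope g (arm y 1) (- real_of_int m) \<or>
    has_slope g (arm y 0) (- real_of_int m) \<and> has_slope g (arm y 1) m)"
proof -
  have "y \<in> F" using assms unfolding nice_def by blast
  then obtain r where "star_chart \<Gamma> y (valence y) r (arm y)" using arm_chart by blast
  then show ?thesis using nice_any_chart[OF assms] by blast
qed

lemma nice_unique:
  assumes "nice g m y" "nice g m' y" shows "\<bar>m\<bar> = \<bar>m'\<bar>"
proof -
  have "real_of_int m = real_of_int m' \<or> real_of_int m = - real_of_int m'"
    using nice_arm[OF assms(1)] nice_arm[OF assms(2)] has_slope_unique by (metis minus_minus)
  then have "real_of_int \<bar>m\<bar> = real_of_int \<bar>m'\<bar>" by auto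
  then show ?thesis by linarith
qed

lemma nice_on_segment:
  assumes s: "segment a b \<alpha>" "a < v" "v < b" and n: "nice g m (\<alpha> v)"
  shows "\<exists>m'::int. \<exists>e>0. \<forall>y. \<bar>y - v\<bar> < e \<longrightarrow> g (\<alpha> y) = g (\<alpha> v) + real_of_int m' * (y - v)"
proof -
  let ?\<phi> = "\<lambda>(k::nat) t. if k = 0 then \<alpha> (v + t) else \<alpha> (v - t)"
  obtain m' :: int where m': "has_slope g (?\<phi> 0) m'" "has_slope g (?\<phi> 1) (- real_of_int m')"
  proof -
    have "has_slope g (?\<phi> 0) m \<and> has_slope g (?\<phi> 1) (- real_of_int m) \<or>
      has_slope g (?\<phi> 0) (- real_of_int m) \<and> has_slope g (?\<phi> 1) m"
      using nice_any_chart[OF n segment_chart[OF s]] by blast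
    then show ?thesis using that[of m] that[of "- m"] by auto
  qed
 then obtain e1 e2 :: real where e: "e1 > 0" "e2 > 0"
    "\<forall>t\<in>{0..<e1}. g (\<alpha> (v + t)) = g (\<alpha> v) + m' * t"
    "\<forall>t\<in>{0..<e2}. g (\<alpha> (v - t)) = g (\<alpha> v) - m' * t"
    unfolding has_slope_iff by auto
  have "g (\<alpha> y) = g (\<alpha> v) + real_of_int m' * (y - v)" if "\<bar>y - v\<bar> < min e1 e2" for y
  proof (cases "y \<ge> v")
    case True
    then show ?thesis using e(3)[rule_format, of "y - v"] that by auto
  next
    case False
    then show ?thesis using e(4)[rule_format, of "v - y"] that by (auto simp: algebra_simps)
  qed
  moreover have "min e1 e2 > 0" using e(1,2) by simp
  ultimately show ?thesis by blast
qed

lemma nice_of_segment: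
  assumes s: "segment a b \<alpha>" "a < v" "v < b"
    and lin: "\<And>t. a < t \<Longrightarrow> t < b \<Longrightarrow> g (\<alpha> t) = c + real_of_int m * t"
  shows "nice g m (\<alpha> v)"
proof -
  let ?\<phi> = "\<lambda>(k::nat) t. if k = 0 then \<alpha> (v + t) else \<alpha> (v - t)"
  have "has_slope g (?\<phi> 0) m"
    unfolding has_slope_iff
  proof (intro exI[of _ "b - v"] conjI ballI)
    fix t assume "t \<in> {0..<b - v}"
    then show "g (?\<phi> 0 t) = g (?\<phi> 0 0) + real_of_int m * t"
      using lin[of "v + t"] lin[of v] s by (simp add: algebra_simps)
  qed (use s in simp)
  moreover have "has_slope g (?\<phi> 1) (- real_of_int m)"
    unfolding has_slope_iff
  proof (intro exI[of _ "v - a"] conjI ballI)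
    fix t assume "t \<in> {0..<v - a}"
    then show "g (?\<phi> 1 t) = g (?\<phi> 1 0) + - real_of_int m * t"
      using lin[of "v - t"] lin[of v] s by (simp add: algebra_simps)
  qed (use s in simp)
  ultimately show ?thesis using segment_chart[OF s] segment_F[OF s(1), of v] s unfolding nice_def
    by (intro conjI exI[of _ "min (v - a) (b - v)"] exI[of _ ?\<phi>]) simp_all
qed

lemma slopes_good_chart:
  assumes x: "x \<in> F" and m: "\<And>k. k < valence x \<Longrightarrow> has_slope g (arm x k) (m k)"
  obtains r0 where "0 < r0" "\<And>r. 0 < r \<Longrightarrow> r \<le> r0 \<Longrightarrow> good_chart x (valence x) r (arm x)"
    "\<And>k t. k < valence x \<Longrightarrow> 0 \<le> t \<Longrightarrow> t \<le> r0 \<Longrightarrow> g (arm x k t) = g x + m k * t"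
proof -
  obtain r1 where r1: "0 < r1" "\<And>r. 0 < r \<Longrightarrow> r \<le> r1 \<Longrightarrow> good_chart x (valence x) r (arm x)"
    using arm_good[OF x] by blast
  have "\<forall>\<^sub>F t in at_right 0. \<forall>k\<in>{..<valence x}. g (arm x k t) = g x + m k * t"
    using m arm_0[OF x] unfolding has_slope_def by (intro eventually_ball_finite) auto
  then obtain b where b: "0 < b" "\<And>t k. 0 < t \<Longrightarrow> t < b \<Longrightarrow> k < valence x \<Longrightarrow> g (arm x k t) = g x + m k * t"
    unfolding eventually_at_right_field by auto
  have "g (arm x k t) = g x + m k * t" if "k < valence x" "0 \<le> t" "t \<le> min r1 (b/2)" for k t
    using b(2)[of t k] that b(1) arm_0[OF x, of k] by (cases "t = 0") auto
  then show ?thesis using that[of "min r1 (b/2)"] r1 b(1) by auto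
qed

lemma PL_good_chart:
  assumes "PL g" "x \<in> F"
  obtains m :: "nat \<Rightarrow> int" and r0 where "0 < r0"
    "\<And>r. 0 < r \<Longrightarrow> r \<le> r0 \<Longrightarrow> good_chart x (valence x) r (arm x)"
    "\<And>k t. k < valence x \<Longrightarrow> 0 \<le> t \<Longrightarrow> t \<le> r0 \<Longrightarrow> g (arm x k t) = g x + real_of_int (m k) * t"
    "\<And>k. k < valence x \<Longrightarrow> has_slope g (arm x k) (m k)"
proof -
  have "\<forall>k. \<exists>m::int. k < valence x \<longrightarrow> has_slope g (arm x k) m" using assms unfolding PL_def by blast
  from choice[OF this] obtain m :: "nat \<Rightarrow> int"
    where m: "\<And>k. k < valence x \<Longrightarrow> has_slope g (arm x k) (m k)" by blast
  show ?thesis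
    by (rule slopes_good_chart[OF assms(2) m], assumption, rule that[of _ m]) (use m in auto)
qed

section \<open>Points at infinity, and finiteness of slopes and critical values\<close>

lemma end_chart_isometric: "end_chart \<Gamma> p \<rho> \<Longrightarrow> isometric_on {0..} \<rho>"
  unfolding end_chart_def isometric_on_def by auto

text \<open>The initial piece up to \<open>T\<close> is compact, hence closed, and can be cut out of
  the open set given by \<open>end_chart\<close>.\<close>

lemma end_nbhd_open:
  assumes e: "end_chart \<Gamma> p \<rho>" and p: "p \<in> ends" and T: "0 \<le> T"
  shows "openin X (insert p (\<rho> ` {T<..}))"
proof -
  have iso: "isometric_on {0..} \<rho>" using end_chart_isometric[OF e] .
  have "closedin X (\<rho> ` {0..T})" using isometric_closed[OF iso] by auto
  moreover have "openin X (insert p (\<rho> ` {0<..}))" using e unfolding end_chart_def by blast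
  ultimately have "openin X (insert p (\<rho> ` {0<..}) - \<rho> ` {0..T})" by blast
  moreover have "insert p (\<rho> ` {0<..}) - \<rho> ` {0..T} = insert p (\<rho> ` {T<..})"
  proof -
    have "p \<notin> \<rho> ` {0..T}" using iso p F_inf_disjoint unfolding isometric_on_def by auto
    moreover have notin: "\<rho> s \<notin> \<rho> ` {0..T}" if "s > T" for s
      using isometric_inj[OF iso, of s] that T by fastforce
    ultimately have "\<rho> ` {0<..} - \<rho> ` {0..T} = \<rho> ` {T<..}"
    proof (intro equalityI subsetI)
      fix y assume "y \<in> \<rho> ` {T<..}"
      then obtain s where s: "y = \<rho> s" "s > T" by auto
      then have "s \<in> {0<..}" using T by simp
      then show "y \<in> \<rho> ` {0<..} - \<rho> ` {0..T}" unfolding s(1) using notin[OF s(2)] by (intro DiffI imageI)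
    next
      fix y assume "y \<in> \<rho> ` {0<..} - \<rho> ` {0..T}"
      then obtain s where s: "y = \<rho> s" "s > 0" "y \<notin> \<rho> ` {0..T}" by auto
      then have "s \<notin> {0..T}" by blast
      then have "s > T" using s(2) by simp
      then show "y \<in> \<rho> ` {T<..}" using s by auto
    qed
    then show ?thesis using \<open>p \<notin> \<rho> ` {0..T}\<close> by auto
  qed
  ultimately show ?thesis by simp
qed

lemma end_eventually:
  assumes e: "end_chart \<Gamma> p \<rho>" and U: "openin X U" "p \<in> U"
  obtains T where "0 \<le> T" "\<And>t. T \<le> t \<Longrightarrow> \<rho> t \<in> U"
proof -
  have "\<forall>\<^sub>F t in at_top. \<rho> t \<in> U" using e U unfolding end_chart_def limitin_def by blast
  then obtain T where "\<And>t. T \<le> t \<Longrightarrow> \<rho> t \<in> U" unfolding eventually_at_top_linorder by blast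
  then show ?thesis using that[of "max T 0"] by auto
qed

text \<open>Intersecting the open tail beyond \<open>a\<close> with the ball of radius
  \<open>b - a\<close> about \<open>\<rho> a\<close> removes \<open>p\<close> and everything from
  parameter \<open>b\<close> on.\<close>

lemma end_segment:
  assumes e: "end_chart \<Gamma> p \<rho>" and p: "p \<in> ends" and T: "0 \<le> a"
  shows "segment a b \<rho>"
proof -
  have iso: "isometric_on {0..} \<rho>" using end_chart_isometric[OF e] .
  have "\<rho> ` {a<..<b} = insert p (\<rho> ` {a<..}) \<inter> mball (\<rho> a) (b - a)"
    using iso T p F_inf_disjoint unfolding isometric_on_def by (auto simp: in_mball)
  then have "openin X (\<rho> ` {a<..<b})" using end_nbhd_open[OF assms] openin_mball_X by auto
  then show ?thesis unfolding segment_def using isometric_on_subset[OF iso, of "{a..b}"] T by auto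
qed

lemma locally_constD:
  assumes "locally_const_at_ends g" "p \<in> ends"
  obtains \<rho> T c where "0 \<le> T" "end_chart \<Gamma> p \<rho>" "\<And>t. T \<le> t \<Longrightarrow> g (\<rho> t) = c"
proof -
  obtain \<rho> where \<rho>: "end_chart \<Gamma> p \<rho>" using end_chart_ex[OF assms(2)] by blast
  obtain U c where U: "openin X U" "p \<in> U" "\<forall>y\<in>U \<inter> F. g y = c"
    using assms unfolding locally_const_at_ends_def by blast
  obtain T where T: "0 \<le> T" "\<And>t. T \<le> t \<Longrightarrow> \<rho> t \<in> U" using end_eventually[OF \<rho> U(1,2)] by blast
  have "g (\<rho> t) = c" if "T \<le> t" for t
    using T(2)[OF that] U(3) \<rho> that T(1) unfolding end_chart_def by auto
  with that T \<rho> show ?thesis by blast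
qed

lemma locally_constI:
  assumes "\<And>p. p \<in> ends \<Longrightarrow> \<exists>\<rho> T c. 0 \<le> T \<and> end_chart \<Gamma> p \<rho> \<and> (\<forall>t>T. g (\<rho> t) = c)"
  shows "locally_const_at_ends g"
  unfolding locally_const_at_ends_def
proof
  fix p assume p: "p \<in> ends"
  obtain \<rho> T c where r: "0 \<le> T" "end_chart \<Gamma> p \<rho>" "\<forall>t>T. g (\<rho> t) = c" using assms[OF p] by blast
  have "openin X (insert p (\<rho> ` {T<..}))" using end_nbhd_open r p by blast
  moreover have "\<forall>y\<in>insert p (\<rho> ` {T<..}) \<inter> F. g y = c" using r(3) p F_inf_disjoint by auto
  ultimately show "\<exists>U c. openin X U \<and> p \<in> U \<and> (\<forall>y\<in>U \<inter> F. g y = c)" by blast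
qed

text \<open>The local input for a compactness argument. A flat point near a finite \<open>x\<close>
  lies on an arm of slope 0 that starts at \<open>x\<close>, and a flat point near an end lies in
  the constant tail, so one value \<open>c\<close> is enough.\<close>

lemma PL_local_structure:
  assumes g: "PL g" and x: "x \<in> points \<Gamma>"
  shows "\<exists>U c M. openin X U \<and> x \<in> U \<and> finite M \<and> (x \<in> F \<longrightarrow> c = g x) \<and>
    (\<forall>y\<in>U - {x}. \<exists>m\<in>M. nice g m y \<and> (m = 0 \<longrightarrow> g y = c))"
proof (cases "x \<in> F")
  case True
  obtain m r where r: "0 < r" "good_chart x (valence x) r (arm x)"
    "\<And>k t. k < valence x \<Longrightarrow> 0 \<le> t \<Longrightarrow> t \<le> r \<Longrightarrow> g (arm x k t) = g x + real_of_int (m k) * t"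
    by (rule PL_good_chart[OF g True]) (rule that; blast intro: order_refl)
  have "\<exists>i\<in>m ` {..<valence x}. nice g i y \<and> (i = 0 \<longrightarrow> g y = g x)" if y: "y \<in> mball x r - {x}" for y
  proof -
    have y': "y \<in> F" "d x y < r" "y \<noteq> x" using y by auto
    then obtain k where k: "k < valence x" "y = arm x k (d x y)"
      using r(2) unfolding good_chart_def by blast
    have pos: "0 < d x y" using y' True by auto
    have seg: "segment 0 r (arm x k)" using r(2) k unfolding good_chart_def by blast
    have "nice g (m k) (arm x k (d x y))"
      using r(3)[OF k(1)] y' pos by (intro nice_of_segment[OF seg, where c = "g x"]) auto
    then show ?thesis using k r(3)[OF k(1), of "d x y"] y' pos by auto
  qed
  then show ?thesis using openin_mball_X[of x r] True r(1)
    by (intro exI[of _ "mball x r"] exI[of _ "g x"] exI[of _ "m ` {..<valence x}"]) auto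
next
  case False
  then have p: "x \<in> ends" using x points_eq by blast
  have "locally_const_at_ends g" using g unfolding PL_def by blast
  then obtain \<rho> T c where T: "0 \<le> T" "end_chart \<Gamma> x \<rho>" "\<And>t. T \<le> t \<Longrightarrow> g (\<rho> t) = c"
    by (rule locally_constD[OF _ p]) (rule that)
  have "nice g 0 (\<rho> t)" if "t > T" for t
    using end_segment[OF T(2) p T(1), of "t + 1"] T(3) that by (auto intro: nice_of_segment[where c = c])
  then show ?thesis using end_nbhd_open[OF T(2) p T(1)] False T
    by (intro exI[of _ "insert x (\<rho> ` {T<..})"] exI[of _ c] exI[of _ "{0}"]) auto
qed

text \<open>A finite subcover of the neighbourhoods from \<open>PL_local_structure\<close>.
  \<open>S\<close> consists of the centres and contains every vertex, bend and end, since none of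
  these is nice; \<open>M\<close> collects the slopes and \<open>C\<close> the critical
  values.\<close>

lemma PL_finite_structure:
  assumes g: "PL g"
  obtains S M C where "finite S" "finite M" "finite C"
    "\<And>y. y \<in> points \<Gamma> - S \<Longrightarrow> \<exists>m\<in>M. nice g m y \<and> (m = 0 \<longrightarrow> g y \<in> C)"
    "\<And>y. y \<in> S \<Longrightarrow> y \<in> F \<Longrightarrow> g y \<in> C"
proof -
  have "\<forall>x\<in>points \<Gamma>. \<exists>W. openin X (fst W) \<and> x \<in> fst W \<and> finite (snd (snd W)) \<and>
      (x \<in> F \<longrightarrow> fst (snd W) = g x) \<and>
      (\<forall>y\<in>fst W - {x}. \<exists>m\<in>snd (snd W). nice g m y \<and> (m = 0 \<longrightarrow> g y = fst (snd W)))"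
    using PL_local_structure[OF g] by simp
  from bchoice[OF this] obtain W where "\<forall>x\<in>points \<Gamma>.
      openin X (fst (W x)) \<and> x \<in> fst (W x) \<and> finite (snd (snd (W x))) \<and>
      (x \<in> F \<longrightarrow> fst (snd (W x)) = g x) \<and>
      (\<forall>y\<in>fst (W x) - {x}. \<exists>m\<in>snd (snd (W x)). nice g m y \<and> (m = 0 \<longrightarrow> g y = fst (snd (W x))))" ..
  note W = this[THEN bspec]
  have "compactin X (points \<Gamma>)" using compact_X unfolding compact_space_def points_def .
  moreover have "\<And>U. U \<in> (\<lambda>x. fst (W x)) ` points \<Gamma> \<Longrightarrow> openin X U" using W by blast
  moreover have "points \<Gamma> \<subseteq> \<Union>((\<lambda>x. fst (W x)) ` points \<Gamma>)" using W by blast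
  ultimately obtain \<F> where \<F>: "finite \<F>" "\<F> \<subseteq> (\<lambda>x. fst (W x)) ` points \<Gamma>" "points \<Gamma> \<subseteq> \<Union>\<F>"
    unfolding compactin_def by meson
  obtain S where S: "S \<subseteq> points \<Gamma>" "finite S" "\<F> = (\<lambda>x. fst (W x)) ` S"
    using finite_subset_image[OF \<F>(1,2)] by blast
  show ?thesis
  proof (rule that[of S "\<Union>x\<in>S. snd (snd (W x))" "(\<lambda>x. fst (snd (W x))) ` S"])
    show "finite S" "finite ((\<lambda>x. fst (snd (W x))) ` S)" using S by auto
    show "finite (\<Union>x\<in>S. snd (snd (W x)))" using S W by blast
    fix y assume y: "y \<in> points \<Gamma> - S"
    then obtain x where x: "x \<in> S" "y \<in> fst (W x)" using \<F> S by blast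
    then have "y \<in> fst (W x) - {x}" using y by blast
    moreover have "x \<in> points \<Gamma>" using x S by blast
    ultimately obtain m where "m \<in> snd (snd (W x))" "nice g m y" "m = 0 \<longrightarrow> g y = fst (snd (W x))"
      using W[of x] by meson
    then show "\<exists>m\<in>\<Union>x\<in>S. snd (snd (W x)). nice g m y \<and> (m = 0 \<longrightarrow> g y \<in> (\<lambda>x. fst (snd (W x))) ` S)"
      using x by blast
  next
    fix y assume "y \<in> S" "y \<in> F"
    then show "g y \<in> (\<lambda>x. fst (snd (W x))) ` S" using W[of y] S by (auto intro!: image_eqI[of _ _ y])
  qed
qed

section \<open>Orders of piecewise linear functions\<close>

lemma outgoing_slope_eq:
  assumes "has_slope g \<alpha> m" and "\<forall>\<^sub>F t in at_right 0. real_of_ereal (f (\<alpha> t)) = g (\<alpha> t)"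
    and "real_of_ereal (f (\<alpha> 0)) = g (\<alpha> 0)"
  shows "outgoing_slope f \<alpha> = m"
  unfolding outgoing_slope_def
proof (rule tendsto_Lim)
  have "\<forall>\<^sub>F t in at_right (0::real). 0 < t" by (simp add: eventually_at_right_less)
  with assms(1,2) have "\<forall>\<^sub>F t in at_right 0. g (\<alpha> t) = g (\<alpha> 0) + m * t \<and>
      real_of_ereal (f (\<alpha> t)) = g (\<alpha> t) \<and> 0 < t"
    unfolding has_slope_def by (intro eventually_conj)
  then have "\<forall>\<^sub>F t in at_right 0. (real_of_ereal (f (\<alpha> t)) - real_of_ereal (f (\<alpha> 0))) / t = m"
    by (rule eventually_mono) (use assms(3) in auto)
  then show "((\<lambda>t. (real_of_ereal (f (\<alpha> t)) - real_of_ereal (f (\<alpha> 0))) / t) \<longlongrightarrow> m) (at_right 0)"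
    by (rule tendsto_eventually)
qed simp

lemma ord_at_F:
  assumes x: "x \<in> F" and m: "\<And>k. k < valence x \<Longrightarrow> has_slope g (arm x k) (m k)"
    and f: "\<And>y. y \<in> F \<Longrightarrow> real_of_ereal (f y) = g y"
  shows "ord_at \<Gamma> f x = (\<Sum>k<valence x. m k)"
proof -
  have "x \<notin> ends" using x F_inf_disjoint by blast
  then have "ord_at \<Gamma> f x = (\<Sum>k<valence x. outgoing_slope f (arm x k))"
    unfolding ord_at_def valence_def arm_def by (simp add: case_prod_beta)
  moreover have "outgoing_slope f (arm x k) = m k" if k: "k < valence x" for k
  proof (rule outgoing_slope_eq[OF m[OF k]])
    obtain r where r: "0 < r" "good_chart x (valence x) r (arm x)" using arm_good[OF x] by blast
    then show "\<forall>\<^sub>F t in at_right 0. real_of_ereal (f (arm x k t)) = g (arm x k t)"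
      using good_chart_arm_d(1)[OF r(2) k] f by (auto simp: eventually_at_right_field intro!: exI[of _ r])
    show "real_of_ereal (f (arm x k 0)) = g (arm x k 0)" using arm_0[OF x k] f x by simp
  qed
  ultimately show ?thesis by simp
qed

lemma ord_at_end:
  assumes p: "p \<in> ends" and g: "locally_const_at_ends g"
    and f: "\<And>y. y \<in> F \<Longrightarrow> real_of_ereal (f y) = g y"
  shows "ord_at \<Gamma> f p = 0"
proof -
  define \<rho> where "\<rho> = (SOME \<rho>. end_chart \<Gamma> p \<rho>)"
  have \<rho>: "end_chart \<Gamma> p \<rho>" unfolding \<rho>_def using end_chart_ex[OF p] by (rule someI_ex)
  obtain U c where U: "openin X U" "p \<in> U" "\<forall>y\<in>U \<inter> F. g y = c"
    using g p unfolding locally_const_at_ends_def by blast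
  obtain T where T: "0 \<le> T" "\<And>t. T \<le> t \<Longrightarrow> \<rho> t \<in> U" using end_eventually[OF \<rho> U(1,2)] by blast
  have c: "real_of_ereal (f (\<rho> t)) = c" if "T \<le> t" for t
    using T(2)[OF that] U(3) \<rho> that T(1) f unfolding end_chart_def by auto
  have "\<forall>\<^sub>F t in at_top. real_of_ereal (f (\<rho> t)) - real_of_ereal (f (\<rho> (t + 1))) = 0"
    unfolding eventually_at_top_linorder using c by (intro exI[of _ T]) auto
  then have "outgoing_slope_inf f \<rho> = 0"
    unfolding outgoing_slope_inf_def by (intro tendsto_Lim tendsto_eventually) auto
  then show ?thesis using p unfolding ord_at_def \<rho>_def by simp
qed

definition Ord :: "('a \<Rightarrow> real) \<Rightarrow> 'a \<Rightarrow> real"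
  where "Ord g = ord_at \<Gamma> (\<lambda>x. ereal (g x))"

lemma PL_slopes:
  assumes "PL g" "x \<in> F"
  obtains m :: "nat \<Rightarrow> int" where "\<And>k. k < valence x \<Longrightarrow> has_slope g (arm x k) (m k)"
  using PL_good_chart[OF assms] by metis

lemma ord_at_eq_Ord:
  assumes "PL g" "\<And>y. y \<in> F \<Longrightarrow> real_of_ereal (f y) = g y" "x \<in> points \<Gamma>"
  shows "ord_at \<Gamma> f x = Ord g x"
proof (cases "x \<in> F")
  case True
  then obtain m :: "nat \<Rightarrow> int" where m: "\<And>k. k < valence x \<Longrightarrow> has_slope g (arm x k) (m k)"
    using PL_slopes[OF assms(1)] by blast
  show ?thesis unfolding Ord_def
    using ord_at_F[OF True m, of f] ord_at_F[OF True m, of "\<lambda>x. ereal (g x)"] assms by simp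
next
  case False
  then have p: "x \<in> ends" using assms points_eq by blast
  have "locally_const_at_ends g" using assms unfolding PL_def by blast
  then show ?thesis unfolding Ord_def
    using ord_at_end[OF p, of g f] ord_at_end[OF p, of g "\<lambda>x. ereal (g x)"] assms by simp
qed

lemma Ord_F: "x \<in> F \<Longrightarrow> (\<And>k. k < valence x \<Longrightarrow> has_slope g (arm x k) (m k)) \<Longrightarrow> Ord g x = (\<Sum>k<valence x. m k)"
  unfolding Ord_def by (rule ord_at_F) auto

lemma Ord_end: "PL g \<Longrightarrow> p \<in> ends \<Longrightarrow> Ord g p = 0"
  unfolding Ord_def PL_def by (rule ord_at_end) auto

lemma Ord_nice:
  assumes "nice g m y" shows "Ord g y = 0"
proof -
  have y: "y \<in> F" using assms unfolding nice_def by blast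
  obtain s where s: "has_slope g (arm y 0) s" "has_slope g (arm y 1) (- s)" "valence y = 2"
    using nice_arm[OF assms] by auto
  have "Ord g y = (\<Sum>k<valence y. if k = 0 then s else - s)"
    using s by (intro Ord_F[OF y]) (auto simp: less_2_cases_iff)
  also have "\<dots> = 0" using s(3) by (simp add: numeral_2_eq_2)
  finally show ?thesis .
qed

lemma Ord_support:
  assumes "PL g" shows "finite {x \<in> points \<Gamma>. Ord g x \<noteq> 0}"
proof -
  obtain S M C where S: "finite S"
    "\<And>y. y \<in> points \<Gamma> - S \<Longrightarrow> \<exists>m\<in>M. nice g m y \<and> (m = 0 \<longrightarrow> g y \<in> (C :: real set))"
    by (rule PL_finite_structure[OF assms]) (rule that)
  have "{x \<in> points \<Gamma>. Ord g x \<noteq> 0} \<subseteq> S" using S(2) Ord_nice by blast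
  then show ?thesis using S(1) finite_subset by blast
qed

lemma Ord_Ints:
  assumes "PL g" "x \<in> points \<Gamma>" shows "Ord g x \<in> \<int>"
proof (cases "x \<in> F")
  case True
  then obtain m :: "nat \<Rightarrow> int" where m: "\<And>k. k < valence x \<Longrightarrow> has_slope g (arm x k) (m k)"
    using PL_slopes[OF assms(1)] by blast
  then show ?thesis using Ord_F[OF True m] by (simp add: Ints_sum)
next
  case False
  then show ?thesis using Ord_end assms points_eq by force
qed

lemma PL_const: "PL (\<lambda>x. c)"
proof -
  have "\<forall>x\<in>F. \<forall>k<valence x. \<exists>m::int. has_slope (\<lambda>x. c) (arm x k) m"
    unfolding has_slope_def by (intro ballI allI impI exI[of _ 0]) simp
  moreover have "\<exists>U. openin X U \<and> p \<in> U" if "p \<in> ends" for p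
    using that topspace_X openin_topspace[of X] by (metis Un_iff)
  ultimately show ?thesis unfolding PL_def locally_const_at_ends_def by blast
qed

lemma PL_minus:
  assumes "PL g" shows "PL (\<lambda>x. - g x)"
proof -
  have "\<exists>k::int. has_slope (\<lambda>x. - g x) \<alpha> k" if "has_slope g \<alpha> (real_of_int m)" for \<alpha> m
    using has_slope_minus[OF that] by (metis of_int_minus)
  then show ?thesis using assms unfolding PL_def locally_const_at_ends_def by (metis)
qed

lemma PL_add:
  assumes "PL g" "PL h" shows "PL (\<lambda>x. g x + h x)"
proof -
  have "\<exists>m::int. has_slope (\<lambda>x. g x + h x) (arm x k) m" if "x \<in> F" "k < valence x" for x k
  proof -
    obtain a b :: int where ab: "has_slope g (arm x k) a" "has_slope h (arm x k) b"
      using PL_slopes[OF assms(1) \<open>x \<in> F\<close>] PL_slopes[OF assms(2) \<open>x \<in> F\<close>] \<open>k < valence x\<close>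
      by metis
    from has_slope_add[OF ab] show ?thesis by (metis of_int_add)
  qed
  moreover have "locally_const_at_ends (\<lambda>x. g x + h x)"
    unfolding locally_const_at_ends_def
  proof
    fix p assume "p \<in> ends"
    then obtain U c V c' where "openin X U" "p \<in> U" "\<forall>y\<in>U \<inter> F. g y = c"
      "openin X V" "p \<in> V" "\<forall>y\<in>V \<inter> F. h y = c'"
      using assms unfolding PL_def locally_const_at_ends_def by meson
    then show "\<exists>U c. openin X U \<and> p \<in> U \<and> (\<forall>y\<in>U \<inter> F. g y + h y = c)"
      by (intro exI[of _ "U \<inter> V"] exI[of _ "c + c'"]) auto
  qed
  ultimately show ?thesis unfolding PL_def by blast
qed

lemma Ord_add:
  assumes "PL g" "PL h" "x \<in> points \<Gamma>"
  shows "Ord (\<lambda>x. g x + h x) x = Ord g x + Ord h x"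
proof (cases "x \<in> F")
  case True
  obtain m :: "nat \<Rightarrow> int" where m: "\<And>k. k < valence x \<Longrightarrow> has_slope g (arm x k) (m k)"
    using PL_slopes[OF assms(1) True] by blast
  obtain n :: "nat \<Rightarrow> int" where n: "\<And>k. k < valence x \<Longrightarrow> has_slope h (arm x k) (n k)"
    using PL_slopes[OF assms(2) True] by blast
  show ?thesis using Ord_F[OF True m] Ord_F[OF True n] Ord_F[OF True has_slope_add[OF m n]]
    by (simp add: sum.distrib)
next
  case False
  then show ?thesis using Ord_end PL_add assms points_eq by force
qed

lemma Ord_minus:
  assumes "PL g" "x \<in> points \<Gamma>"
  shows "Ord (\<lambda>x. - g x) x = - Ord g x"
proof (cases "x \<in> F")
  case True
  obtain m :: "nat \<Rightarrow> int" where m: "\<And>k. k < valence x \<Longrightarrow> has_slope g (arm x k) (m k)"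
    using PL_slopes[OF assms(1) True] by blast
  show ?thesis using Ord_F[OF True m] Ord_F[OF True has_slope_minus[OF m]]
    by (simp add: sum_negf)
next
  case False
  then show ?thesis using Ord_end PL_minus assms points_eq by force
qed

lemma Ord_const: "x \<in> points \<Gamma> \<Longrightarrow> Ord (\<lambda>x. c) x = 0"
  using Ord_F[of x "\<lambda>x. c" "\<lambda>_. 0"] Ord_end[OF PL_const] points_eq by (auto simp: has_slope_def)

lemma PL_cong_F: 
  assumes "PL g" "\<And>x. x \<in> F \<Longrightarrow> g x = h x" shows "PL h"
proof -
  have "\<exists>m::int. has_slope h (arm x k) m" if x: "x \<in> F" and k: "k < valence x" for x k
  proof -
    obtain m :: int where m: "has_slope g (arm x k) m" using assms x k unfolding PL_def by blast
    obtain r where r: "0 < r" "good_chart x (valence x) r (arm x)" using arm_good[OF x] by blast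
    have "\<forall>\<^sub>F t in at_right 0. arm x k t \<in> F"
      using good_chart_arm_d(1)[OF r(2) k] r(1) by (auto simp: eventually_at_right_field intro!: exI[of _ r])
    then have "has_slope h (arm x k) m" using m unfolding has_slope_def
      by eventually_elim (use assms(2) arm_0[OF x k] x in auto)
    then show ?thesis by blast
  qed
  moreover have "locally_const_at_ends h"
    using assms unfolding PL_def locally_const_at_ends_def by (metis IntD2)
  ultimately show ?thesis unfolding PL_def by blast
qed

lemma Ord_cong_F:
  assumes "PL g" "\<And>x. x \<in> F \<Longrightarrow> g x = h x" "x \<in> points \<Gamma>" shows "Ord h x = Ord g x"
  using ord_at_eq_Ord[OF assms(1), of "\<lambda>x. ereal (h x)"] assms unfolding Ord_def by simp

section \<open>Continuity, and comparison with rational functions\<close>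

lemma PL_local_lipschitz:
  assumes g: "PL g" and z: "z \<in> F"
    and K: "\<And>k m. k < valence z \<Longrightarrow> has_slope g (arm z k) m \<Longrightarrow> \<bar>m\<bar> \<le> K"
  shows "\<exists>e>0. \<forall>w\<in>F. d z w < e \<longrightarrow> \<bar>g w - g z\<bar> \<le> K * d z w"
proof -
  obtain m r where r: "0 < r" "good_chart z (valence z) r (arm z)"
    "\<And>k t. k < valence z \<Longrightarrow> 0 \<le> t \<Longrightarrow> t \<le> r \<Longrightarrow> g (arm z k t) = g z + real_of_int (m k) * t"
    "\<And>k. k < valence z \<Longrightarrow> has_slope g (arm z k) (m k)"
    by (rule PL_good_chart[OF g z]) (rule that; blast intro: order_refl)
  have "\<bar>g w - g z\<bar> \<le> K * d z w" if w: "w \<in> F" "d z w < r" for w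
  proof (cases "w = z")
    case False
    then obtain k where k: "k < valence z" "w = arm z k (d z w)"
      using r(2) w unfolding good_chart_def by blast
    have "g w = g z + real_of_int (m k) * d z w" using r(3)[OF k(1), of "d z w"] k(2) w by simp
    then have "\<bar>g w - g z\<bar> = \<bar>real_of_int (m k)\<bar> * d z w" by (simp add: abs_mult)
    also have "\<dots> \<le> K * d z w" using K[OF k(1) r(4)[OF k(1)]] by (simp add: mult_right_mono)
    finally show ?thesis .
  qed (use z in auto)
  with r(1) show ?thesis by blast
qed

text \<open>\<open>PL\<close> does not mention continuity; it is contained in
  \<open>has_slope\<close>, because every arm starts at \<open>x\<close> with the value
  \<open>g x\<close>. The sum of the absolute slopes at \<open>z\<close> serves as a Lipschitz
  constant.\<close>

lemma PL_continuous:
  assumes g: "PL g" and z: "z \<in> F" and eps: "0 < \<epsilon>"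
  shows "\<exists>e>0. \<forall>w\<in>F. d z w < e \<longrightarrow> \<bar>g w - g z\<bar> < \<epsilon>"
proof -
  obtain m :: "nat \<Rightarrow> int" where m: "\<And>k. k < valence z \<Longrightarrow> has_slope g (arm z k) (m k)"
    using PL_slopes[OF g z] by blast
  define K where "K = (\<Sum>k<valence z. real_of_int \<bar>m k\<bar>)"
  have K0: "0 \<le> K" unfolding K_def by (simp add: sum_nonneg)
  have "\<bar>s\<bar> \<le> K" if k: "k < valence z" and s: "has_slope g (arm z k) s" for k s
  proof -
    have "s = m k" using has_slope_unique[OF s m[OF k]] .
    then have "\<bar>s\<bar> = real_of_int \<bar>m k\<bar>" by simp
    also have "\<dots> \<le> K" unfolding K_def using k by (intro member_le_sum) auto
    finally show ?thesis .
  qed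
  then obtain e where e: "e > 0" "\<forall>w\<in>F. d z w < e \<longrightarrow> \<bar>g w - g z\<bar> \<le> K * d z w"
    using PL_local_lipschitz[OF g z] by meson
  define e' where "e' = min e (\<epsilon> / (K + 1))"
  have "\<bar>g w - g z\<bar> < \<epsilon>" if "w \<in> F" "d z w < e'" for w
  proof -
    have "\<bar>g w - g z\<bar> \<le> K * d z w" using e(2) that by (auto simp: e'_def)
    also have "\<dots> \<le> K * (\<epsilon> / (K + 1))" using that K0 by (intro mult_left_mono) (auto simp: e'_def)
    also have "\<dots> < \<epsilon>" using K0 eps by (simp add: field_simps)
    finally show ?thesis .
  qed
  moreover have "e' > 0" using e(1) K0 eps by (simp add: e'_def)
  ultimately show ?thesis by blast
qed

text \<open>At each end the value is redefined as a constant that \<open>g\<close> takes nearby,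
  since \<open>PL\<close> leaves it free while continuity determines it.\<close>

lemma PL_imp_rational:
  assumes g: "PL g"
  obtains f where "rational_function \<Gamma> f" "\<And>x. x \<in> F \<Longrightarrow> f x = ereal (g x)"
proof -
  have "\<forall>p\<in>ends. \<exists>Uc. openin X (fst Uc) \<and> p \<in> fst Uc \<and> (\<forall>y\<in>fst Uc \<inter> F. g y = snd Uc)"
    using g unfolding PL_def locally_const_at_ends_def by auto
  from bchoice[OF this] obtain Uc where Uc:
    "\<forall>p\<in>ends. openin X (fst (Uc p)) \<and> p \<in> fst (Uc p) \<and> (\<forall>y\<in>fst (Uc p) \<inter> F. g y = snd (Uc p))" ..
  define f where "f x = (if x \<in> F then ereal (g x) else ereal (snd (Uc x)))" for x
  have "\<exists>U. openin X U \<and> x \<in> U \<and> (\<forall>y\<in>U. f y \<in> V)"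
    if x: "x \<in> topspace X" and V: "open V" "f x \<in> V" for x V
  proof (cases "x \<in> F")
    case True
    have "open (ereal -` V)" using V(1) by (rule open_ereal_vimage)
    moreover have "g x \<in> ereal -` V" using V True by (simp add: f_def)
    ultimately obtain \<epsilon> where eps: "\<epsilon> > 0" "\<And>v. \<bar>v - g x\<bar> < \<epsilon> \<Longrightarrow> v \<in> ereal -` V"
      unfolding open_dist dist_real_def by blast
    obtain e where e: "e > 0" "\<forall>w\<in>F. d x w < e \<longrightarrow> \<bar>g w - g x\<bar> < \<epsilon>"
      using PL_continuous[OF g True eps(1)] by blast
    have "\<forall>y\<in>mball x e. f y \<in> V" using e(2) eps(2) by (auto simp: f_def)
    then show ?thesis using openin_mball_X[of x e] e(1) True by (intro exI[of _ "mball x e"]) auto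
  next
    case False
    then have p: "x \<in> ends" using x topspace_X by blast
    \<comment> \<open>The constancy of \<open>g\<close> concerns finite points only, so the other
      ends have to be removed from the neighbourhood.\<close>
    let ?U = "fst (Uc x) - (ends - {x})"
    have "closedin X (ends - {x})"
      using closedin_Hausdorff_finite[OF Hausdorff_X] finite_inf topspace_X by auto
    then have "openin X ?U" using Uc p by blast
    moreover have "\<forall>y\<in>?U. f y \<in> V"
    proof
      fix y assume y: "y \<in> ?U"
      then have "y \<in> topspace X" using Uc p openin_subset by blast
      then have "y = x \<or> y \<in> F" using y topspace_X by blast
      then have "f y = f x" using y Uc p False by (auto simp: f_def)
      then show "f y \<in> V" using V by simp
    qed
    ultimately show ?thesis using Uc p by (intro exI[of _ ?U]) auto
  qed
  then have "continuous_map X euclidean f"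
    unfolding continuous_map_eq_topcontinuous_at topcontinuous_at_def by auto
  moreover have "piecewise_linear \<Gamma> f"
  proof -
    obtain S M C where S: "finite S"
      "\<And>y. y \<in> points \<Gamma> - S \<Longrightarrow> \<exists>m\<in>M. nice g m y \<and> (m = 0 \<longrightarrow> g y \<in> (C :: real set))"
      by (rule PL_finite_structure[OF g]) (rule that)
    have "ends \<subseteq> S"
    proof
      fix p assume p: "p \<in> ends"
      show "p \<in> S"
      proof (rule ccontr)
        assume "p \<notin> S"
        then obtain m where "nice g m p" using S(2)[of p] p points_eq by blast
        then show False using p F_inf_disjoint unfolding nice_def by blast
      qed
    qed
    moreover have "\<exists>r \<phi> (m::int). star_chart \<Gamma> x 2 r \<phi> \<and>
           (\<forall>t\<in>{0..<r}. f (\<phi> 0 t) = f x + ereal (real_of_int m * t) \<and> f (\<phi> 1 t) = f x - ereal (real_of_int m * t))"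
      if "x \<in> points \<Gamma> - S" for x
    proof -
      obtain m where "nice g m x" using S(2) \<open>x \<in> points \<Gamma> - S\<close> by blast
      then obtain r \<phi> where x: "x \<in> F" and c: "star_chart \<Gamma> x 2 r \<phi>"
        and s: "has_slope g (\<phi> 0) m" "has_slope g (\<phi> 1) (- real_of_int m)"
        unfolding nice_def by blast
      obtain r0 where r0: "r0 > 0" "\<And>q. 0 < q \<Longrightarrow> q \<le> r0 \<Longrightarrow> good_chart x 2 q \<phi>"
        using good_chart_ex[OF c x] by blast
      obtain e1 e2 :: real where e: "e1 > 0" "\<forall>t\<in>{0..<e1}. g (\<phi> 0 t) = g (\<phi> 0 0) + m * t"
        "e2 > 0" "\<forall>t\<in>{0..<e2}. g (\<phi> 1 t) = g (\<phi> 1 0) - m * t"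
        using s unfolding has_slope_iff by auto
      define q where "q = min r0 (min e1 e2)"
      have q: "q > 0" and gc: "good_chart x 2 q \<phi>" using r0 e by (auto simp: q_def)
      have "f (\<phi> 0 t) = f x + ereal (real_of_int m * t) \<and> f (\<phi> 1 t) = f x - ereal (real_of_int m * t)" if t: "t \<in> {0..<q}" for t
      proof -
        have "\<phi> 0 0 = x" "\<phi> 1 0 = x" using gc unfolding good_chart_def by auto
        moreover have "\<phi> 0 t \<in> F" "\<phi> 1 t \<in> F"
          using good_chart_arm_d(1)[OF gc, of 0 t] good_chart_arm_d(1)[OF gc, of 1 t] t by auto
        moreover have "g (\<phi> 0 t) = g (\<phi> 0 0) + m * t" "g (\<phi> 1 t) = g (\<phi> 1 0) - m * t"
          using e(2)[rule_format, of t] e(4)[rule_format, of t] t by (auto simp: q_def)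
        ultimately show ?thesis using x by (simp add: f_def)
      qed
      moreover have "star_chart \<Gamma> x 2 q \<phi>" using gc unfolding good_chart_def by blast
      ultimately show ?thesis by (intro exI[of _ q] exI[of _ \<phi>] exI[of _ m] conjI ballI) blast+
    qed
    ultimately show ?thesis using S(1) unfolding piecewise_linear_def by blast
  qed
  ultimately have "rational_function \<Gamma> f" unfolding rational_function_def by (auto simp: f_def)
  then show ?thesis using that[of f] by (simp add: f_def)
qed

text \<open>Off the finite set \<open>S\<close> the function is locally affine along arms and tails,
  and gluing yields a single integer slope on each punctured arm and on each tail. Continuity closes
  the gap at the centre of an arm; on a tail the order at the end is minus the slope, so order 0
  makes the tail constant.\<close>

lemma rational_imp_PL:
  assumes f: "rational_function \<Gamma> f" and ord: "\<And>p. p \<in> ends \<Longrightarrow> ord_at \<Gamma> f p = 0"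
  shows "PL (\<lambda>x. real_of_ereal (f x))"
proof -
  define g where "g = (\<lambda>x. real_of_ereal (f x))"
  have cont: "continuous_map X euclidean f" and fin: "\<And>x. x \<in> F \<Longrightarrow> f x = ereal (g x)"
    and pl: "piecewise_linear \<Gamma> f"
    using f unfolding rational_function_def g_def by (auto simp: ereal_real)
  obtain S where S: "finite S" "ends \<subseteq> S" and
    ch: "\<And>x. x \<in> points \<Gamma> - S \<Longrightarrow> \<exists>r \<phi> (m::int). star_chart \<Gamma> x 2 r \<phi> \<and>
           (\<forall>t\<in>{0..<r}. f (\<phi> 0 t) = f x + ereal (real_of_int m * t) \<and> f (\<phi> 1 t) = f x - ereal (real_of_int m * t))"
    using pl unfolding piecewise_linear_def by blast
  have nice: "\<exists>m. nice g m x" if x: "x \<in> points \<Gamma> - S" for x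
  proof -
    obtain r \<phi> and m :: int where c: "star_chart \<Gamma> x 2 r \<phi>"
      "\<forall>t\<in>{0..<r}. f (\<phi> 0 t) = f x + ereal (real_of_int m * t) \<and> f (\<phi> 1 t) = f x - ereal (real_of_int m * t)"
      using ch[OF x] by blast
    have xF: "x \<in> F" using x S points_eq by blast
    have r: "0 < r" "\<phi> 0 0 = x" "\<phi> 1 0 = x" "\<And>t. 0 \<le> t \<Longrightarrow> t < r \<Longrightarrow> \<phi> 0 t \<in> F"
      "\<And>t. 0 \<le> t \<Longrightarrow> t < r \<Longrightarrow> \<phi> 1 t \<in> F"
      using c(1) unfolding star_chart_def by auto
    have "g (\<phi> 0 t) = g (\<phi> 0 0) + real_of_int m * t \<and> g (\<phi> 1 t) = g (\<phi> 1 0) + - real_of_int m * t"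
      if t: "t \<in> {0..<r}" for t
    proof -
      have "f (\<phi> 0 t) = f x + ereal (real_of_int m * t)" "f (\<phi> 1 t) = f x - ereal (real_of_int m * t)"
        using c(2) t by blast+
      then show ?thesis unfolding g_def r(2,3) using fin[OF xF] by simp
    qed
    then have "has_slope g (\<phi> 0) m" "has_slope g (\<phi> 1) (- real_of_int m)"
      unfolding has_slope_iff using r(1) by blast+
    then show ?thesis using c(1) xF unfolding nice_def by blast
  qed
  have loc: "\<exists>m::int. \<exists>e>0. \<forall>y. \<bar>y - v\<bar> < e \<longrightarrow> g (\<alpha> y) = g (\<alpha> v) + real_of_int m * (y - v)"
    if s: "segment a b \<alpha>" "a < v" "v < b" "\<alpha> v \<notin> S" for a b \<alpha> v
  proof -
    have "\<alpha> v \<in> points \<Gamma> - S" using segment_F[OF s(1), of v] s points_eq by auto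
    then obtain m where "nice g m (\<alpha> v)" using nice by blast
    from nice_on_segment[OF s(1-3) this] show ?thesis .
  qed
  have nbhd: "\<exists>U. openin X U \<and> x \<in> U \<and> U \<inter> S \<subseteq> {x}" if "x \<in> points \<Gamma>" for x
  proof -
    have "closedin X (S \<inter> points \<Gamma> - {x})"
      using closedin_Hausdorff_finite[OF Hausdorff_X, of "S \<inter> points \<Gamma> - {x}"] S(1)
      by (auto simp: points_def)
    then have "openin X (topspace X - (S \<inter> points \<Gamma> - {x}))" by (simp add: closedin_def)
    then show ?thesis using \<open>x \<in> points \<Gamma>\<close>
      by (intro exI[of _ "topspace X - (S \<inter> points \<Gamma> - {x})"]) (auto simp: points_def)
  qed
  have "\<exists>m::int. has_slope g (arm x k) m" if x: "x \<in> F" and k: "k < valence x" for x k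
  proof -
    obtain U where U: "openin X U" "x \<in> U" "U \<inter> S \<subseteq> {x}" using nbhd[of x] x points_eq by blast
    obtain r1 where r1: "r1 > 0" "mball x r1 \<subseteq> U" using open_contains_mball[OF U(1,2) x] by blast
    obtain r2 where r2: "r2 > 0" "\<And>q. 0 < q \<Longrightarrow> q \<le> r2 \<Longrightarrow> good_chart x (valence x) q (arm x)"
      using arm_good[OF x] by blast
    define r where "r = min r1 r2"
    have r: "r > 0" "good_chart x (valence x) r (arm x)" using r1 r2 by (auto simp: r_def)
    let ?\<alpha> = "arm x k"
    have seg: "segment 0 r ?\<alpha>" using r(2) k unfolding good_chart_def by blast
    have \<alpha>0: "?\<alpha> 0 = x" using arm_0[OF x k] .
    have notS: "?\<alpha> v \<notin> S" if v: "0 < v" "v < r" for v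
    proof -
      have "?\<alpha> v \<in> F" "d x (?\<alpha> v) = v" using good_chart_arm_d[OF r(2) k, of v] v by auto
      then have "?\<alpha> v \<in> U" "?\<alpha> v \<noteq> x" using r1 v x by (auto simp: r_def)
      then show ?thesis using U(3) by blast
    qed
    have "\<exists>m::int. \<forall>s\<in>{0<..<r}. \<forall>t\<in>{0<..<r}. g (?\<alpha> t) = g (?\<alpha> s) + real_of_int m * (t - s)"
    proof (rule locally_affine_imp_affine)
      fix v assume "v \<in> {0<..<r}"
      then show "\<exists>m::int. \<exists>e>0. \<forall>y. \<bar>y - v\<bar> < e \<longrightarrow>
          g (?\<alpha> y) = g (?\<alpha> v) + real_of_int m * (y - v)"
        using loc[OF seg, of v] notS by auto
    qed auto
    then obtain m :: int
      where "\<forall>s\<in>{0<..<r}. \<forall>t\<in>{0<..<r}. g (?\<alpha> t) = g (?\<alpha> s) + real_of_int m * (t - s)" ..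
    note m = this[THEN bspec, THEN bspec]
    have iso: "isometric_on {0..r} ?\<alpha>" using seg unfolding segment_def by blast
    have "continuous_map (top_of_set {0..r}) euclidean (f \<circ> ?\<alpha>)"
      using continuous_map_compose[OF isometric_on_continuous[OF iso] cont] .
    then have "continuous_on {0..r} (f \<circ> ?\<alpha>)" by simp
    then have "((f \<circ> ?\<alpha>) \<longlongrightarrow> (f \<circ> ?\<alpha>) 0) (at 0 within {0..r})"
      using r(1) by (simp add: continuous_on_def o_def)
    then have "((\<lambda>t. f (?\<alpha> t)) \<longlongrightarrow> ereal (g x)) (at_right 0)"
      using at_within_Icc_at_right[OF r(1)] \<alpha>0 fin[OF x] by (simp add: o_def)
    then have "((\<lambda>t. real_of_ereal (f (?\<alpha> t))) \<longlongrightarrow> g x) (at_right 0)" by (rule lim_real_of_ereal)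
    then have lim1: "((\<lambda>t. g (?\<alpha> t)) \<longlongrightarrow> g x) (at_right 0)" by (simp add: g_def)
    \<comment> \<open>The value at parameter 0 of the affine extension from the punctured arm; both
      \<open>c\<close> and \<open>g x\<close> are limits of \<open>g\<close> along the arm, hence
      equal.\<close>
    define c where "c = g (?\<alpha> (r/2)) - real_of_int m * (r/2)"
    have lin: "g (?\<alpha> t) = c + real_of_int m * t" if "0 < t" "t < r" for t
      using m[of "r/2" t] that r(1) by (simp add: c_def algebra_simps)
    have "((\<lambda>t. c + real_of_int m * t) \<longlongrightarrow> c + real_of_int m * 0) (at_right 0)"
      by (intro tendsto_intros)
    moreover have "\<forall>\<^sub>F t in at_right 0. c + real_of_int m * t = g (?\<alpha> t)"
      using lin r(1) by (auto simp: eventually_at_right_field)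
    ultimately have "((\<lambda>t. g (?\<alpha> t)) \<longlongrightarrow> c) (at_right 0)"
      by (simp add: filterlim_cong)
    then have "g x = c" using tendsto_unique[OF _ lim1] by simp
    then have "\<forall>\<^sub>F t in at_right 0. g (?\<alpha> t) = g (?\<alpha> 0) + real_of_int m * t"
      using lin r(1) \<alpha>0 by (auto simp: eventually_at_right_field)
    then show ?thesis unfolding has_slope_def by blast
  qed
  moreover have "locally_const_at_ends g"
  proof (rule locally_constI)
    fix p assume p: "p \<in> ends"
    define \<rho> where "\<rho> = (SOME \<rho>. end_chart \<Gamma> p \<rho>)"
    have \<rho>: "end_chart \<Gamma> p \<rho>" unfolding \<rho>_def using end_chart_ex[OF p] by (rule someI_ex)
    obtain U where U: "openin X U" "p \<in> U" "U \<inter> S \<subseteq> {p}" using nbhd[of p] p points_eq by blast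
    obtain T where T: "0 \<le> T" "\<And>t. T \<le> t \<Longrightarrow> \<rho> t \<in> U" using end_eventually[OF \<rho> U(1,2)] by blast
    have notS: "\<rho> v \<notin> S" if v: "T < v" for v
    proof -
      have "\<rho> v \<in> F" using \<rho> v T(1) unfolding end_chart_def by auto
      then have "\<rho> v \<noteq> p" using p F_inf_disjoint by auto
      then show ?thesis using T(2)[of v] v U(3) by auto
    qed
    have "\<exists>m::int. \<forall>s\<in>{T<..}. \<forall>t\<in>{T<..}. g (\<rho> t) = g (\<rho> s) + real_of_int m * (t - s)"
    proof (rule locally_affine_imp_affine)
      fix v assume "v \<in> {T<..}"
      then show "\<exists>m::int. \<exists>e>0. \<forall>y. \<bar>y - v\<bar> < e \<longrightarrow> g (\<rho> y) = g (\<rho> v) + real_of_int m * (y - v)"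
        using loc[OF end_segment[OF \<rho> p T(1), of "v + 1"], of v] notS by auto
    qed auto
    then obtain m :: int
      where "\<forall>s\<in>{T<..}. \<forall>t\<in>{T<..}. g (\<rho> t) = g (\<rho> s) + real_of_int m * (t - s)" ..
    note m = this[THEN bspec, THEN bspec]
    have "\<forall>\<^sub>F t in at_top. g (\<rho> t) - g (\<rho> (t + 1)) = - real_of_int m"
      using eventually_gt_at_top[of T]
    proof eventually_elim
      case (elim t) then show ?case using m[of t "t + 1"] by simp
    qed
    then have "outgoing_slope_inf f \<rho> = - real_of_int m"
      unfolding outgoing_slope_inf_def g_def by (intro tendsto_Lim tendsto_eventually) auto
    then have "m = 0" using ord[OF p] p unfolding ord_at_def \<rho>_def by simp
    then have eq: "g (\<rho> t) = g (\<rho> (T + 1))" if "t > T" for t using m[of "T + 1" t] that by simp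
    obtain c where "\<forall>t>T. g (\<rho> t) = c"
    proof
      show "\<forall>t>T. g (\<rho> t) = g (\<rho> (T + 1))" using eq by iprover
    qed
    then show "\<exists>\<rho> T c. 0 \<le> T \<and> end_chart \<Gamma> p \<rho> \<and> (\<forall>t>T. g (\<rho> t) = c)"
      using T(1) \<rho> by blast
  qed
  ultimately show ?thesis unfolding PL_def g_def by blast
qed

subsection \<open>The distance to a subgraph\<close>

text \<open>The open segment and the complement of the closed one are disjoint open sets. They cover
  \<open>C\<close> because \<open>C\<close> avoids both endpoints, so \<open>C\<close> cannot meet
  both of them.\<close>

lemma connected_in_segment:
  assumes C: "connectedin X C" and s: "segment a b \<alpha>" and e: "\<alpha> a \<notin> C" "\<alpha> b \<notin> C"
    and u: "a < u" "u < b" "\<alpha> u \<in> C"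
  shows "C \<subseteq> \<alpha> ` {a<..<b}"
proof (rule ccontr)
  assume not: "\<not> C \<subseteq> \<alpha> ` {a<..<b}"
  let ?U = "\<alpha> ` {a<..<b}" and ?V = "topspace X - \<alpha> ` {a..b}"
  have op: "openin X ?U" "openin X ?V"
    using s isometric_closed[of "{a..b}" \<alpha> "{a..b}"] unfolding segment_def by (auto simp: closedin_def)
  have eq: "\<alpha> ` {a..b} = ?U \<union> {\<alpha> a, \<alpha> b}" 
  proof -
    have "{a..b} = {a<..<b} \<union> {a, b}" using u by auto
    then show ?thesis by auto
  qed
  have "C \<subseteq> topspace X" using C connectedin_subset_topspace by blast
  then have "C \<subseteq> ?U \<union> ?V" "?V \<inter> C \<noteq> {}" using e not unfolding eq by blast+
  moreover have "?U \<inter> ?V \<inter> C = {}" unfolding eq by blast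
  moreover have "\<alpha> u \<in> ?U" using u by simp
  then have "?U \<inter> C \<noteq> {}" using u(3) by blast
  ultimately show False using C op unfolding connectedin by metis
qed

text \<open>A geodesic from an interior point to a point outside is connected, so it passes through
  an endpoint of the segment, and distances add along it.\<close>

lemma segment_exit_dist:
  assumes s: "segment a b \<alpha>" and v: "a \<le> v" "v \<le> b" and z: "z \<in> F" "z \<notin> \<alpha> ` {a<..<b}"
  shows "d (\<alpha> v) z = min (v - a + d (\<alpha> a) z) (b - v + d (\<alpha> b) z)"
proof -
  note F = segment_F[OF s]
  have Fv: "\<alpha> v \<in> F" "\<alpha> a \<in> F" "\<alpha> b \<in> F" using F[of v] F[of a] F[of b] v by auto
  have dv: "d (\<alpha> v) (\<alpha> a) = v - a" "d (\<alpha> v) (\<alpha> b) = b - v" using segment_d[OF s] v by auto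
  have le: "d (\<alpha> v) z \<le> v - a + d (\<alpha> a) z" "d (\<alpha> v) z \<le> b - v + d (\<alpha> b) z"
    using triangle[of "\<alpha> v" "\<alpha> a" z] triangle[of "\<alpha> v" "\<alpha> b" z] Fv z dv by auto
  show ?thesis
  proof (cases "v = a \<or> v = b")
    case True then show ?thesis using le by (auto simp: min_def)
  next
    case False
    obtain \<gamma> where \<gamma>: "\<gamma> 0 = \<alpha> v" "\<gamma> (d (\<alpha> v) z) = z" "isometric_on {0..d (\<alpha> v) z} \<gamma>"
      using geodesic_ex[OF Fv(1) z(1)] unfolding isometric_on_def by blast
    let ?C = "\<gamma> ` {0..d (\<alpha> v) z}"
    have conn: "connectedin X ?C" using isometric_connected[OF \<gamma>(3)] by auto
    have ends: "\<alpha> v \<in> ?C" "z \<in> ?C"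
      using \<gamma>(1,2) image_eqI[of "\<alpha> v" \<gamma> 0] image_eqI[of z \<gamma> "d (\<alpha> v) z"] by auto
    have "\<alpha> a \<in> ?C \<or> \<alpha> b \<in> ?C"
      using connected_in_segment[OF conn s, of v] ends z v False by force
    then obtain s where s: "s \<in> {0..d (\<alpha> v) z}" "\<gamma> s = \<alpha> a \<or> \<gamma> s = \<alpha> b" by force
    have "d (\<alpha> v) (\<gamma> s) = s" "d (\<gamma> s) z = d (\<alpha> v) z - s"
      using \<gamma>(3) s(1) unfolding isometric_on_def
      using \<gamma>(1,2) by (metis (no_types, lifting) abs_minus_commute abs_of_nonneg atLeastAtMost_iff
          diff_zero nonneg order_refl diff_ge_0_iff_ge)+
    then have "d (\<alpha> v) z = d (\<alpha> v) (\<gamma> s) + d (\<gamma> s) z" by simp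
    then show ?thesis using s(2) dv le by (auto simp: min_def)
  qed
qed

text \<open>Meaningful only if \<open>A\<close> contains a point that is not at infinity (\<open>Inf {}\<close> otherwise).\<close>

definition dist_set :: "'a set \<Rightarrow> 'a \<Rightarrow> real"
  where "dist_set A x = (INF a\<in>A \<inter> F. d x a)"

lemma dist_set_le: "a \<in> A \<Longrightarrow> a \<in> F \<Longrightarrow> dist_set A x \<le> d x a"
  unfolding dist_set_def by (rule cINF_lower) (auto intro!: bdd_belowI[of _ 0])

lemma dist_set_greatest:
  "A \<inter> F \<noteq> {} \<Longrightarrow> (\<And>a. a \<in> A \<Longrightarrow> a \<in> F \<Longrightarrow> c \<le> d x a) \<Longrightarrow> c \<le> dist_set A x"
  unfolding dist_set_def by (rule cINF_greatest) auto

lemma dist_set_nonneg: "A \<inter> F \<noteq> {} \<Longrightarrow> 0 \<le> dist_set A x"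
  by (rule dist_set_greatest) auto

lemma dist_set_eq_0: "x \<in> A \<Longrightarrow> x \<in> F \<Longrightarrow> dist_set A x = 0"
  using dist_set_le[of x A x] dist_set_nonneg[of A x] by fastforce

text \<open>If \<open>A\<close> contains no finite point, all distances from \<open>x\<close> are
  infinite and the move is the constant \<open>- l\<close>.\<close>

lemma CF_finite:
  assumes x: "x \<in> F" and A: "A \<subseteq> topspace X"
  shows "CF \<Gamma> A l x = - ereal (if A \<inter> F = {} then l else min l (dist_set A x))"
proof -
  have "x \<notin> ends" using x F_inf_disjoint by blast
  then have ext: "ext_dist \<Gamma> x y = (if y \<in> F then ereal (d x y) else \<infinity>)" if "y \<in> A" for y
    using that x A topspace_X F_inf_disjoint unfolding ext_dist_def by auto
  show ?thesis
  proof (cases "A \<inter> F = {}")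
    case True
    then have "dist_to_set \<Gamma> x A = \<infinity>"
      unfolding dist_to_set_def using ext by (auto simp: top_ereal_def intro!: INF_eqI[where x = "top::ereal", simplified top_ereal_def])
    then show ?thesis unfolding CF_def using True by (simp add: min_def)
  next
    case False
    then obtain a where a: "a \<in> A" "a \<in> F" by blast
    define I where "I = dist_to_set \<Gamma> x A"
    have le: "I \<le> ereal (d x y)" if "y \<in> A" "y \<in> F" for y
      unfolding I_def dist_to_set_def using INF_lower[of y A "ext_dist \<Gamma> x"] ext that by auto
    have ge: "ereal (dist_set A x) \<le> I"
      unfolding I_def dist_to_set_def
      by (rule INF_greatest) (auto simp: ext intro: dist_set_le)
    have "I = ereal (dist_set A x)"
    proof (cases I)
      case (real i)
      have "i \<le> dist_set A x" using le real by (intro dist_set_greatest[OF False]) auto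
      then show ?thesis using ge real by simp
    qed (use le[OF a] ge in auto)
    then show ?thesis unfolding CF_def I_def using False by (simp add: min_def)
  qed
qed

lemma dist_set_segment:
  assumes A: "A \<inter> F \<noteq> {}" and s: "segment a b \<alpha>" and v: "a \<le> v" "v \<le> b"
    and disj: "A \<inter> \<alpha> ` {a<..<b} = {}"
  shows "dist_set A (\<alpha> v) = min (v - a + dist_set A (\<alpha> a)) (b - v + dist_set A (\<alpha> b))"
proof (rule antisym)
  have eq: "d (\<alpha> v) z = min (v - a + d (\<alpha> a) z) (b - v + d (\<alpha> b) z)" if "z \<in> A" "z \<in> F" for z
    using segment_exit_dist[OF s v \<open>z \<in> F\<close>] that disj by blast
  have "dist_set A (\<alpha> v) - (v - a) \<le> dist_set A (\<alpha> a)"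
    using dist_set_le[of _ A "\<alpha> v"] eq by (intro dist_set_greatest[OF A]) (smt (verit) min.cobounded1)
  moreover have "dist_set A (\<alpha> v) - (b - v) \<le> dist_set A (\<alpha> b)"
    using dist_set_le[of _ A "\<alpha> v"] eq by (intro dist_set_greatest[OF A]) (smt (verit) min.cobounded2)
  ultimately show "dist_set A (\<alpha> v) \<le> min (v - a + dist_set A (\<alpha> a)) (b - v + dist_set A (\<alpha> b))" by auto
  show "min (v - a + dist_set A (\<alpha> a)) (b - v + dist_set A (\<alpha> b)) \<le> dist_set A (\<alpha> v)"
  proof (rule dist_set_greatest[OF A])
    fix z assume z: "z \<in> A" "z \<in> F"
    show "min (v - a + dist_set A (\<alpha> a)) (b - v + dist_set A (\<alpha> b)) \<le> d (\<alpha> v) z"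
      unfolding eq[OF z] using dist_set_le[OF z, of "\<alpha> a"] dist_set_le[OF z, of "\<alpha> b"]
      by (intro min.mono) auto
  qed
qed

text \<open>Finiteness of the set of components enters here: if no component eventually contains the
  path, each is eventually avoided, and finitely many such statements hold simultaneously. The
  filter is kept abstract to serve both arms and ends.\<close>

lemma subgraph_eventually:
  assumes A: "subgraph \<Gamma> A"
    and C: "\<And>C. connectedin X C \<Longrightarrow> (\<forall>\<^sub>F t in G. \<alpha> t \<in> C) \<or> (\<forall>\<^sub>F t in G. \<alpha> t \<notin> C)"
  shows "(\<forall>\<^sub>F t in G. \<alpha> t \<in> A) \<or> (\<forall>\<^sub>F t in G. \<alpha> t \<notin> A)"
proof -
  let ?K = "connected_components_of (subtopology X A)"
  have "A \<subseteq> topspace X" using A unfolding subgraph_def by (simp add: compactin_subset_topspace)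
  then have un: "\<Union>?K = A" using Union_connected_components_of[of "subtopology X A"]
    by (metis topspace_subtopology_subset)
  have con: "connectedin X C" if "C \<in> ?K" for C
    using connectedin_connected_components_of[OF that] by (simp add: connectedin_subtopology)
  show ?thesis
  proof (cases "\<exists>C\<in>?K. \<forall>\<^sub>F t in G. \<alpha> t \<in> C")
    case True
    then obtain C where "C \<in> ?K" "\<forall>\<^sub>F t in G. \<alpha> t \<in> C" by blast
    then have "\<forall>\<^sub>F t in G. \<alpha> t \<in> A" by (elim eventually_mono) (use un in blast)
    then show ?thesis ..
  next
    case False
    then have "\<forall>C\<in>?K. \<forall>\<^sub>F t in G. \<alpha> t \<notin> C" using C con by blast
    moreover have "finite ?K" using A unfolding subgraph_def by blast
    ultimately have "\<forall>\<^sub>F t in G. \<forall>C\<in>?K. \<alpha> t \<notin> C" by (intro eventually_ball_finite)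
    then have "\<forall>\<^sub>F t in G. \<alpha> t \<notin> A" by (elim eventually_mono) (use un in blast)
    then show ?thesis ..
  qed
qed

text \<open>If \<open>C\<close> were hit and missed arbitrarily close to 0, two misses with a hit
  between them would trap all of \<open>C\<close> between them, although there is a further hit
  closer to 0.\<close>

lemma connected_eventually_at_right:
  assumes C: "connectedin X C" and s: "segment 0 r \<alpha>" "0 < r"
  shows "(\<forall>\<^sub>F t in at_right 0. \<alpha> t \<in> C) \<or> (\<forall>\<^sub>F t in at_right 0. \<alpha> t \<notin> C)"
proof (rule ccontr)
  assume "\<not> ?thesis"
  then have ex: "\<exists>t. 0 < t \<and> t < e \<and> \<alpha> t \<in> C" "\<exists>t. 0 < t \<and> t < e \<and> \<alpha> t \<notin> C" if "0 < e" for e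
    using that unfolding eventually_at_right_field by blast+
  obtain b where b: "0 < b" "b < r" "\<alpha> b \<notin> C" using ex(2)[of r] s by blast
  obtain u where u: "0 < u" "u < b" "\<alpha> u \<in> C" using ex(1)[of b] b by blast
  obtain a where a: "0 < a" "a < u" "\<alpha> a \<notin> C" using ex(2)[of u] u by blast
  obtain w where w: "0 < w" "w < a" "\<alpha> w \<in> C" using ex(1)[of a] a by blast
  have "segment a b \<alpha>" using segment_subset[OF s(1)] a b by auto
  then have "C \<subseteq> \<alpha> ` {a<..<b}" using connected_in_segment[OF C] a b u by blast
  then obtain t where t: "\<alpha> w = \<alpha> t" "a < t" "t < b" using w by auto
  have "w = t" using s(1) t w a b u unfolding segment_def
    by (elim conjE isometric_inj[of "{0..r}" \<alpha> w t]) auto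
  then show False using t w by simp
qed

lemma connected_eventually_at_top:
  assumes C: "connectedin X C" and e: "end_chart \<Gamma> p \<rho>" and p: "p \<in> ends"
  shows "(\<forall>\<^sub>F t in at_top. \<rho> t \<in> C) \<or> (\<forall>\<^sub>F t in at_top. \<rho> t \<notin> C)"
proof (rule ccontr)
  assume "\<not> ?thesis"
  then have ex: "\<exists>t>e. \<rho> t \<in> C" "\<exists>t>e. \<rho> t \<notin> C" for e
    unfolding eventually_at_top_dense by blast+
  obtain a where a: "0 < a" "\<rho> a \<notin> C" using ex(2)[of 0] by blast
  obtain u where u: "a < u" "\<rho> u \<in> C" using ex(1)[of a] by blast
  obtain b where b: "u < b" "\<rho> b \<notin> C" using ex(2)[of u] by blast
  obtain w where w: "b < w" "\<rho> w \<in> C" using ex(1)[of b] by blast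
  have "segment a b \<rho>" using end_segment[OF e p] a by auto
  then have "C \<subseteq> \<rho> ` {a<..<b}" using connected_in_segment[OF C] a b u by blast
  then obtain t where t: "\<rho> w = \<rho> t" "a < t" "t < b" using w by auto
  have "w = t" using isometric_inj[OF end_chart_isometric[OF e], of w t] t w a b u by auto
  then show False using t w by simp
qed

text \<open>\<open>P\<close> and \<open>Q\<close> are the distances to the subgraph from the two
  endpoints of a segment of length \<open>r\<close>. The hypothesis says that the rising branch
  gives the minimum at \<open>t = 0\<close>; in case of equality the falling branch takes over at
  once and the slope is \<open>-1\<close>, unless \<open>l\<close> truncates both.\<close>

lemma min_tent_slope:
  fixes P Q l r :: real
  assumes "P \<le> r + Q" "0 < r"
  shows "\<exists>m::int. \<forall>\<^sub>F t in at_right 0. min l (min (t + P) (r - t + Q)) = min l P + real_of_int m * t"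
proof -
  have ev: "\<forall>\<^sub>F t in at_right (0::real). 0 < t \<and> t < c" if "0 < c" for c
    using that by (auto simp: eventually_at_right_field)
  consider "l < P" | "l = P" "P < r + Q" | "l \<ge> P" "P = r + Q" | "P < l" "P < r + Q"
    using assms by linarith
  then show ?thesis
  proof cases
    case 1
    have "\<forall>\<^sub>F t in at_right 0. min l (min (t + P) (r - t + Q)) = min l P + real_of_int 0 * t"
      by (rule eventually_mono[OF ev[of "P - l"]]) (use 1 assms in auto)
    then show ?thesis by blast
  next
    case 2
    have "\<forall>\<^sub>F t in at_right 0. min l (min (t + P) (r - t + Q)) = min l P + real_of_int 0 * t"
      by (rule eventually_mono[OF ev[of "r + Q - P"]]) (use 2 assms in auto)
    then show ?thesis by blast
  next
    case 3
    have "\<forall>\<^sub>F t in at_right 0. min l (min (t + P) (r - t + Q)) = min l P + real_of_int (- 1) * t"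
      by (rule eventually_mono[OF ev[of 1]]) (use 3 assms in auto)
    then show ?thesis by blast
  next
    case 4
    have "\<forall>\<^sub>F t in at_right 0. min l (min (t + P) (r - t + Q)) = min l P + real_of_int 1 * t"
      by (rule eventually_mono[OF ev[of "min (l - P) ((r + Q - P) / 2)"]]) (use 4 assms in auto)
    then show ?thesis by blast
  qed
qed

text \<open>If an arm starts inside \<open>A\<close>, closedness puts its centre into
  \<open>A\<close> and the distance vanishes. If it starts outside, a short initial segment avoids
  \<open>A\<close> and the distance along it is a tent.\<close>

lemma PL_dist_set:
  assumes A: "subgraph \<Gamma> A" and ne: "A \<inter> F \<noteq> {}"
  shows "PL (\<lambda>x. min l (dist_set A x))"
proof -
  have cl: "closedin X A" using A compactin_imp_closedin[OF Hausdorff_X] unfolding subgraph_def by blast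
  have "\<exists>m::int. has_slope (\<lambda>x. min l (dist_set A x)) (arm x k) m" if x: "x \<in> F" and k: "k < valence x" for x k
  proof -
    let ?\<alpha> = "arm x k"
    obtain r where r: "0 < r" "good_chart x (valence x) r (arm x)" using arm_good[OF x] by blast
    have seg: "segment 0 r ?\<alpha>" using r(2) k unfolding good_chart_def by blast
    have \<alpha>0: "?\<alpha> 0 = x" using arm_0[OF x k] .
    note ad = good_chart_arm_d[OF r(2) k]
    consider "\<forall>\<^sub>F t in at_right 0. ?\<alpha> t \<in> A" | "\<forall>\<^sub>F t in at_right 0. ?\<alpha> t \<notin> A"
      using subgraph_eventually[OF A, of ?\<alpha> "at_right 0"] connected_eventually_at_right[OF _ seg r(1)] by blast
    then show ?thesis
    proof cases
      case 1
      then obtain e where e: "0 < e" "\<And>t. 0 < t \<Longrightarrow> t < e \<Longrightarrow> ?\<alpha> t \<in> A"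
        unfolding eventually_at_right_field by blast
      have "x \<in> A"
      proof (rule ccontr)
        assume "x \<notin> A"
        then have "openin X (topspace X - A)" "x \<in> topspace X - A"
          using cl x topspace_X by (auto simp: closedin_def)
        then obtain q where q: "q > 0" "mball x q \<subseteq> topspace X - A"
          using open_contains_mball x by blast
        define t where "t = min q (min e r) / 2"
        have t: "0 < t" "t < q" "t < e" "t \<le> r" using q(1) e(1) r(1) by (auto simp: t_def min_def)
        then have "?\<alpha> t \<in> mball x q" using ad[of t] x by auto
        then show False using q(2) e(2)[OF t(1,3)] by blast
      qed
      then have "dist_set A (?\<alpha> 0) = 0" using dist_set_eq_0 x \<alpha>0 by simp
      moreover have "\<forall>\<^sub>F t in at_right 0. dist_set A (?\<alpha> t) = 0"
        unfolding eventually_at_right_field using e r(1) ad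
        by (intro exI[of _ "min e r"]) (auto intro!: dist_set_eq_0)
      ultimately have "has_slope (\<lambda>x. min l (dist_set A x)) ?\<alpha> (real_of_int 0)"
        unfolding has_slope_def by (auto elim: eventually_mono)
      then show ?thesis by blast
    next
      case 2
      then obtain e where e: "0 < e" "\<And>t. 0 < t \<Longrightarrow> t < e \<Longrightarrow> ?\<alpha> t \<notin> A"
        unfolding eventually_at_right_field by blast
      define q where "q = min e r"
      have q: "0 < q" "q \<le> r" using e(1) r(1) by (auto simp: q_def)
      have sq: "segment 0 q ?\<alpha>" using segment_subset[OF seg] q by auto
      have disj: "A \<inter> ?\<alpha> ` {0<..<q} = {}" using e(2) by (auto simp: q_def)
      have eq: "dist_set A (?\<alpha> t) = min (t + dist_set A x) (q - t + dist_set A (?\<alpha> q))"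
        if "0 \<le> t" "t \<le> q" for t
        using dist_set_segment[OF ne sq that disj] \<alpha>0 by simp
      have "dist_set A x \<le> q + dist_set A (?\<alpha> q)" using eq[of 0] q \<alpha>0 by auto
      then obtain m :: int where m: "\<forall>\<^sub>F t in at_right 0.
          min l (min (t + dist_set A x) (q - t + dist_set A (?\<alpha> q))) = min l (dist_set A x) + real_of_int m * t"
        using min_tent_slope[OF _ q(1)] by blast
      have "\<forall>\<^sub>F t in at_right 0. 0 \<le> t \<and> t \<le> q" using q(1) by (auto simp: eventually_at_right_field)
      with m have "\<forall>\<^sub>F t in at_right 0. min l (dist_set A (?\<alpha> t)) = min l (dist_set A (?\<alpha> 0)) + real_of_int m * t"
      proof eventually_elim
        case (elim t)
        then show ?case using eq[of t] \<alpha>0 by (simp only:)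
      qed
      then show ?thesis unfolding has_slope_def by blast
    qed
  qed
  moreover have "locally_const_at_ends (\<lambda>x. min l (dist_set A x))"
  proof (rule locally_constI)
    fix p assume p: "p \<in> ends"
    obtain \<rho> where \<rho>: "end_chart \<Gamma> p \<rho>" using end_chart_ex[OF p] by blast
    have F: "\<rho> t \<in> F" if "0 \<le> t" for t using \<rho> that unfolding end_chart_def by blast
    consider "\<forall>\<^sub>F t in at_top. \<rho> t \<in> A" | "\<forall>\<^sub>F t in at_top. \<rho> t \<notin> A"
      using subgraph_eventually[OF A, of \<rho> at_top] connected_eventually_at_top[OF _ \<rho> p] by blast
    then show "\<exists>\<rho> T c. 0 \<le> T \<and> end_chart \<Gamma> p \<rho> \<and> (\<forall>t>T. min l (dist_set A (\<rho> t)) = c)"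
    proof cases
      case 1
      then obtain T where T: "\<And>t. t \<ge> T \<Longrightarrow> \<rho> t \<in> A" unfolding eventually_at_top_linorder by blast
      have "min l (dist_set A (\<rho> t)) = min l 0" if "t > max T 0" for t
        using dist_set_eq_0[OF T[of t] F[of t]] that by simp
      then show ?thesis using \<rho> by (metis max.cobounded2)
    next
      case 2
      then obtain T0 where T0: "\<And>t. t \<ge> T0 \<Longrightarrow> \<rho> t \<notin> A" unfolding eventually_at_top_linorder by blast
      define T where "T = max T0 0"
      have T: "0 \<le> T" "\<And>t. t \<ge> T \<Longrightarrow> \<rho> t \<notin> A" using T0 by (auto simp: T_def)
      have "min l (dist_set A (\<rho> t)) = l" if t: "t > T + \<bar>l\<bar>" for t
      proof -
        \<comment> \<open>The point \<open>\<rho> t\<close> is the midpoint of a segment that avoids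
          \<open>A\<close>, so every path to \<open>A\<close> has length at least
          \<open>t - T\<close>, which exceeds \<open>l\<close>.\<close>
        have "A \<inter> \<rho> ` {T<..<2 * t - T} = {}" using T(2) by auto
        from dist_set_segment[OF ne end_segment[OF \<rho> p T(1)] _ _ this, of t]
        have "dist_set A (\<rho> t) = min (t - T + dist_set A (\<rho> T)) (2 * t - T - t + dist_set A (\<rho> (2 * t - T)))"
          using t by auto
        then have "dist_set A (\<rho> t) \<ge> t - T"
          using dist_set_nonneg[OF ne, of "\<rho> T"] dist_set_nonneg[OF ne, of "\<rho> (2 * t - T)"] by (auto simp: min_def)
        then show ?thesis using t by auto
      qed
      then show ?thesis using \<rho> T(1)
        by (intro exI[of _ \<rho>] exI[of _ "T + \<bar>l\<bar>"] exI[of _ l]) auto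
    qed
  qed
  ultimately show ?thesis unfolding PL_def by blast
qed

lemma CF_PL:
  assumes A: "subgraph \<Gamma> A"
  obtains u where "PL u" "\<And>x. x \<in> F \<Longrightarrow> real_of_ereal (CF \<Gamma> A l x) = u x"
proof -
  have sub: "A \<subseteq> topspace X" using A unfolding subgraph_def by (simp add: compactin_subset_topspace)
  show ?thesis
  proof (cases "A \<inter> F = {}")
    case True
    then show ?thesis using that[OF PL_const[of "- l"]] CF_finite[OF _ sub] by simp
  next
    case False
    show ?thesis using that[OF PL_minus[OF PL_dist_set[OF A False, of l]]] CF_finite[OF _ sub] False
      by (simp flip: ereal_min)
  qed
qed

subsection \<open>Recognizing chip firing moves\<close>

text \<open>An end near which \<open>u\<close> vanishes has to be included to make the set closed;
  the value of \<open>u\<close> at the end itself carries no information.\<close>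

definition zero_set :: "('a \<Rightarrow> real) \<Rightarrow> 'a set"
  where "zero_set u = {x \<in> F. u x = 0} \<union> {p \<in> ends. \<exists>U. openin X U \<and> p \<in> U \<and> (\<forall>y\<in>U \<inter> F. u y = 0)}"

lemma zero_set_F: "x \<in> F \<Longrightarrow> x \<in> zero_set u \<longleftrightarrow> u x = 0"
  using F_inf_disjoint unfolding zero_set_def by blast

lemma closedin_zero_set:
  assumes u: "PL u" shows "closedin X (zero_set u)"
proof -
  have "\<exists>U. openin X U \<and> x \<in> U \<and> U \<subseteq> topspace X - zero_set u" if x: "x \<in> topspace X - zero_set u" for x
  proof (cases "x \<in> F")
    case True
    then have "0 < \<bar>u x\<bar>" using x zero_set_F by auto
    then obtain e where e: "e > 0" "\<forall>w\<in>F. d x w < e \<longrightarrow> \<bar>u w - u x\<bar> < \<bar>u x\<bar>"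
      using PL_continuous[OF u True] by blast
    have "mball x e \<subseteq> topspace X - zero_set u"
    proof
      fix y assume "y \<in> mball x e"
      then have "y \<in> F" "u y \<noteq> 0" using e(2) by force+
      then show "y \<in> topspace X - zero_set u" using zero_set_F topspace_X by blast
    qed
    then show ?thesis using openin_mball_X e(1) True by (intro exI[of _ "mball x e"]) auto
  next
    case False
    then have p: "x \<in> ends" using x topspace_X by blast
    obtain U c where U: "openin X U" "x \<in> U" "\<forall>y\<in>U \<inter> F. u y = c"
      using u p unfolding PL_def locally_const_at_ends_def by blast
    have c: "c \<noteq> 0" using x U p unfolding zero_set_def by blast
    have "closedin X (ends - {x})"
      using closedin_Hausdorff_finite[OF Hausdorff_X] finite_inf topspace_X by auto
    then have "openin X (U - (ends - {x}))" using U by blast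
    moreover have "U - (ends - {x}) \<subseteq> topspace X - zero_set u"
    proof
      fix y assume y: "y \<in> U - (ends - {x})"
      have "y \<in> topspace X" using y U(1) openin_subset by blast
      moreover from this have "y = x \<or> y \<in> F" using y topspace_X by blast
      ultimately show "y \<in> topspace X - zero_set u" using x y U(3) c zero_set_F by auto
    qed
    ultimately show ?thesis using U(2) by (intro exI[of _ "U - (ends - {x})"]) auto
  qed
  then have "openin X (topspace X - zero_set u)" by (subst openin_subopen) blast
  moreover have "zero_set u \<subseteq> topspace X" using topspace_X unfolding zero_set_def by blast
  ultimately show ?thesis by (simp add: closedin_def)
qed

text \<open>Near a finite zero the zero set is the star formed by the arms of slope 0. Near an end
  it is a ray together with its limit point.\<close>

lemma zero_set_locally_connected:
  assumes u: "PL u" and x: "x \<in> zero_set u"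
  shows "\<exists>U T. openin X U \<and> x \<in> U \<and> connectedin X T \<and> x \<in> T \<and> T \<subseteq> zero_set u \<and> U \<inter> zero_set u \<subseteq> T"
proof (cases "x \<in> F")
  case True
  then have ux: "u x = 0" using x zero_set_F by blast
  obtain m r where r: "0 < r" "good_chart x (valence x) r (arm x)"
    "\<And>k t. k < valence x \<Longrightarrow> 0 \<le> t \<Longrightarrow> t \<le> r \<Longrightarrow> u (arm x k t) = u x + real_of_int (m k) * t"
    by (rule PL_good_chart[OF u True]) (rule that; blast intro: order_refl)
  let ?K = "{k. k < valence x \<and> m k = 0}"
  let ?T = "\<Union>(insert {x} ((\<lambda>k. arm x k ` {0..r}) ` ?K))"
  have xarm: "x \<in> arm x k ` {0..r}" if "k < valence x" for k
    using arm_0[OF True that] r(1) by (intro image_eqI[of _ _ 0]) auto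
  have "connectedin X ?T"
  proof (rule connectedin_Union)
    fix S assume "S \<in> insert {x} ((\<lambda>k. arm x k ` {0..r}) ` ?K)"
    then consider "S = {x}" | k where "k < valence x" "S = arm x k ` {0..r}" by blast
    then show "connectedin X S"
    proof cases
      case 1 then show ?thesis using True topspace_X by simp
    next
      case 2
      then have "isometric_on {0..r} (arm x k)" using r(2) unfolding good_chart_def segment_def by blast
      from isometric_connected[OF this, of "{0..r}"] show ?thesis using 2 by auto
    qed
  next
    have "x \<in> \<Inter>(insert {x} ((\<lambda>k. arm x k ` {0..r}) ` ?K))" using xarm by blast
    then show "\<Inter>(insert {x} ((\<lambda>k. arm x k ` {0..r}) ` ?K)) \<noteq> {}" by blast
  qed
  moreover have "?T \<subseteq> zero_set u"
  proof
    fix y assume "y \<in> ?T"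
    then consider "y = x" | k t where "k < valence x" "m k = 0" "0 \<le> t" "t \<le> r" "y = arm x k t" by auto
    then show "y \<in> zero_set u"
    proof cases
      case 1 then show ?thesis using x by blast
    next
      case 2
      then have "y \<in> F" "u y = 0" using good_chart_arm_d(1)[OF r(2), of k t] r(3)[of k t] ux by auto
      then show ?thesis using zero_set_F by blast
    qed
  qed
  moreover have "mball x r \<inter> zero_set u \<subseteq> ?T"
  proof
    fix y assume "y \<in> mball x r \<inter> zero_set u"
    then have y: "y \<in> F" "d x y < r" "u y = 0" using zero_set_F by auto
    show "y \<in> ?T"
    proof (cases "y = x")
      case False
      then obtain k where k: "k < valence x" "y = arm x k (d x y)"
        using y r(2) unfolding good_chart_def by blast
      have "real_of_int (m k) * d x y = 0" using r(3)[OF k(1), of "d x y"] k(2) y ux by simp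
      then have "m k = 0" using False y True by simp
      moreover have "y \<in> arm x k ` {0..r}" using k(2) y by (intro image_eqI[of _ _ "d x y"]) auto
      ultimately show ?thesis using k(1) by blast
    qed simp
  qed
  moreover have "x \<in> ?T" "x \<in> mball x r" using True r(1) by auto
  ultimately show ?thesis using openin_mball_X[of x r]
    by (intro exI[of _ "mball x r"] exI[of _ ?T] conjI)
next
  case False
  then have p: "x \<in> ends" and "\<exists>U. openin X U \<and> x \<in> U \<and> (\<forall>y\<in>U \<inter> F. u y = 0)"
    using x unfolding zero_set_def by blast+
  then obtain U where U: "openin X U" "x \<in> U" "\<forall>y\<in>U \<inter> F. u y = 0" by blast
  obtain \<rho> where \<rho>: "end_chart \<Gamma> x \<rho>" using end_chart_ex[OF p] by blast
  obtain T where T: "0 \<le> T" "\<And>t. T \<le> t \<Longrightarrow> \<rho> t \<in> U" using end_eventually[OF \<rho> U(1,2)] by blast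
  let ?T = "insert x (\<rho> ` {T<..})"
  have "\<rho> t \<in> zero_set u" if "t > T" for t
  proof -
    have "\<rho> t \<in> F" using \<rho> that T(1) unfolding end_chart_def by auto
    then show ?thesis using U(3) T(2)[of t] that zero_set_F by auto
  qed
  then have "?T \<subseteq> zero_set u" using x by blast
  moreover have "connectedin X ?T"
  proof (rule connectedin_intermediate_closure_of)
    have "{T<..} \<subseteq> {0..}" using T(1) by auto
    from isometric_connected[OF end_chart_isometric[OF \<rho>] this]
    show "connectedin X (\<rho> ` {T<..})" by simp
    have "x \<in> X closure_of (\<rho> ` {T<..})"
      unfolding in_closure_of
    proof (intro conjI allI impI)
      fix V assume V: "x \<in> V \<and> openin X V"
      then obtain T' where T': "\<And>t. T' \<le> t \<Longrightarrow> \<rho> t \<in> V" using end_eventually[OF \<rho>] by blast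
      have "\<rho> (max T' (T + 1)) \<in> V" using T'[of "max T' (T + 1)"] by simp
      moreover have "\<rho> (max T' (T + 1)) \<in> \<rho> ` {T<..}" by (intro imageI) auto
      ultimately show "\<exists>y. y \<in> \<rho> ` {T<..} \<and> y \<in> V" by blast
    qed (use p topspace_X in blast)
    moreover have "\<rho> ` {T<..} \<subseteq> topspace X" 
      using end_chart_isometric[OF \<rho>] T(1) topspace_X unfolding isometric_on_def by auto
    then have "\<rho> ` {T<..} \<subseteq> X closure_of (\<rho> ` {T<..})" by (rule closure_of_subset)
    ultimately show "?T \<subseteq> X closure_of (\<rho> ` {T<..})" by blast
  qed auto
  ultimately show ?thesis using end_nbhd_open[OF \<rho> p T(1)]
    by (intro exI[of _ ?T]) auto
qed

text \<open>Finitely many of the neighbourhoods from \<open>zero_set_locally_connected\<close> cover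
  the compact zero set, and its part in each lies in one connected piece. So every component is the
  component of one of finitely many centres.\<close>

lemma subgraph_zero_set:
  assumes u: "PL u" shows "subgraph \<Gamma> (zero_set u)"
proof -
  let ?A = "zero_set u"
  have comp: "compactin X ?A" using closedin_zero_set[OF u] compact_X closedin_compact_space by blast
  have "\<forall>x\<in>?A. \<exists>UT. openin X (fst UT) \<and> x \<in> fst UT \<and> connectedin X (snd UT) \<and> x \<in> snd UT \<and>
      snd UT \<subseteq> ?A \<and> fst UT \<inter> ?A \<subseteq> snd UT"
    using zero_set_locally_connected[OF u] by simp
  from bchoice[OF this] obtain UT where UT: "\<forall>x\<in>?A. openin X (fst (UT x)) \<and> x \<in> fst (UT x) \<and>
      connectedin X (snd (UT x)) \<and> x \<in> snd (UT x) \<and> snd (UT x) \<subseteq> ?A \<and> fst (UT x) \<inter> ?A \<subseteq> snd (UT x)" ..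
  have "?A \<subseteq> \<Union>((\<lambda>x. fst (UT x)) ` ?A)" using UT by blast
  moreover have "\<And>U. U \<in> (\<lambda>x. fst (UT x)) ` ?A \<Longrightarrow> openin X U" using UT by blast
  ultimately obtain \<F> where \<F>: "finite \<F>" "\<F> \<subseteq> (\<lambda>x. fst (UT x)) ` ?A" "?A \<subseteq> \<Union>\<F>"
    using comp unfolding compactin_def by meson
  obtain S where S: "S \<subseteq> ?A" "finite S" "\<F> = (\<lambda>x. fst (UT x)) ` S"
    using finite_subset_image[OF \<F>(1,2)] by blast
  let ?Y = "subtopology X ?A"
  have tY: "topspace ?Y = ?A" using comp compactin_subset_topspace topspace_subtopology_subset by metis
  have "connected_components_of ?Y \<subseteq> connected_component_of_set ?Y ` S"
  proof
    fix K assume "K \<in> connected_components_of ?Y"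
    then obtain y where y: "y \<in> ?A" "K = connected_component_of_set ?Y y"
      using tY unfolding connected_components_of_def by auto
    obtain x where x: "x \<in> S" "y \<in> fst (UT x)" using \<F>(3) S(3) y(1) by blast
    then have xA: "x \<in> ?A" using S(1) by blast
    then have "y \<in> snd (UT x)" using UT x(2) y(1) by blast
    moreover have "connectedin ?Y (snd (UT x))" "x \<in> snd (UT x)"
      using UT xA by (auto simp: connectedin_subtopology)
    ultimately have "connected_component_of ?Y x y" unfolding connected_component_of_def by blast
    then have "connected_component_of_set ?Y x = connected_component_of_set ?Y y"
      by (metis connected_component_of_equiv)
    then show "K \<in> connected_component_of_set ?Y ` S" using x(1) y(2) by blast
  qed
  then have "finite (connected_components_of ?Y)" using S(2) finite_subset by blast
  then show ?thesis using comp unfolding subgraph_def by blast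
qed

lemma PL_nonexpanding:
  assumes u: "PL u"
    and sl: "\<And>x k m. x \<in> F \<Longrightarrow> k < valence x \<Longrightarrow> has_slope u (arm x k) m \<Longrightarrow> \<bar>m\<bar> \<le> 1"
    and xy: "x \<in> F" "y \<in> F"
  shows "\<bar>u y - u x\<bar> \<le> d x y"
proof -
  obtain \<gamma> where \<gamma>: "\<gamma> 0 = x" "\<gamma> (d x y) = y" "isometric_on {0..d x y} \<gamma>"
    using geodesic_ex[OF xy] unfolding isometric_on_def by blast
  have "\<bar>u (\<gamma> (d x y)) - u (\<gamma> 0)\<bar> \<le> d x y - 0"
  proof (rule pointwise_nonexpanding_imp_nonexpanding)
    fix s assume s: "0 \<le> s" "s \<le> d x y"
    have Fs: "\<gamma> s \<in> F" using \<gamma>(3) s unfolding isometric_on_def by auto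
    obtain e where e: "e > 0" "\<forall>w\<in>F. d (\<gamma> s) w < e \<longrightarrow> \<bar>u w - u (\<gamma> s)\<bar> \<le> 1 * d (\<gamma> s) w"
      using PL_local_lipschitz[OF u Fs, of 1] sl[OF Fs] by blast
    have "\<bar>u (\<gamma> t) - u (\<gamma> s)\<bar> \<le> \<bar>t - s\<bar>" if t: "t \<in> {0..d x y}" "\<bar>t - s\<bar> < e" for t
    proof -
      have "\<gamma> t \<in> F" "d (\<gamma> s) (\<gamma> t) = \<bar>t - s\<bar>"
        using \<gamma>(3) s t unfolding isometric_on_def by auto
      then show ?thesis using e(2) t(2) by auto
    qed
    then show "\<exists>e>0. \<forall>t\<in>{0..d x y}. \<bar>t - s\<bar> < e \<longrightarrow> \<bar>u (\<gamma> t) - u (\<gamma> s)\<bar> \<le> \<bar>t - s\<bar>"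
      using e(1) by blast
  qed simp
  then show ?thesis using \<gamma> by simp
qed

lemma PL_continuous_map:
  assumes u: "PL u" shows "continuous_map (subtopology X F) euclideanreal u"
proof -
  have "\<exists>T. openin (subtopology X F) T \<and> x \<in> T \<and> (\<forall>y\<in>T. u y \<in> V)"
    if x: "x \<in> F" and V: "open V" "u x \<in> V" for x V
  proof -
    obtain \<epsilon> where eps: "\<epsilon> > 0" "\<And>v. \<bar>v - u x\<bar> < \<epsilon> \<Longrightarrow> v \<in> V"
      using V unfolding open_dist dist_real_def by blast
    obtain e where e: "e > 0" "\<forall>w\<in>F. d x w < e \<longrightarrow> \<bar>u w - u x\<bar> < \<epsilon>"
      using PL_continuous[OF u x eps(1)] by blast
    have "openin (subtopology X F) (mball x e)" using openin_mball[of x e] unfolding mtop .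
    then show ?thesis using e eps(2) x by (intro exI[of _ "mball x e"]) auto
  qed
  then show ?thesis unfolding continuous_map_eq_topcontinuous_at topcontinuous_at_def
    using openin_F by (auto simp: openin_subset Int_absorb1)
qed

text \<open>Following descending arms step by step might stall, since the steps may shrink. Instead
  \<open>u\<close> is minimised over the compact set \<open>K\<close> of points whose distance from
  \<open>x\<close> is at most the decrease of \<open>u\<close>. A descending arm does not leave
  \<open>K\<close> at first: the distance grows by at most \<open>t\<close> while \<open>u\<close>
  drops by \<open>t\<close>. Hence a positive minimum is impossible.\<close>

lemma descent_to_zero:
  assumes u: "PL u" and nn: "\<And>y. y \<in> F \<Longrightarrow> 0 \<le> u y"
    and desc: "\<And>y. y \<in> F \<Longrightarrow> 0 < u y \<Longrightarrow> u y < l \<Longrightarrow> \<exists>k<valence y. has_slope u (arm y k) (- 1)"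
    and x: "x \<in> F" "u x < l"
  shows "\<exists>a\<in>F. u a = 0 \<and> d x a \<le> u x"
proof -
  define K where "K = {y \<in> F. u y + d x y \<le> u x}"
  have "closedin X K"
  proof -
    have "\<exists>U. openin X U \<and> y \<in> U \<and> U \<subseteq> topspace X - K" if y: "y \<in> topspace X - K" for y
    proof (cases "y \<in> F")
      case True
      define \<epsilon> where "\<epsilon> = (u y + d x y - u x) / 2"
      have eps: "\<epsilon> > 0" using y True by (auto simp: K_def \<epsilon>_def)
      obtain e where e: "e > 0" "\<forall>w\<in>F. d y w < e \<longrightarrow> \<bar>u w - u y\<bar> < \<epsilon>"
        using PL_continuous[OF u True eps] by blast
      have "mball y (min e \<epsilon>) \<subseteq> topspace X - K"
      proof
        fix w assume "w \<in> mball y (min e \<epsilon>)"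
        then have w: "w \<in> F" "d y w < e" "d y w < \<epsilon>" by auto
        have "d x y \<le> d x w + d y w" using triangle[of x w y] x True w by (simp add: commute)
        moreover have "\<bar>u w - u y\<bar> < \<epsilon>" using e w by blast
        moreover have "2 * \<epsilon> = u y + d x y - u x" by (simp add: \<epsilon>_def)
        ultimately have "u w + d x w > u x" using w(3) by linarith
        then show "w \<in> topspace X - K" using w(1) topspace_X by (auto simp: K_def)
      qed
      then show ?thesis using openin_mball_X e(1) eps True
        by (intro exI[of _ "mball y (min e \<epsilon>)"]) auto
    next
      case False
      then have p: "y \<in> ends" using y topspace_X by blast
      obtain \<rho> where \<rho>: "end_chart \<Gamma> y \<rho>" using end_chart_ex[OF p] by blast
      have F: "\<rho> t \<in> F" if "0 \<le> t" for t using \<rho> that unfolding end_chart_def by blast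
      \<comment> \<open>Beyond this parameter the distance from \<open>x\<close> exceeds
        \<open>u x\<close>, so \<open>K\<close> keeps away from the end.\<close>
      define T where "T = u x + d x (\<rho> 0)"
      have T: "0 \<le> T" using nn[OF x(1)] by (simp add: T_def)
      have "\<rho> t \<notin> K" if t: "t > T" for t
      proof -
        have "t \<le> d x (\<rho> 0) + d x (\<rho> t)"
          using \<rho> triangle[of "\<rho> 0" x "\<rho> t"] F[of 0] F[of t] x(1) t T
          unfolding end_chart_def by (simp add: commute)
        then have "d x (\<rho> t) > u x" using t by (simp add: T_def)
        then show ?thesis using nn[OF F[of t]] t T by (auto simp: K_def)
      qed
      then have "insert y (\<rho> ` {T<..}) \<inter> K = {}" using False by (auto simp: K_def)
      moreover have op: "openin X (insert y (\<rho> ` {T<..}))" using end_nbhd_open[OF \<rho> p T] .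
      ultimately show ?thesis using openin_subset[OF op]
        by (intro exI[of _ "insert y (\<rho> ` {T<..})"]) blast
    qed
    then have "openin X (topspace X - K)" by (subst openin_subopen) blast
    moreover have "K \<subseteq> topspace X" using topspace_X by (auto simp: K_def)
    ultimately show ?thesis by (simp add: closedin_def)
  qed
  then have "compactin X K" using compact_X closedin_compact_space by blast
  then have "compactin (subtopology X F) K" by (auto simp: compactin_subtopology K_def)
  then have "compact (u ` K)" using image_compactin[OF _ PL_continuous_map[OF u]] by simp
  moreover have "x \<in> K" using x(1) by (simp add: K_def)
  ultimately obtain v where "v \<in> u ` K" "\<forall>w\<in>u ` K. v \<le> w"
    using compact_attains_inf[of "u ` K"] by blast
  then obtain y where y: "y \<in> K" "\<And>w. w \<in> K \<Longrightarrow> u y \<le> u w" by blast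
  have yF: "y \<in> F" and yK: "u y + d x y \<le> u x" using y(1) by (auto simp: K_def)
  have "u y = 0"
  proof (rule ccontr)
    assume "u y \<noteq> 0"
    then have pos: "0 < u y" using nn[OF yF] by simp
    moreover have "u y < l" using yK x(2) nonneg[of x y] by linarith
    ultimately obtain k where k: "k < valence y" "has_slope u (arm y k) (- 1)" using desc[OF yF] by blast
    obtain r where r: "0 < r" "good_chart y (valence y) r (arm y)" using arm_good[OF yF] by blast
    obtain e where e: "0 < e" "\<forall>t\<in>{0..<e}. u (arm y k t) = u (arm y k 0) + - 1 * t"
      using k(2) unfolding has_slope_iff by blast
    define t where "t = min e r / 2"
    have t: "0 < t" "t < e" "t \<le> r" using e(1) r(1) by (auto simp: t_def min_def)
    have w: "arm y k t \<in> F" "d y (arm y k t) = t" using good_chart_arm_d[OF r(2) k(1), of t] t by auto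
    have uw: "u (arm y k t) = u y - t" using e(2) t arm_0[OF yF k(1)] by auto
    have "d x (arm y k t) \<le> d x y + t" using triangle[OF x(1) yF w(1)] w(2) by simp
    then have "arm y k t \<in> K" using w(1) uw yK by (auto simp: K_def)
    then show False using y(2) uw t(1) by force
  qed
  then show ?thesis using yF yK by auto
qed

text \<open>Slopes of absolute value at most 1 make \<open>u\<close> nonexpanding, hence at most the
  distance to its zero set; descent gives the opposite inequality where \<open>u x < l\<close>. If
  there is no finite zero, descent is impossible and \<open>u\<close> is constantly
  \<open>l\<close>.\<close>

lemma PL_eq_CF:
  assumes u: "PL u" and bd: "\<And>y. y \<in> F \<Longrightarrow> 0 \<le> u y" "\<And>y. y \<in> F \<Longrightarrow> u y \<le> l"
    and sl: "\<And>x k m. x \<in> F \<Longrightarrow> k < valence x \<Longrightarrow> has_slope u (arm x k) m \<Longrightarrow> \<bar>m\<bar> \<le> 1"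
    and desc: "\<And>y. y \<in> F \<Longrightarrow> 0 < u y \<Longrightarrow> u y < l \<Longrightarrow> \<exists>k<valence y. has_slope u (arm y k) (- 1)"
    and x: "x \<in> F"
  shows "real_of_ereal (CF \<Gamma> (zero_set u) l x) = - u x"
proof -
  let ?A = "zero_set u"
  have sub: "?A \<subseteq> topspace X" using topspace_X unfolding zero_set_def by blast
  have descent: "\<exists>a\<in>F. a \<in> ?A \<and> d x a \<le> u x" if "u x < l"
    using descent_to_zero[OF u bd(1) desc x that] zero_set_F by blast
  have "u x = (if ?A \<inter> F = {} then l else min l (dist_set ?A x))"
  proof (cases "?A \<inter> F = {}")
    case True
    then show ?thesis using descent bd(2)[OF x] by force
  next
    case False
    have "u x \<le> dist_set ?A x"
    proof (rule dist_set_greatest[OF False])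
      fix a assume a: "a \<in> ?A" "a \<in> F"
      then have "u a = 0" using zero_set_F by blast
      moreover have "\<bar>u a - u x\<bar> \<le> d x a" by (rule PL_nonexpanding[OF u sl x a(2)])
      ultimately show "u x \<le> d x a" by auto
    qed
    moreover have "dist_set ?A x \<le> u x" if "u x < l"
      using descent[OF that] dist_set_le[of _ ?A x] by force
    ultimately show ?thesis using False bd(2)[OF x] by (cases "u x < l") auto
  qed
  then show ?thesis using CF_finite[OF x sub, of l] by (simp split: if_splits flip: ereal_min)
qed

subsection \<open>Decomposition into chip firing moves\<close>

text \<open>Meaningful at nice points only, where \<open>nice_unique\<close> makes the value
  independent of the choice.\<close>

definition abs_slope :: "('a \<Rightarrow> real) \<Rightarrow> 'a \<Rightarrow> nat"
  where "abs_slope g x = nat \<bar>SOME m. nice g m x\<bar>"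

lemma abs_slope_eq: "nice g m x \<Longrightarrow> abs_slope g x = nat \<bar>m\<bar>"
  unfolding abs_slope_def using nice_unique[OF someI[of "\<lambda>m. nice g m x" m]] by simp

lemma nice_ascending_arm:
  assumes "nice g m y" shows "\<exists>k<valence y. has_slope g (arm y k) (real_of_int \<bar>m\<bar>)"
proof -
  have v: "0 < valence y" "1 < valence y" using nice_arm[OF assms] by auto
  have "has_slope g (arm y 0) (real_of_int \<bar>m\<bar>) \<or> has_slope g (arm y 1) (real_of_int \<bar>m\<bar>)"
    using nice_arm[OF assms] by (cases "0 \<le> m") auto
  then show ?thesis using v by blast
qed

lemma nice_minus: "nice g m x \<Longrightarrow> nice (\<lambda>y. - g y) (- m) x"
  unfolding nice_def using has_slope_minus by fastforce

text \<open>\<open>u\<close> is the truncated distance itself, the negative of a chip firing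
  function, so that firing \<open>u\<close> subtracts it.\<close>

definition fires :: "('a \<Rightarrow> real) \<Rightarrow> bool"
  where "fires u \<longleftrightarrow> PL u \<and> (\<exists>A l. subgraph \<Gamma> A \<and> 0 < l \<and> (\<forall>x\<in>F. real_of_ereal (CF \<Gamma> A l x) = - u x))"

definition reaches :: "('a \<Rightarrow> int) \<Rightarrow> ('a \<Rightarrow> real) \<Rightarrow> bool"
  where "reaches D g \<longleftrightarrow> PL g \<and> (\<exists>D'. (chip_firing_step \<Gamma>)\<^sup>*\<^sup>* D D' \<and> divisor \<Gamma> D' \<and>
    (\<forall>x\<in>points \<Gamma>. of_int (D' x) = of_int (D x) + Ord g x))"

lemma reaches_cong: "reaches D g \<Longrightarrow> (\<And>x. x \<in> F \<Longrightarrow> g x = h x) \<Longrightarrow> reaches D h"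
  unfolding reaches_def using PL_cong_F[of g h] Ord_cong_F[of g h] by auto

lemma reaches_const: "divisor \<Gamma> D \<Longrightarrow> reaches D (\<lambda>x. c)"
  unfolding reaches_def using PL_const Ord_const by auto

lemma reaches_add_const:
  assumes "reaches D g" shows "reaches D (\<lambda>x. g x + c)"
  using assms PL_add[OF _ PL_const, of g c] Ord_add[OF _ PL_const, of g _ c] Ord_const
  unfolding reaches_def by auto

lemma reaches_fire:
  assumes r: "reaches D g" and u: "fires u"
  shows "reaches D (\<lambda>x. g x - u x)"
proof -
  obtain D' where g: "PL g" and D': "(chip_firing_step \<Gamma>)\<^sup>*\<^sup>* D D'" "divisor \<Gamma> D'"
    "\<forall>x\<in>points \<Gamma>. of_int (D' x) = of_int (D x) + Ord g x"
    using r unfolding reaches_def by blast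
  obtain A l where "PL u" and A: "subgraph \<Gamma> A" "0 < l" "\<forall>x\<in>F. real_of_ereal (CF \<Gamma> A l x) = - u x"
    using u unfolding fires_def by blast
  note mu = PL_minus[OF \<open>PL u\<close>]
  \<comment> \<open>The floor is exact because orders are integers, and a divisor has to vanish off
    the curve.\<close>
  define E where "E x = (if x \<in> points \<Gamma> then D' x + \<lfloor>Ord (\<lambda>x. - u x) x\<rfloor> else 0)" for x
  have E: "of_int (E x) = of_int (D' x) + Ord (\<lambda>x. - u x) x" if "x \<in> points \<Gamma>" for x
    using Ord_Ints[OF mu that] that by (simp add: E_def)
  have "{x. E x \<noteq> 0} \<subseteq> {x. D' x \<noteq> 0} \<union> {x \<in> points \<Gamma>. Ord (\<lambda>x. - u x) x \<noteq> 0}"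
    by (auto simp: E_def split: if_splits)
  then have "finite {x. E x \<noteq> 0}"
    using D'(2) Ord_support[OF mu] unfolding divisor_def by (meson finite_UnI finite_subset)
  then have dE: "divisor \<Gamma> E" unfolding divisor_def by (auto simp: E_def)
  have "of_int (E x) = of_int (D' x) + ord_at \<Gamma> (CF \<Gamma> A l) x" if "x \<in> points \<Gamma>" for x
    using ord_at_eq_Ord[OF mu _ that, of "CF \<Gamma> A l"] A(3) E[OF that] by simp
  then have "chip_firing_step \<Gamma> D' E"
    unfolding chip_firing_step_def using D'(2) dE A(1,2) by blast
  then have "(chip_firing_step \<Gamma>)\<^sup>*\<^sup>* D E" using D'(1) by simp
  moreover have "PL (\<lambda>x. g x - u x)" using PL_add[OF g mu] by simp
  moreover have "of_int (E x) = of_int (D x) + Ord (\<lambda>x. g x - u x) x" if "x \<in> points \<Gamma>" for x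
    using E[OF that] D'(3) Ord_add[OF g mu that] that by simp
  ultimately show ?thesis using dE unfolding reaches_def by blast
qed

lemma reaches_fire_sum:
  "reaches D g \<Longrightarrow> (\<And>j. j < n \<Longrightarrow> fires (u j)) \<Longrightarrow> reaches D (\<lambda>x. g x - (\<Sum>j<n. u j x))" for n :: nat
proof (induction n)
  case (Suc n)
  then show ?case using reaches_fire[of D "\<lambda>x. g x - (\<Sum>j<n. u j x)" "u n"] by (simp add: algebra_simps)
qed simp

end

text \<open>\<open>regular\<close> expresses that no critical value lies strictly between
  \<open>a\<close> and \<open>c\<close> and that \<open>N\<close> is a common multiple of the slopes
  there; \<open>a\<close> and \<open>c\<close> themselves may be critical.\<close>

locale slab = tropical +
  fixes g :: "'a \<Rightarrow> real" and a c :: real and N :: nat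
  assumes PL_g: "PL g" and ac: "a < c" and N: "0 < N"
    and regular: "\<And>x. x \<in> F \<Longrightarrow> a < g x \<Longrightarrow> g x < c \<Longrightarrow> \<exists>m. m \<noteq> 0 \<and> nat \<bar>m\<bar> dvd N \<and> nice g m x"
begin

definition "l = (c - a) / N"

lemma l_pos: "0 < l"
  using ac N by (simp add: l_def)

text \<open>
  The \<open>j\<close>-th move of the slab: on an edge of slope \<open>s\<close> the first \<open>j div s\<close> pieces of length \<open>l\<close>, counted
  from the upper end, have been crossed already, and the next piece is being crossed.
\<close>

definition layer :: "nat \<Rightarrow> 'a \<Rightarrow> real"
  where "layer j x = (if c \<le> g x then 0 else if g x \<le> a then l
    else ramp l ((c - g x) / abs_slope g x - real (j div abs_slope g x) * l))"

text \<open>On the boundary of the slab several edges may meet, so \<open>s\<close> can be any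
  divisor of \<open>N\<close> there. At \<open>g x = c\<close> the argument of the ramp is at most
  0. At \<open>g x = a\<close> it equals \<open>l * (P - j div s)\<close> with
  \<open>N = s * P\<close>, and \<open>j < N\<close> makes this at least \<open>l\<close>. So the
  constants in \<open>layer\<close> continue the formula of every adjacent edge.\<close>

lemma layer_eq:
  assumes "a \<le> g x" "g x \<le> c" and s: "0 < s" "s dvd N" and j: "j < N"
    and sx: "a < g x \<Longrightarrow> g x < c \<Longrightarrow> abs_slope g x = s"
  shows "layer j x = ramp l ((c - g x) / s - real (j div s) * l)"
proof -
  consider "g x = c" | "g x = a" | "a < g x" "g x < c" using assms by linarith
  then show ?thesis
  proof cases
    case 1
    moreover have "0 \<le> real (j div s) * l" using l_pos by simp
    ultimately show ?thesis using l_pos unfolding layer_def ramp_def by auto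
  next
    case 2
    obtain P where P: "N = s * P" using s(2) by blast
    have "c - a = l * real s * real P" unfolding l_def using N by (simp add: P)
    then have eq: "(c - g x) / s - real (j div s) * l = l * (real P - real (j div s))"
      using s(1) 2 by (simp add: field_simps)
    have "j div s < P" using j P by (simp add: less_mult_imp_div_less mult.commute)
    then have "1 \<le> real P - real (j div s)" by linarith
    then have "l * 1 \<le> l * (real P - real (j div s))" using l_pos by (intro mult_left_mono) auto
    then show ?thesis unfolding eq using 2 ac l_pos by (simp add: layer_def ramp_def)
  next
    case 3 then show ?thesis using sx by (simp add: layer_def)
  qed
qed

text \<open>Division by the slope normalises the speed: along an arm of slope \<open>\<mu>\<close>
  inside the slab the argument of the ramp changes at rate \<open>- sgn \<mu>\<close>, and
  \<open>ramp_slope\<close> applies.\<close>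

lemma layer_arm:
  assumes x: "x \<in> F" and k: "k < valence x" and j: "j < N" and \<mu>: "has_slope g (arm x k) (real_of_int \<mu>)"
  shows "\<exists>m::int. \<bar>m\<bar> \<le> (1::int) \<and> has_slope (layer j) (arm x k) (real_of_int m) \<and>
    (0 < \<mu> \<and> 0 < layer j x \<and> layer j x < l \<longrightarrow> m = (- 1::int))"
proof -
  let ?\<alpha> = "arm x k"
  have \<alpha>0: "?\<alpha> 0 = x" using arm_0[OF x k] .
  obtain e where e: "0 < e" "\<forall>t\<in>{0..<e}. g (?\<alpha> t) = g x + real_of_int \<mu> * t"
    using \<mu> \<alpha>0 unfolding has_slope_iff by auto
  obtain r1 where r1: "0 < r1" "good_chart x (valence x) r1 (arm x)" using arm_good[OF x] by blast
  define r where "r = min e r1"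
  have r: "0 < r" using e(1) r1(1) by (simp add: r_def)
  have lin: "g (?\<alpha> t) = g x + real_of_int \<mu> * t" if "0 \<le> t" "t < r" for t
    using e(2) that by (simp add: r_def)
  have seg: "segment 0 r ?\<alpha>"
    using r1(2) k segment_subset[of 0 r1 ?\<alpha> 0 r] unfolding good_chart_def by (auto simp: r_def)
  have nice: "nice g \<mu> (?\<alpha> t)" if "0 < t" "t < r" for t
    by (rule nice_of_segment[OF seg that]) (simp add: lin)
  have evr: "\<forall>\<^sub>F t in at_right 0. 0 < t \<and> t < r" using r by (auto simp: eventually_at_right_field)
  have const: "has_slope (layer j) ?\<alpha> (real_of_int 0)" if "\<forall>\<^sub>F t in at_right 0. layer j (?\<alpha> t) = layer j x"
    using that \<alpha>0 unfolding has_slope_def by simp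
  \<comment> \<open>The arm stays at or above the slab, stays at or below it, or begins with a piece
    strictly inside it, its centre possibly on the boundary.\<close>
  consider "c < g x \<or> g x = c \<and> 0 \<le> \<mu>" | "g x < a \<or> g x = a \<and> \<mu> \<le> 0"
    | "a \<le> g x" "g x \<le> c" "g x = c \<longrightarrow> \<mu> < 0" "g x = a \<longrightarrow> 0 < \<mu>" by linarith
  then show ?thesis
  proof cases
    case 1
    have "\<forall>\<^sub>F t in at_right 0. c \<le> g x + real_of_int \<mu> * t"
    proof (cases "c < g x")
      case True
      from eventually_affine_greater[OF this, of "real_of_int \<mu>"] show ?thesis by (rule eventually_mono) simp
    next
      case False
      then show ?thesis using 1 by (intro eventually_mono[OF evr]) auto
    qed
    with evr have "\<forall>\<^sub>F t in at_right 0. layer j (?\<alpha> t) = layer j x"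
      by eventually_elim (use 1 lin in \<open>auto simp: layer_def\<close>)
    from const[OF this] show ?thesis using 1 by (intro exI[of _ 0]) (auto simp: layer_def)
  next
    case 2
    have "\<forall>\<^sub>F t in at_right 0. g x + real_of_int \<mu> * t \<le> a"
    proof (cases "g x < a")
      case True
      from eventually_affine_less[OF this, of "real_of_int \<mu>"] show ?thesis by (rule eventually_mono) simp
    next
      case False
      then show ?thesis using 2 by (intro eventually_mono[OF evr]) (auto simp: mult_le_0_iff)
    qed
    with evr have "\<forall>\<^sub>F t in at_right 0. layer j (?\<alpha> t) = layer j x"
      by eventually_elim (use 2 lin ac in \<open>auto simp: layer_def\<close>)
    from const[OF this] show ?thesis using 2 ac by (intro exI[of _ 0]) (auto simp: layer_def)
  next
    case 3
    have up: "\<forall>\<^sub>F t in at_right 0. g x + real_of_int \<mu> * t < c"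
    proof (cases "g x < c")
      case True then show ?thesis by (rule eventually_affine_less)
    next
      case False
      then show ?thesis using 3 by (intro eventually_mono[OF evr]) (auto simp: mult_less_0_iff)
    qed
    have low: "\<forall>\<^sub>F t in at_right 0. a < g x + real_of_int \<mu> * t"
    proof (cases "a < g x")
      case True then show ?thesis by (rule eventually_affine_greater)
    next
      case False
      then show ?thesis using 3 by (intro eventually_mono[OF evr]) auto
    qed
    have ev: "\<forall>\<^sub>F t in at_right 0. (0 < t \<and> t < r) \<and>
        g x + real_of_int \<mu> * t < c \<and> a < g x + real_of_int \<mu> * t"
      by (rule eventually_conj[OF evr eventually_conj[OF up low]])
    \<comment> \<open>The centre may be a vertex on the boundary, where \<open>regular\<close> says
      nothing; the slope is examined at a nearby point inside the slab.\<close>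
    then obtain t0 where t0: "0 < t0" "t0 < r" "g (?\<alpha> t0) < c" "a < g (?\<alpha> t0)"
      using lin eventually_happens'[OF trivial_limit_at_right_real ev] by force
    define s where "s = nat \<bar>\<mu>\<bar>"
    have "?\<alpha> t0 \<in> F" using nice[OF t0(1,2)] unfolding nice_def by blast
    then obtain m where "m \<noteq> 0" "nat \<bar>m\<bar> dvd N" "nice g m (?\<alpha> t0)" using regular t0 by blast
    then have \<mu>0: "\<mu> \<noteq> 0" and dvd: "s dvd N" using nice_unique[OF nice[OF t0(1,2)]] by (auto simp: s_def)
    have s: "0 < s" using \<mu>0 by (simp add: s_def)
    have sx: "abs_slope g x = s" if gx: "a < g x" "g x < c"
    proof -
      obtain m where m: "nice g m x" using regular[OF x gx] by blast
      have "real_of_int \<mu> = real_of_int m \<or> real_of_int \<mu> = - real_of_int m"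
        using nice_arm[OF m] k has_slope_unique[OF \<mu>] by (metis One_nat_def less_2_cases)
      then have "\<bar>\<mu>\<bar> = \<bar>m\<bar>" by linarith
      then show ?thesis using abs_slope_eq[OF m] by (simp add: s_def)
    qed
    define v where "v = (c - g x) / s - real (j div s) * l"
    have lx: "layer j x = ramp l v" unfolding v_def by (rule layer_eq[OF 3(1,2) s dvd j sx])
    have ratio: "real_of_int \<mu> / real s = sgn \<mu>"
      using \<mu>0 by (auto simp: s_def sgn_if)
    obtain m :: int where m: "\<bar>m\<bar> \<le> (1::int)"
      "\<forall>\<^sub>F t in at_right 0. ramp l (v + real_of_int (- sgn \<mu>) * t) = ramp l v + real_of_int m * t"
      "0 < ramp l v \<and> ramp l v < l \<longrightarrow> m = - sgn \<mu>"
    proof -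
      have "\<bar>- sgn \<mu>\<bar> \<le> 1" by (simp add: sgn_if)
      from ramp_slope[OF l_pos this, of v] show ?thesis using that by blast
    qed
    have "\<forall>\<^sub>F t in at_right 0. layer j (?\<alpha> t) = ramp l (v + real_of_int (- sgn \<mu>) * t)"
      using ev
    proof (rule eventually_mono)
      fix t assume t: "(0 < t \<and> t < r) \<and> g x + real_of_int \<mu> * t < c \<and> a < g x + real_of_int \<mu> * t"
      then have gt: "g (?\<alpha> t) = g x + real_of_int \<mu> * t" using lin by simp
      have "layer j (?\<alpha> t) = ramp l ((c - g (?\<alpha> t)) / s - real (j div s) * l)"
        using t gt nice[of t] by (intro layer_eq s dvd j) (auto simp: abs_slope_eq s_def)
      also have "(c - g (?\<alpha> t)) / s - real (j div s) * l = v - real_of_int \<mu> / real s * t"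
        unfolding gt v_def by (simp add: diff_divide_distrib add_divide_distrib)
      finally show "layer j (?\<alpha> t) = ramp l (v + real_of_int (- sgn \<mu>) * t)" unfolding ratio by simp
    qed
    with m(2) have "\<forall>\<^sub>F t in at_right 0. layer j (?\<alpha> t) = layer j (?\<alpha> 0) + real_of_int m * t"
      by eventually_elim (simp add: \<alpha>0 lx)
    then have "has_slope (layer j) ?\<alpha> m" unfolding has_slope_def .
    moreover have "0 < \<mu> \<and> 0 < layer j x \<and> layer j x < l \<longrightarrow> m = - 1" using m(3) lx by simp
    ultimately show ?thesis using m(1) by blast
  qed
qed

lemma PL_layer:
  assumes j: "j < N" shows "PL (layer j)"
proof -
  have "\<exists>m::int. has_slope (layer j) (arm x k) m" if "x \<in> F" "k < valence x" for x k
  proof -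
    obtain \<mu> :: int where "has_slope g (arm x k) \<mu>" using PL_g \<open>x \<in> F\<close> \<open>k < valence x\<close> unfolding PL_def by blast
    from layer_arm[OF \<open>x \<in> F\<close> \<open>k < valence x\<close> j this] show ?thesis by blast
  qed
  moreover have "locally_const_at_ends (layer j)"
  proof (rule locally_constI)
    fix p assume p: "p \<in> ends"
    have "locally_const_at_ends g" using PL_g unfolding PL_def by blast
    then obtain \<rho> T c0 where T: "0 \<le> T" "end_chart \<Gamma> p \<rho>" "\<And>t. T \<le> t \<Longrightarrow> g (\<rho> t) = c0"
      by (rule locally_constD[OF _ p]) (rule that)
    \<comment> \<open>The tail at an end is flat, and slope 0 is excluded inside the slab.\<close>
    have "\<not> (a < c0 \<and> c0 < c)"
    proof
      assume c0: "a < c0 \<and> c0 < c"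
      have F: "\<rho> (T + 1) \<in> F" using T(1,2) unfolding end_chart_def by simp
      have "nice g 0 (\<rho> (T + 1))"
        by (rule nice_of_segment[OF end_segment[OF T(2) p T(1), of "T + 2"]]) (simp_all add: T(3))
      moreover obtain m where "m \<noteq> 0" "nice g m (\<rho> (T + 1))" using regular[OF F] T(3)[of "T + 1"] c0 by auto
      ultimately show False using nice_unique by fastforce
    qed
    then have "layer j (\<rho> t) = (if c \<le> c0 then 0 else l)" if "t > T" for t
      using T(3)[of t] that by (auto simp: layer_def)
    then show "\<exists>\<rho> T b. 0 \<le> T \<and> end_chart \<Gamma> p \<rho> \<and> (\<forall>t>T. layer j (\<rho> t) = b)" using T(1,2) by blast
  qed
  ultimately show ?thesis unfolding PL_def by blast
qed

lemma layer_fires: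
  assumes j: "j < N" shows "fires (layer j)"
proof -
  have bd: "0 \<le> layer j y" "layer j y \<le> l" for y
    using l_pos by (auto simp: layer_def ramp_def)
  have sl: "\<bar>m\<bar> \<le> 1" if x: "x \<in> F" and k: "k < valence x" and m: "has_slope (layer j) (arm x k) m" for x k m
  proof -
    obtain \<mu> :: int where "has_slope g (arm x k) \<mu>" using PL_g x k unfolding PL_def by blast
    from layer_arm[OF x k j this] obtain n :: int
      where n: "\<bar>n\<bar> \<le> (1::int)" "has_slope (layer j) (arm x k) (real_of_int n)" by blast
    then have "\<bar>real_of_int n\<bar> \<le> 1" by linarith
    then show ?thesis using has_slope_unique[OF m n(2)] by simp
  qed
  have desc: "\<exists>k<valence y. has_slope (layer j) (arm y k) (- 1)"
    if y: "y \<in> F" and pos: "0 < layer j y" "layer j y < l" for y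
  proof -
    \<comment> \<open>A value strictly between \<open>0\<close> and \<open>l\<close> is possible
      only inside the slab, where \<open>g\<close> has an ascending arm; the layer descends along
      it.\<close>
    have "a < g y" "g y < c" using pos by (auto simp: layer_def split: if_splits)
    then obtain m where m: "m \<noteq> 0" "nice g m y" using regular[OF y] by blast
    obtain k where k: "k < valence y" "has_slope g (arm y k) (real_of_int \<bar>m\<bar>)"
      using nice_ascending_arm[OF m(2)] by blast
    from layer_arm[OF y k(1) j k(2)] show ?thesis using pos m(1) k(1) by force
  qed
  have "real_of_ereal (CF \<Gamma> (zero_set (layer j)) l x) = - layer j x" if "x \<in> F" for x
    by (rule PL_eq_CF[OF PL_layer[OF j] bd sl desc that])
  then show ?thesis unfolding fires_def
    using PL_layer[OF j] subgraph_zero_set[OF PL_layer[OF j]] l_pos by blast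
qed

text \<open>Inside the slab, at a point of slope \<open>s\<close>, the moves form
  \<open>N / s\<close> blocks of \<open>s\<close> equal ramps, and one ramp from each block tiles
  the distance \<open>(c - g x) / s\<close> from the upper end of the edge.\<close>

lemma sum_layer:
  assumes x: "x \<in> F" shows "(\<Sum>j<N. layer j x) = c - max a (min c (g x))"
proof -
  consider "c \<le> g x" | "g x \<le> a" | "a < g x" "g x < c" by linarith
  then show ?thesis
  proof cases
    case 1 then show ?thesis using ac by (simp add: layer_def)
  next
    case 2 then show ?thesis using ac N by (simp add: layer_def l_def)
  next
    case 3
    obtain m where m: "m \<noteq> 0" "nat \<bar>m\<bar> dvd N" "nice g m x" using regular[OF x 3] by blast
    define s where "s = nat \<bar>m\<bar>"
    have s: "0 < s" "abs_slope g x = s" using m abs_slope_eq by (auto simp: s_def)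
    obtain P where P: "N = P * s" using m(2) by (metis dvdE mult.commute s_def)
    define v where "v = (c - g x) / s"
    have "real P * l = (c - a) / s" unfolding l_def using N by (simp add: P)
    then have v: "0 < v" "v \<le> real P * l" using 3 s(1) by (auto simp: v_def divide_right_mono)
    have "(\<Sum>j<N. layer j x) = (\<Sum>j<N. ramp l (v - real (j div s) * l))"
      using 3 s by (simp add: layer_def v_def)
    also have "\<dots> = (\<Sum>j<P * s. ramp l (v - real (j div s) * l))"
      using arg_cong[OF P, of "\<lambda>n. \<Sum>j<n. ramp l (v - real (j div s) * l)"] .
    also have "\<dots> = real s * (\<Sum>q<P. ramp l (v - real q * l))"
      using sum_div_blocks[OF s(1), of "\<lambda>q. ramp l (v - real q * l)"] .
    also have "\<dots> = real s * v" unfolding sum_ramp[OF l_pos] using v by simp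
    also have "\<dots> = c - g x" using s(1) by (simp add: v_def)
    finally show ?thesis using 3 by simp
  qed
qed

text \<open>Rests on the identity \<open>min a v + max a (min c v) = a + min c v\<close> for
  \<open>a < c\<close>; the constant \<open>c - a\<close> is added at no cost because constants have
  order 0.\<close>

lemma reaches_next_level:
  assumes "reaches D (\<lambda>x. min a (g x))" shows "reaches D (\<lambda>x. min c (g x))"
proof (rule reaches_cong)
  show "reaches D (\<lambda>x. (min a (g x) + (c - a)) - (\<Sum>j<N. layer j x))"
    by (rule reaches_fire_sum[OF reaches_add_const[OF assms] layer_fires])
  show "(min a (g x) + (c - a)) - (\<Sum>j<N. layer j x) = min c (g x)" if "x \<in> F" for x
    unfolding sum_layer[OF that] using ac by (auto simp: min_def max_def)
qed

end

section \<open>Assembling the slabs, and the equivalence\<close>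

context tropical
begin

lemma F_nonempty: "F \<noteq> {}"
proof
  assume F: "F = {}"
  have "points \<Gamma> \<noteq> {}" using tropical unfolding tropical_curve_def by blast
  then obtain p where p: "p \<in> ends" using F points_eq by blast
  obtain \<rho> where "end_chart \<Gamma> p \<rho>" using end_chart_ex[OF p] by blast
  then have "\<rho> 0 \<in> F" unfolding end_chart_def by blast
  then show False using F by blast
qed

text \<open>The finite part need not be compact, so the maximum is taken for the continuous
  extension to the whole curve. If it occurs at an end, a point of the constant tail has the same
  value.\<close>

lemma PL_attains_max:
  assumes g: "PL g"
  shows "\<exists>y\<in>F. \<forall>x\<in>F. g x \<le> g y"
proof -
  obtain f where f: "rational_function \<Gamma> f" "\<And>x. x \<in> F \<Longrightarrow> f x = ereal (g x)"
    using PL_imp_rational[OF g] by blast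
  have cont: "continuous_map X euclidean f" using f(1) unfolding rational_function_def by blast
  have "compactin X (topspace X)" using compact_X unfolding compact_space_def .
  then have "compact (f ` topspace X)" using image_compactin[OF _ cont] by simp
  moreover have "f ` topspace X \<noteq> {}" using F_nonempty topspace_X by blast
  ultimately obtain z where z: "z \<in> topspace X" "\<And>x. x \<in> topspace X \<Longrightarrow> f x \<le> f z"
    using compact_attains_sup[of "f ` topspace X"] by blast
  show ?thesis
  proof (cases "z \<in> F")
    case True
    have "g x \<le> g z" if "x \<in> F" for x
      using z(2)[of x] f(2)[OF that] f(2)[OF True] that topspace_X by auto
    then show ?thesis using True by blast
  next
    case False
    then have p: "z \<in> ends" using z topspace_X by blast
    have "locally_const_at_ends g" using g unfolding PL_def by blast
    then obtain \<rho> T c where T: "0 \<le> T" "end_chart \<Gamma> z \<rho>" "\<And>t. T \<le> t \<Longrightarrow> g (\<rho> t) = c"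
      by (rule locally_constD[OF _ p]) (rule that)
    have F: "\<rho> t \<in> F" if "0 \<le> t" for t using T(2) that unfolding end_chart_def by blast
    have "limitin euclidean (f \<circ> \<rho>) (f z) at_top"
      using continuous_map_limit[OF cont] T(2) unfolding end_chart_def by blast
    then have "((\<lambda>t. f (\<rho> t)) \<longlongrightarrow> f z) at_top" by (simp add: o_def)
    moreover have "\<forall>\<^sub>F t in at_top. f (\<rho> t) = ereal c"
      using eventually_ge_at_top[of T] by eventually_elim (use T(1,3) F f(2) in auto)
    ultimately have "f z = ereal c" 
      using tendsto_unique[OF trivial_limit_at_top_linorder _ tendsto_eventually] by blast
    then have "g x \<le> g (\<rho> T)" if "x \<in> F" for x
      using z(2)[of x] f(2)[OF that] that topspace_X T(3)[of T] by auto
    then show ?thesis using F[OF T(1)] by blast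
  qed
qed

text \<open>At a noncritical value there is an ascending arm, so the maximum is critical. Applied to
  \<open>- g\<close> this also gives a critical lower bound.\<close>

lemma max_is_critical:
  assumes g: "PL g" and C: "\<And>y. y \<in> F \<Longrightarrow> g y \<notin> C \<Longrightarrow> \<exists>m. m \<noteq> 0 \<and> nice g m y"
  shows "\<exists>c\<in>C. \<forall>x\<in>F. g x \<le> c"
proof -
  obtain y where y: "y \<in> F" "\<And>x. x \<in> F \<Longrightarrow> g x \<le> g y" using PL_attains_max[OF g] by blast
  have "g y \<in> C"
  proof (rule ccontr)
    assume "g y \<notin> C"
    then obtain m where m: "m \<noteq> 0" "nice g m y" using C y(1) by blast
    obtain k where k: "k < valence y" "has_slope g (arm y k) (real_of_int \<bar>m\<bar>)"
      using nice_ascending_arm[OF m(2)] by blast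
    obtain e where e: "0 < e" "\<forall>t\<in>{0..<e}. g (arm y k t) = g y + real_of_int \<bar>m\<bar> * t"
      using k(2) arm_0[OF y(1) k(1)] unfolding has_slope_iff by auto
    obtain r where r: "0 < r" "good_chart y (valence y) r (arm y)" using arm_good[OF y(1)] by blast
    define t where "t = min e r / 2"
    have t: "0 < t" "t < e" "t \<le> r" using e(1) r(1) by (auto simp: t_def min_def)
    have "arm y k t \<in> F" using good_chart_arm_d(1)[OF r(2) k(1), of t] t by simp
    moreover have "g (arm y k t) = g y + real_of_int \<bar>m\<bar> * t" using e(2) t by simp
    moreover have "0 < real_of_int \<bar>m\<bar> * t" using m(1) t(1) by simp
    ultimately show False using y(2)[of "arm y k t"] by simp
  qed
  then show ?thesis using y(2) by blast
qed

text \<open>The truncation \<open>min c g\<close> is constant for the lowest critical value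
  \<open>bot\<close> and equals \<open>g\<close> for the highest one \<open>top\<close>; each slab
  raises \<open>c\<close> to the next critical value.\<close>

lemma PL_reaches:
  assumes g: "PL g" and D: "divisor \<Gamma> D"
  shows "reaches D g"
proof -
  obtain S M C where S: "finite S" "finite M" "finite C"
    "\<And>y. y \<in> points \<Gamma> - S \<Longrightarrow> \<exists>m\<in>M. nice g m y \<and> (m = 0 \<longrightarrow> g y \<in> C)"
    "\<And>y. y \<in> S \<Longrightarrow> y \<in> F \<Longrightarrow> g y \<in> C"
    by (rule PL_finite_structure[OF g]) (rule that)
  have C: "\<exists>m\<in>M. m \<noteq> 0 \<and> nice g m y" if "y \<in> F" "g y \<notin> C" for y
  proof -
    have "y \<in> points \<Gamma> - S" using S(5)[of y] that points_eq by blast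
    from S(4)[OF this] show ?thesis using that(2) by blast
  qed
  \<comment> \<open>All slopes in \<open>M\<close> are at most \<open>B\<close> in absolute value,
    so \<open>fact B\<close> is a multiple of every nonzero one and serves as \<open>N\<close> in
    all slabs. Inserting 0 keeps \<open>Max\<close> meaningful for empty \<open>M\<close>.\<close>
  define B where "B = Max (insert 0 ((\<lambda>m. nat \<bar>m\<bar>) ` M))"
  have B: "nat \<bar>m\<bar> \<le> B" if "m \<in> M" for m unfolding B_def using S(2) that by (intro Max_ge) auto
  have crit: "\<exists>m. m \<noteq> 0 \<and> nice g m y" if "y \<in> F" "g y \<notin> C" for y using C[OF that] by blast
  obtain top where top: "top \<in> C" "\<forall>x\<in>F. g x \<le> top"
    using max_is_critical[OF g crit] by blast
  have "\<exists>b\<in>uminus ` C. \<forall>x\<in>F. - g x \<le> b"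
  proof (rule max_is_critical[OF PL_minus[OF g]])
    fix y assume "y \<in> F" "- g y \<notin> uminus ` C"
    then obtain m where "m \<noteq> 0" "nice g m y" using crit[of y] by force
    then show "\<exists>m. m \<noteq> 0 \<and> nice (\<lambda>x. - g x) m y" using nice_minus[of g m y] by (intro exI[of _ "- m"]) simp
  qed
  then obtain bot where bot: "bot \<in> C" "\<forall>x\<in>F. - g x \<le> - bot" by blast
  have level: "reaches D (\<lambda>x. min c (g x))" if "c \<in> C" "bot \<le> c" for c
    using that
  proof (induction "card {b \<in> C. b < c}" arbitrary: c rule: less_induct)
    case less
    show ?case
    proof (cases "c = bot")
      case True
      then show ?thesis using bot(2) by (intro reaches_cong[OF reaches_const[OF D, of c]]) simp
    next
      case False
      \<comment> \<open>The critical value directly below \<open>c\<close>, so that no critical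
        value lies strictly between the two.\<close>
      define a where "a = Max {b \<in> C. b < c}"
      have fin: "finite {b \<in> C. b < c}" using S(3) by simp
      have bot_in: "bot \<in> {b \<in> C. b < c}" using bot(1) less.prems False by simp
      then have "{b \<in> C. b < c} \<noteq> {}" by blast
      then have a: "a \<in> C" "a < c" using Max_in[OF fin] by (auto simp: a_def)
      have gap: "b \<notin> C" if "a < b" "b < c" for b
        using Max_ge[OF fin, of b] that by (auto simp: a_def)
      have "bot \<le> a" using Max_ge[OF fin bot_in] by (simp add: a_def)
      moreover have "card {b \<in> C. b < a} < card {b \<in> C. b < c}"
        using a fin by (intro psubset_card_mono) auto
      ultimately have IH: "reaches D (\<lambda>x. min a (g x))" using less.hyps a(1) by blast
      interpret slab \<Gamma> g a c "fact B"
      proof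
        fix x assume x: "x \<in> F" "a < g x" "g x < c"
        then obtain m where m: "m \<in> M" "m \<noteq> 0" "nice g m x" using C gap by blast
        have "nat \<bar>m\<bar> dvd fact B" using B[OF m(1)] m(2) by (intro dvd_fact) auto
        then show "\<exists>m. m \<noteq> 0 \<and> nat \<bar>m\<bar> dvd fact B \<and> nice g m x" using m by blast
      qed (use g a in auto)
      show ?thesis by (rule reaches_next_level[OF IH])
    qed
  qed
  obtain x where "x \<in> F" using F_nonempty by blast
  then have "bot \<le> top" using top(2) bot(2) by fastforce
  then have "reaches D (\<lambda>x. min top (g x))" by (rule level[OF top(1)])
  then show ?thesis by (rule reaches_cong) (use top(2) in simp)
qed

lemma attainable_imp_PL:
  assumes "(chip_firing_step \<Gamma>)\<^sup>*\<^sup>* D D'"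
  shows "\<exists>g. PL g \<and> (\<forall>x\<in>points \<Gamma>. of_int (D' x) = of_int (D x) + Ord g x)"
  using assms
proof (induction rule: rtranclp_induct)
  case base
  then show ?case using PL_const[of 0] Ord_const[of _ 0] by (intro exI[of _ "\<lambda>x. 0"]) auto
next
  case (step E E')
  obtain g where g: "PL g" "\<forall>x\<in>points \<Gamma>. of_int (E x) = of_int (D x) + Ord g x" using step.IH by blast
  obtain A l where A: "subgraph \<Gamma> A" "\<forall>x\<in>points \<Gamma>. of_int (E' x) = of_int (E x) + ord_at \<Gamma> (CF \<Gamma> A l) x"
    using step.hyps(2) unfolding chip_firing_step_def by blast
  obtain u where u: "PL u" "\<And>x. x \<in> F \<Longrightarrow> real_of_ereal (CF \<Gamma> A l x) = u x" using CF_PL[OF A(1)] by blast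
  have "of_int (E' x) = of_int (D x) + Ord (\<lambda>x. g x + u x) x" if "x \<in> points \<Gamma>" for x
    using A(2) g(2) ord_at_eq_Ord[OF u that] Ord_add[OF g(1) u(1) that] that by simp
  then show ?case using PL_add[OF g(1) u(1)] by blast
qed

end

theorem proposition3:
  fixes \<Gamma> :: "'a curve_data" and D D' :: "'a \<Rightarrow> int"
  assumes "tropical_curve \<Gamma>"
    and "divisor \<Gamma> D" and "divisor \<Gamma> D'"
  shows "linearly_equivalent \<Gamma> D D' \<and> (\<forall>p\<in>inf_pts \<Gamma>. D p = D' p)
     \<longleftrightarrow> attainable_from \<Gamma> D D'"
proof -
  interpret tropical \<Gamma> by unfold_locales (rule assms(1))
  show ?thesis
  proof
    assume L: "linearly_equivalent \<Gamma> D D' \<and> (\<forall>p\<in>inf_pts \<Gamma>. D p = D' p)"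
    then obtain f where f: "rational_function \<Gamma> f"
      "\<forall>x\<in>points \<Gamma>. of_int (D x - D' x) = ord_at \<Gamma> f x"
      unfolding linearly_equivalent_def by blast
    let ?g = "\<lambda>x. real_of_ereal (f x)"
    have "ord_at \<Gamma> f p = 0" if "p \<in> inf_pts \<Gamma>" for p
      using f(2) L that points_eq by force
    then have g: "PL ?g" using rational_imp_PL[OF f(1)] by blast
    \<comment> \<open>Linear equivalence provides \<open>D - D' = (f)\<close>, whereas moves add to
      \<open>D\<close>; hence the moves realise the negative of \<open>f\<close>.\<close>
    obtain E where E: "(chip_firing_step \<Gamma>)\<^sup>*\<^sup>* D E" "divisor \<Gamma> E"
      "\<forall>x\<in>points \<Gamma>. of_int (E x) = of_int (D x) + Ord (\<lambda>x. - ?g x) x"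
      using PL_reaches[OF PL_minus[OF g] assms(2)] unfolding reaches_def by blast
    have "E x = D' x" for x
    proof (cases "x \<in> points \<Gamma>")
      case True
      have "of_int (E x) = of_int (D x) - ord_at \<Gamma> f x"
        using E(3) Ord_minus[OF g True] ord_at_eq_Ord[OF g _ True, of f] True by simp
      also have "\<dots> = real_of_int (D' x)" using f(2) True by (metis of_int_diff diff_diff_eq2 add_diff_cancel_left')
      finally show ?thesis by simp
    next
      case False
      then have "E x = 0" "D' x = 0" using E(2) assms(3) unfolding divisor_def by blast+
      then show ?thesis by simp
    qed
    then have "E = D'" ..
    then show "attainable_from \<Gamma> D D'" using E(1) unfolding attainable_from_def by simp
  next
    assume "attainable_from \<Gamma> D D'"
    then obtain g where g: "PL g" "\<forall>x\<in>points \<Gamma>. of_int (D' x) = of_int (D x) + Ord g x"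
      using attainable_imp_PL unfolding attainable_from_def by blast
    obtain f where f: "rational_function \<Gamma> f" "\<And>x. x \<in> fin_pts \<Gamma> \<Longrightarrow> f x = ereal (- g x)"
      using PL_imp_rational[OF PL_minus[OF g(1)]] by blast
    have "of_int (D x - D' x) = ord_at \<Gamma> f x" if "x \<in> points \<Gamma>" for x
      using ord_at_eq_Ord[OF PL_minus[OF g(1)] _ that, of f] f(2) Ord_minus[OF g(1) that] g(2) that by simp
    then have "linearly_equivalent \<Gamma> D D'" using f(1) unfolding linearly_equivalent_def by blast
    moreover have "\<forall>p\<in>inf_pts \<Gamma>. D p = D' p" using g Ord_end points_eq by force
    ultimately show "linearly_equivalent \<Gamma> D D' \<and> (\<forall>p\<in>inf_pts \<Gamma>. D p = D' p)" ..
  qed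
qed

end
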